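(* Let $\mathcal G$ be a Voevodsky pro-$3$ group with independent characters $\chi_1,\chi_2\in H^1(\mathcal G,\mathbb Z/3\mathbb Z)$, and let $n\ge1$. Suppose $[c]\in H^{n-1}(\mathcal G,\mathcal M_4\otimes_{\mathbb Z}\mathbb Z/3\mathbb Z)$. Then the composite satisfies $h_3(\mathcal B([c]))=0\in H^n(\mathcal G,\mathcal M_3\otimes_{\mathbb Z}\mathbb Z/3\mathbb Z)$.
   Context: A pro-$3$ group $\mathcal G$ is a Voevodsky group if (a) for $\mathcal G$ and each of its closed subgroups $\mathcal K$ the reduction maps $H^n(\mathcal K,\mathbb Z/9\mathbb Z)\to H^n(\mathcal K,\mathbb Z/3\mathbb Z)$ are surjective for all $n$, and (b) every normal subgroup $\mathcal N$ of $\mathcal G$ with $\mathcal G/\mathcal N\cong\mathbb Z/3\mathbb Z$ contains a normal subgroup $\widetilde{\mathcal N}$ of $\mathcal G$ with $\mathcal G/\widetilde{\mathcal N}\cong\mathbb Z/9\mathbb Z$. Let $G=\langle\tau_1,\tau_2\rangle\cong\mathbb Z/3\mathbb Z\oplus\mathbb Z/3\mathbb Z$, with $\mathcal G$ acting on $\mathbb Z[G]$-modules through $\gamma\mapsto\tau_1^{\chi_1(\gamma)}\tau_2^{\chi_2(\gamma)}$. Put $t_k=\tau_k-1$ $(k=1,2)$, $\tau_3=\tau_1\tau_2$, $\tau_4=\tau_1\tau_2^2$, $T_k=1+\tau_k+\tau_k^2$, $T_G=\sum_{g\in G}g$. Let $\mathcal M_2=\mathbb Z[G]\oplus\mathbb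 Z[G]T_G$, $\mathcal M_3=\mathbb Z[G]\oplus\mathbb Z[G]\oplus\mathbb Z[G]T_3\oplus\mathbb Z[G]T_4$, $d_2(\xi,mT_G)=(-\xi t_1,-\xi t_2,\xi T_3+mT_G,\xi T_4+mT_G)$, $\mathcal M_4=\mathrm{cok}(d_2:\mathcal M_2\to\mathcal M_3)$ (which is $\mathbb Z$-free). Let $\kappa_1=-(\tau_1+2\tau_1^2)$, $\kappa_2=-(\tau_2+2\tau_2^2)$, so that $t_1\kappa_1+t_2\kappa_2+T_3+T_4=T_G-3$. Define $h_2:\mathcal M_3\to\mathcal M_2$ by $h_2(\xi_1,\xi_2,\xi_3T_3,\xi_4T_4)=(\xi_1\kappa_1+\xi_2\kappa_2-\xi_3T_3-\xi_4T_4,\ \xi_3T_3T_G)$ and the (well-defined) $G$-map $h_3:\mathcal M_4\to\mathcal M_3$ by $h_3([m])=3m-d_2(h_2(m))$; $h_3$ also denotes the map induced on cohomology with coefficients tensored with $\mathbb Z/3\mathbb Z$. $\mathcal B:H^{n-1}(\mathcal G,\mathcal M_4\otimes\mathbb Z/3\mathbb Z)\to H^{n}(\mathcal G,\mathcal M_4\otimes\mathbb Z/3\mathbb Z)$ is the Bockstein (connecting) map of the short exact sequence $0\to\mathcal M_4\otimes\mathbb Z/3\mathbb Z\to\mathcal M_4\otimes\mathbb Z/9\mathbb Z\to\mathcal M_4\otimes\mathbb Z/3\mathbb Z\to0$. *)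

theory Defs
  imports
    "HOL-Analysis.Analysis"
    "HOL-Algebra.Free_Abelian_Groups"
    "HOL-Algebra.Elementary_Groups"
    "HOL-Algebra.Generated_Groups"
    "HOL-Library.Poly_Mapping"
    "HOL-Library.Numeral_Type"
    "HOL-Library.Product_Plus"
begin

section \<open>Profinite groups\<close>

definition topological_group :: "('a, 'x) monoid_scheme \<Rightarrow> 'a topology \<Rightarrow> bool" where
  "topological_group G T \<longleftrightarrow>
     group G \<and> topspace T = carrier G \<and>
     continuous_map (prod_topology T T) T (\<lambda>(x, y). x \<otimes>\<^bsub>G\<^esub> y) \<and>
     continuous_map T T (\<lambda>x. inv\<^bsub>G\<^esub> x)"

definition profinite_group :: "('a, 'x) monoid_scheme \<Rightarrow> 'a topology \<Rightarrow> bool" where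
  "profinite_group G T \<longleftrightarrow>
     topological_group G T \<and> compact_space T \<and> Hausdorff_space T \<and>
     (\<forall>x\<in>topspace T. connected_component_of_set T x = {x})"

definition pro_p_group :: "nat \<Rightarrow> ('a, 'x) monoid_scheme \<Rightarrow> 'a topology \<Rightarrow> bool" where
  "pro_p_group p G T \<longleftrightarrow>
     profinite_group G T \<and>
     (\<forall>N. N \<lhd> G \<and> openin T N \<longrightarrow> (\<exists>k. card (rcosets\<^bsub>G\<^esub> N) = p ^ k))"


section \<open>Continuous cohomology with discrete coefficients\<close>

text \<open>
  Abelian groups of coefficients are monoid records, hence written multiplicatively. A discrete
  module is such a record \<open>A\<close> together with an action \<open>act\<close>. An \<open>n\<close>-cochain is a continuous map
  from the \<open>n\<close>-fold product of the group to the discrete space \<open>carrier A\<close>; tuples are extensional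
  functions on \<open>{..<n}\<close>, so the product for \<open>n = 0\<close> is a single point. Cochains are made
  extensional so that equality of cochains is equality of functions.
\<close>

abbreviation tuples :: "('a, 'x) monoid_scheme \<Rightarrow> nat \<Rightarrow> (nat \<Rightarrow> 'a) set" where
  "tuples G n \<equiv> {..<n} \<rightarrow>\<^sub>E carrier G"

definition cochains ::
  "('a, 'x) monoid_scheme \<Rightarrow> 'a topology \<Rightarrow> ('m, 'y) monoid_scheme \<Rightarrow> nat \<Rightarrow> ((nat \<Rightarrow> 'a) \<Rightarrow> 'm) set" where
  "cochains G T A n =
     {f \<in> extensional (tuples G n).
        continuous_map (product_topology (\<lambda>_. T) {..<n}) (discrete_topology (carrier A)) f}"

definition cochain_group ::
  "('a, 'x) monoid_scheme \<Rightarrow> 'a topology \<Rightarrow> ('m, 'y) monoid_scheme \<Rightarrow> nat \<Rightarrow> ((nat \<Rightarrow> 'a) \<Rightarrow> 'm) monoid" where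
  "cochain_group G T A n =
     \<lparr>carrier = cochains G T A n,
      monoid.mult = (\<lambda>f f'. \<lambda>g\<in>tuples G n. f g \<otimes>\<^bsub>A\<^esub> f' g),
      one = (\<lambda>g\<in>tuples G n. \<one>\<^bsub>A\<^esub>)\<rparr>"

text \<open>
  The tuple \<open>(g 0, \<dots>, g i \<cdot> g (i + 1), \<dots>, g n)\<close> of length \<open>n\<close>, for \<open>i < n\<close>.
\<close>

definition face :: "('a, 'x) monoid_scheme \<Rightarrow> nat \<Rightarrow> nat \<Rightarrow> (nat \<Rightarrow> 'a) \<Rightarrow> nat \<Rightarrow> 'a" where
  "face G n i g =
     (\<lambda>j\<in>{..<n}. if j < i then g j else if j = i then g i \<otimes>\<^bsub>G\<^esub> g (Suc i) else g (Suc j))"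

text \<open>
  The inhomogeneous differential, in additive notation
  \[g_0 f(g_1, \dots, g_n) + \sum_{i<n} (-1)^{i+1} f(g_0, \dots, g_i g_{i+1}, \dots, g_n)
      + (-1)^{n+1} f(g_0, \dots, g_{n-1}).\]
\<close>

definition coboundary ::
  "('a, 'x) monoid_scheme \<Rightarrow> ('m, 'y) monoid_scheme \<Rightarrow> ('a \<Rightarrow> 'm \<Rightarrow> 'm) \<Rightarrow> nat \<Rightarrow>
   ((nat \<Rightarrow> 'a) \<Rightarrow> 'm) \<Rightarrow> (nat \<Rightarrow> 'a) \<Rightarrow> 'm" where
  "coboundary G A act n f =
     (\<lambda>g\<in>tuples G (Suc n).
        act (g 0) (f (\<lambda>j\<in>{..<n}. g (Suc j)))
        \<otimes>\<^bsub>A\<^esub> (\<Otimes>\<^bsub>A\<^esub>i\<in>{..<n}. f (face G n i g) [^]\<^bsub>A\<^esub> ((-1) ^ Suc i :: int))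
        \<otimes>\<^bsub>A\<^esub> f (\<lambda>j\<in>{..<n}. g j) [^]\<^bsub>A\<^esub> ((-1) ^ Suc n :: int))"

definition cocycles ::
  "('a, 'x) monoid_scheme \<Rightarrow> 'a topology \<Rightarrow> ('m, 'y) monoid_scheme \<Rightarrow> ('a \<Rightarrow> 'm \<Rightarrow> 'm) \<Rightarrow> nat \<Rightarrow>
   ((nat \<Rightarrow> 'a) \<Rightarrow> 'm) set" where
  "cocycles G T A act n =
     {f \<in> cochains G T A n. coboundary G A act n f = \<one>\<^bsub>cochain_group G T A (Suc n)\<^esub>}"

definition coboundaries ::
  "('a, 'x) monoid_scheme \<Rightarrow> 'a topology \<Rightarrow> ('m, 'y) monoid_scheme \<Rightarrow> ('a \<Rightarrow> 'm \<Rightarrow> 'm) \<Rightarrow> nat \<Rightarrow>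
   ((nat \<Rightarrow> 'a) \<Rightarrow> 'm) set" where
  "coboundaries G T A act n =
     (case n of 0 \<Rightarrow> {\<one>\<^bsub>cochain_group G T A 0\<^esub>}
      | Suc m \<Rightarrow> coboundary G A act m ` cochains G T A m)"

definition cohomology ::
  "('a, 'x) monoid_scheme \<Rightarrow> 'a topology \<Rightarrow> ('m, 'y) monoid_scheme \<Rightarrow> ('a \<Rightarrow> 'm \<Rightarrow> 'm) \<Rightarrow> nat \<Rightarrow>
   ((nat \<Rightarrow> 'a) \<Rightarrow> 'm) set monoid" where
  "cohomology G T A act n =
     (cochain_group G T A n)\<lparr>carrier := cocycles G T A act n\<rparr> Mod coboundaries G T A act n"

text \<open>
  The map \<open>A / K \<rightarrow> B / L\<close> induced by \<open>f : A \<rightarrow> B\<close>, evaluated at a coset \<open>S\<close>. It is meaningful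
  when \<open>f\<close> is a homomorphism with \<open>f ` K \<subseteq> L\<close>.
\<close>

definition quotient_map_of ::
  "('b, 'y) monoid_scheme \<Rightarrow> 'b set \<Rightarrow> ('a \<Rightarrow> 'b) \<Rightarrow> 'a set \<Rightarrow> 'b set" where
  "quotient_map_of B L f S = the_elem ((\<lambda>x. r_coset B L (f x)) ` S)"

text \<open>
  The map in degree \<open>n\<close> induced by a coefficient homomorphism \<open>\<phi>\<close> into the module \<open>(B, act)\<close>.
\<close>

definition cohomology_map ::
  "('a, 'x) monoid_scheme \<Rightarrow> 'a topology \<Rightarrow> ('m2, 'z) monoid_scheme \<Rightarrow> ('a \<Rightarrow> 'm2 \<Rightarrow> 'm2) \<Rightarrow>
   ('m1 \<Rightarrow> 'm2) \<Rightarrow> nat \<Rightarrow> ((nat \<Rightarrow> 'a) \<Rightarrow> 'm1) set \<Rightarrow> ((nat \<Rightarrow> 'a) \<Rightarrow> 'm2) set" where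
  "cohomology_map G T B act \<phi> n =
     quotient_map_of (cochain_group G T B n) (coboundaries G T B act n)
       (\<lambda>f. \<lambda>g\<in>tuples G n. \<phi> (f g))"

text \<open>
  The connecting map from degree \<open>n\<close> to degree \<open>n + 1\<close> of a short exact sequence
  \<open>0 \<rightarrow> A' \<rightarrow> A \<rightarrow> A'' \<rightarrow> 0\<close> of modules with maps \<open>\<iota>\<close> and \<open>\<pi>\<close>: lift a cocycle \<open>f\<close> to a cochain
  \<open>e\<close> of \<open>A\<close>, and take the class of the cocycle \<open>b\<close> of \<open>A'\<close> with \<open>\<iota> \<circ> b = \<delta> e\<close>.
\<close>

definition connecting_map ::
  "('a, 'x) monoid_scheme \<Rightarrow> 'a topology \<Rightarrow> ('m1, 'y) monoid_scheme \<Rightarrow> ('a \<Rightarrow> 'm1 \<Rightarrow> 'm1) \<Rightarrow>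
   ('m2, 'z) monoid_scheme \<Rightarrow> ('a \<Rightarrow> 'm2 \<Rightarrow> 'm2) \<Rightarrow> ('m1 \<Rightarrow> 'm2) \<Rightarrow> ('m2 \<Rightarrow> 'm3) \<Rightarrow> nat \<Rightarrow>
   ((nat \<Rightarrow> 'a) \<Rightarrow> 'm3) set \<Rightarrow> ((nat \<Rightarrow> 'a) \<Rightarrow> 'm1) set" where
  "connecting_map G T A' act' A act \<iota> \<pi> n S =
     the_elem {r_coset (cochain_group G T A' (Suc n)) (coboundaries G T A' act' (Suc n)) b | b e f.
       f \<in> S \<and> e \<in> cochains G T A n \<and> b \<in> cocycles G T A' act' (Suc n) \<and>
       (\<forall>g\<in>tuples G n. \<pi> (e g) = f g) \<and>
       (\<forall>g\<in>tuples G (Suc n). \<iota> (b g) = coboundary G A act n e g)}"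


section \<open>Voevodsky groups\<close>

abbreviation Zmod :: "nat \<Rightarrow> int monoid" where
  "Zmod \<equiv> integer_mod_group"

abbreviation trivial_act :: "'a \<Rightarrow> 'm \<Rightarrow> 'm" where
  "trivial_act \<equiv> \<lambda>_ x. x"

text \<open>
  As usual for profinite groups, the normal subgroups of the second condition are closed ones.
\<close>

definition voevodsky_group :: "('a, 'x) monoid_scheme \<Rightarrow> 'a topology \<Rightarrow> bool" where
  "voevodsky_group G T \<longleftrightarrow>
     pro_p_group 3 G T \<and>
     (\<forall>K n. subgroup K G \<and> closedin T K \<longrightarrow>
        cohomology_map (G\<lparr>carrier := K\<rparr>) (subtopology T K) (Zmod 3) trivial_act (\<lambda>x. x mod 3) n
          ` carrier (cohomology (G\<lparr>carrier := K\<rparr>) (subtopology T K) (Zmod 9) trivial_act n)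
        = carrier (cohomology (G\<lparr>carrier := K\<rparr>) (subtopology T K) (Zmod 3) trivial_act n)) \<and>
     (\<forall>N. N \<lhd> G \<and> closedin T N \<and> G Mod N \<cong> Zmod 3 \<longrightarrow>
        (\<exists>N'. N' \<lhd> G \<and> closedin T N' \<and> N' \<subseteq> N \<and> G Mod N' \<cong> Zmod 9))"

text \<open>
  Elements of \<open>H\<^sup>1\<close> with trivial coefficients \<open>\<int>/3\<close> are the continuous homomorphisms.
\<close>

definition character3 :: "('a, 'x) monoid_scheme \<Rightarrow> 'a topology \<Rightarrow> ('a \<Rightarrow> int) \<Rightarrow> bool" where
  "character3 G T chi \<longleftrightarrow>
     chi \<in> hom G (Zmod 3) \<and> continuous_map T (discrete_topology (carrier (Zmod 3))) chi"

definition independent_characters3 ::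
  "('a, 'x) monoid_scheme \<Rightarrow> ('a \<Rightarrow> int) \<Rightarrow> ('a \<Rightarrow> int) \<Rightarrow> bool" where
  "independent_characters3 G chi1 chi2 \<longleftrightarrow>
     (\<forall>a\<in>carrier (Zmod 3). \<forall>b\<in>carrier (Zmod 3).
        (\<forall>\<gamma>\<in>carrier G. (a * chi1 \<gamma> + b * chi2 \<gamma>) mod 3 = 0) \<longrightarrow> a = 0 \<and> b = 0)"


section \<open>Tensor products of abelian groups\<close>

definition tensor_relations ::
  "('a, 'x) monoid_scheme \<Rightarrow> ('b, 'y) monoid_scheme \<Rightarrow> ('a \<times> 'b \<Rightarrow>\<^sub>0 int) set" where
  "tensor_relations A B =
     generate (free_Abelian_group (carrier A \<times> carrier B))
       ({frag_of (a \<otimes>\<^bsub>A\<^esub> a', b) - frag_of (a, b) - frag_of (a', b) | a a' b.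
           a \<in> carrier A \<and> a' \<in> carrier A \<and> b \<in> carrier B} \<union>
        {frag_of (a, b \<otimes>\<^bsub>B\<^esub> b') - frag_of (a, b) - frag_of (a, b') | a b b'.
           a \<in> carrier A \<and> b \<in> carrier B \<and> b' \<in> carrier B})"

definition tensor_product ::
  "('a, 'x) monoid_scheme \<Rightarrow> ('b, 'y) monoid_scheme \<Rightarrow> ('a \<times> 'b \<Rightarrow>\<^sub>0 int) set monoid" where
  "tensor_product A B =
     free_Abelian_group (carrier A \<times> carrier B) Mod tensor_relations A B"

text \<open>\<open>\<phi> \<otimes> \<psi>\<close> with values in \<open>A \<otimes> B\<close>.\<close>

definition tensor_map ::
  "('a, 'x) monoid_scheme \<Rightarrow> ('b, 'y) monoid_scheme \<Rightarrow> ('c \<Rightarrow> 'a) \<Rightarrow> ('d \<Rightarrow> 'b) \<Rightarrow>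
   ('c \<times> 'd \<Rightarrow>\<^sub>0 int) set \<Rightarrow> ('a \<times> 'b \<Rightarrow>\<^sub>0 int) set" where
  "tensor_map A B \<phi> \<psi> =
     quotient_map_of (free_Abelian_group (carrier A \<times> carrier B)) (tensor_relations A B)
       (frag_extend (\<lambda>(c, d). frag_of (\<phi> c, \<psi> d)))"

abbreviation tensor_act ::
  "('m, 'x) monoid_scheme \<Rightarrow> ('b, 'y) monoid_scheme \<Rightarrow> ('a \<Rightarrow> 'm \<Rightarrow> 'm) \<Rightarrow> 'a \<Rightarrow>
   ('m \<times> 'b \<Rightarrow>\<^sub>0 int) set \<Rightarrow> ('m \<times> 'b \<Rightarrow>\<^sub>0 int) set" where
  "tensor_act M B act \<equiv> \<lambda>\<gamma>. tensor_map M B (act \<gamma>) (\<lambda>x. x)"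

text \<open>
  The Bockstein map from degree \<open>n\<close> to degree \<open>n + 1\<close>, i.e. the connecting map of
  \<open>0 \<rightarrow> M \<otimes> \<int>/3 \<rightarrow> M \<otimes> \<int>/9 \<rightarrow> M \<otimes> \<int>/3 \<rightarrow> 0\<close>.
\<close>

definition bockstein ::
  "('a, 'x) monoid_scheme \<Rightarrow> 'a topology \<Rightarrow> ('m, 'y) monoid_scheme \<Rightarrow> ('a \<Rightarrow> 'm \<Rightarrow> 'm) \<Rightarrow> nat \<Rightarrow>
   ((nat \<Rightarrow> 'a) \<Rightarrow> ('m \<times> int \<Rightarrow>\<^sub>0 int) set) set \<Rightarrow> ((nat \<Rightarrow> 'a) \<Rightarrow> ('m \<times> int \<Rightarrow>\<^sub>0 int) set) set" where
  "bockstein G T M act =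
     connecting_map G T
       (tensor_product M (Zmod 3)) (tensor_act M (Zmod 3) act)
       (tensor_product M (Zmod 9)) (tensor_act M (Zmod 9) act)
       (tensor_map M (Zmod 9) (\<lambda>m. m) (\<lambda>k. 3 * k))
       (tensor_map M (Zmod 3) (\<lambda>m. m) (\<lambda>k. k mod 3))"


section \<open>The modules over the group ring of $\mathbb{Z}/3 \oplus \mathbb{Z}/3$\<close>

text \<open>
  The group \<open>\<langle>\<tau>\<^sub>1, \<tau>\<^sub>2\<rangle>\<close> is the additive group of the type \<open>3 \<times> 3\<close>. The multiplication of
  \<open>\<Rightarrow>\<^sub>0\<close> is convolution, which makes \<open>zg\<close> the integral group ring.
\<close>

type_synonym zg = "(3 \<times> 3) \<Rightarrow>\<^sub>0 int"

definition \<tau>\<^sub>1 :: zg where "\<tau>\<^sub>1 = Poly_Mapping.single (1, 0) 1"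
definition \<tau>\<^sub>2 :: zg where "\<tau>\<^sub>2 = Poly_Mapping.single (0, 1) 1"
definition \<tau>\<^sub>3 :: zg where "\<tau>\<^sub>3 = \<tau>\<^sub>1 * \<tau>\<^sub>2"
definition \<tau>\<^sub>4 :: zg where "\<tau>\<^sub>4 = \<tau>\<^sub>1 * \<tau>\<^sub>2 ^ 2"

definition t\<^sub>1 :: zg where "t\<^sub>1 = \<tau>\<^sub>1 - 1"
definition t\<^sub>2 :: zg where "t\<^sub>2 = \<tau>\<^sub>2 - 1"
definition T\<^sub>3 :: zg where "T\<^sub>3 = 1 + \<tau>\<^sub>3 + \<tau>\<^sub>3 ^ 2"
definition T\<^sub>4 :: zg where "T\<^sub>4 = 1 + \<tau>\<^sub>4 + \<tau>\<^sub>4 ^ 2"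
definition T\<^sub>G :: zg where "T\<^sub>G = (\<Sum>g\<in>UNIV. Poly_Mapping.single g 1)"

definition \<kappa>\<^sub>1 :: zg where "\<kappa>\<^sub>1 = - (\<tau>\<^sub>1 + 2 * \<tau>\<^sub>1 ^ 2)"
definition \<kappa>\<^sub>2 :: zg where "\<kappa>\<^sub>2 = - (\<tau>\<^sub>2 + 2 * \<tau>\<^sub>2 ^ 2)"

type_synonym zg4 = "zg \<times> zg \<times> zg \<times> zg"

fun smult4 :: "zg \<Rightarrow> zg4 \<Rightarrow> zg4" where
  "smult4 u (x\<^sub>1, x\<^sub>2, x\<^sub>3, x\<^sub>4) = (u * x\<^sub>1, u * x\<^sub>2, u * x\<^sub>3, u * x\<^sub>4)"

definition M\<^sub>2 :: "(zg \<times> zg) set" where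
  "M\<^sub>2 = {(\<xi>, m * T\<^sub>G) | \<xi> m. True}"

definition M\<^sub>3 :: "zg4 monoid" where
  "M\<^sub>3 = \<lparr>carrier = {(\<xi>\<^sub>1, \<xi>\<^sub>2, \<xi>\<^sub>3 * T\<^sub>3, \<xi>\<^sub>4 * T\<^sub>4) | \<xi>\<^sub>1 \<xi>\<^sub>2 \<xi>\<^sub>3 \<xi>\<^sub>4. True},
        monoid.mult = (+), one = 0\<rparr>"

text \<open>
  The maps \<open>d\<^sub>2\<close> and \<open>h\<^sub>2\<close> are expressed in terms of the components \<open>y = m T\<^sub>G\<close>, respectively
  \<open>y\<^sub>3 = \<xi>\<^sub>3 T\<^sub>3\<close> and \<open>y\<^sub>4 = \<xi>\<^sub>4 T\<^sub>4\<close>, themselves.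
\<close>

fun d\<^sub>2 :: "zg \<times> zg \<Rightarrow> zg4" where
  "d\<^sub>2 (\<xi>, y) = (- \<xi> * t\<^sub>1, - \<xi> * t\<^sub>2, \<xi> * T\<^sub>3 + y, \<xi> * T\<^sub>4 + y)"

fun h\<^sub>2 :: "zg4 \<Rightarrow> zg \<times> zg" where
  "h\<^sub>2 (\<xi>\<^sub>1, \<xi>\<^sub>2, y\<^sub>3, y\<^sub>4) = (\<xi>\<^sub>1 * \<kappa>\<^sub>1 + \<xi>\<^sub>2 * \<kappa>\<^sub>2 - y\<^sub>3 - y\<^sub>4, y\<^sub>3 * T\<^sub>G)"

definition M\<^sub>4 :: "zg4 set monoid" where
  "M\<^sub>4 = M\<^sub>3 Mod (d\<^sub>2 ` M\<^sub>2)"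

text \<open>The value of \<open>h\<^sub>3\<close> does not depend on the representative \<open>m\<close>, as \<open>d\<^sub>2 \<circ> h\<^sub>2 \<circ> d\<^sub>2 = 3 d\<^sub>2\<close> on \<open>M\<^sub>2\<close>.\<close>

definition h\<^sub>3 :: "zg4 set \<Rightarrow> zg4" where
  "h\<^sub>3 S = the_elem ((\<lambda>m. smult4 3 m - d\<^sub>2 (h\<^sub>2 m)) ` S)"

definition act_M\<^sub>3 :: "('a \<Rightarrow> int) \<Rightarrow> ('a \<Rightarrow> int) \<Rightarrow> 'a \<Rightarrow> zg4 \<Rightarrow> zg4" where
  "act_M\<^sub>3 chi1 chi2 \<gamma> = smult4 (\<tau>\<^sub>1 ^ nat (chi1 \<gamma>) * \<tau>\<^sub>2 ^ nat (chi2 \<gamma>))"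

definition act_M\<^sub>4 :: "('a \<Rightarrow> int) \<Rightarrow> ('a \<Rightarrow> int) \<Rightarrow> 'a \<Rightarrow> zg4 set \<Rightarrow> zg4 set" where
  "act_M\<^sub>4 chi1 chi2 \<gamma> = quotient_map_of M\<^sub>3 (d\<^sub>2 ` M\<^sub>2) (act_M\<^sub>3 chi1 chi2 \<gamma>)"

text \<open>The map induced by \<open>h\<^sub>3\<close> in degree \<open>n\<close>, with coefficients tensored with \<open>\<int>/3\<close>.\<close>

definition h\<^sub>3_cohomology ::
  "('a, 'x) monoid_scheme \<Rightarrow> 'a topology \<Rightarrow> ('a \<Rightarrow> int) \<Rightarrow> ('a \<Rightarrow> int) \<Rightarrow> nat \<Rightarrow>
   ((nat \<Rightarrow> 'a) \<Rightarrow> (zg4 set \<times> int \<Rightarrow>\<^sub>0 int) set) set \<Rightarrow>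
   ((nat \<Rightarrow> 'a) \<Rightarrow> (zg4 \<times> int \<Rightarrow>\<^sub>0 int) set) set" where
  "h\<^sub>3_cohomology G T chi1 chi2 n =
     cohomology_map G T
       (tensor_product M\<^sub>3 (Zmod 3)) (tensor_act M\<^sub>3 (Zmod 3) (act_M\<^sub>3 chi1 chi2))
       (tensor_map M\<^sub>3 (Zmod 3) h\<^sub>3 (\<lambda>k. k)) n"

end

theory Submission
  imports Defs "HOL-Library.Function_Algebras"
begin

text \<open>
  The Bockstein map is natural, so applying \<open>h\<^sub>3\<close> after the Bockstein map of \<open>M\<^sub>4\<close> is the same as
  applying the Bockstein map of \<open>M\<^sub>3\<close> after \<open>h\<^sub>3\<close>. The module \<open>M\<^sub>3\<close> is a direct sum of permutation
  modules: two copies of the group ring, and the ideals generated by \<open>T\<^sub>3\<close> and \<open>T\<^sub>4\<close>, which are the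
  functions on the cosets of \<open>\<langle>\<tau>\<^sub>3\<rangle>\<close> and of \<open>\<langle>\<tau>\<^sub>4\<rangle>\<close>. By Shapiro's lemma the cohomology of each summand
  is that of a closed subgroup \<open>K\<close> with trivial coefficients, and there every class modulo 3 lifts
  to a class modulo 9, since the group is a Voevodsky group. So the Bockstein map of \<open>M\<^sub>3\<close> vanishes.

  The argument is carried out with integral cochains: locally constant functions \<open>F\<close> with values in a
  module over the integers, and their coboundary \<open>codiff\<close>. A cochain with values in \<open>M\<^sub>3 \<otimes> \<int>/k\<close> or
  \<open>M\<^sub>4 \<otimes> \<int>/k\<close> is the reduction of a cochain with values in \<open>M\<^sub>3\<close>; the locale \<open>presentation\<close> describes
  cocycles, coboundaries and cohomology classes in terms of these lifts. Writing \<open>\<delta>\<close> for the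
  coboundary, vanishing of the Bockstein map becomes the statement \<open>bockstein_vanishes\<close>: if \<open>\<delta> u\<close>
  is divisible by 3, then there is a cochain \<open>z\<close> such that \<open>\<delta> u + 3 \<delta> z\<close> is divisible by 9. It is
  proved for trivial coefficients from the lifting property (\<open>bockstein_vanishes_trivial\<close>), transferred
  to permutation modules by an explicit prism homotopy (\<open>prism_sum\<close>, \<open>bockstein_vanishes_perm\<close>), and
  then to \<open>M\<^sub>3\<close> (\<open>bockstein_vanishes_M\<^sub>3\<close>).

  Let \<open>D\<close> be the image of \<open>d\<^sub>2\<close>, let \<open>c\<close> be the class of the reduction of \<open>F\<close>, and let
  \<open>\<delta> F = 3 B + d\<close> with \<open>d\<close> in \<open>D\<close>. The quotient of \<open>M\<^sub>3\<close> by \<open>D\<close> has no 3-torsion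
  (\<open>D_torsion_free\<close>), so the Bockstein image of \<open>c\<close> is well defined and is the class of \<open>B\<close>
  (\<open>bockstein_coh_class\<close>). The map \<open>3 - d\<^sub>2 h\<^sub>2\<close> vanishes on \<open>D\<close>; applying it gives
  \<open>\<delta> (h\<^sub>3 F) = 3 h\<^sub>3 B\<close>, so that \<open>3 h\<^sub>3 B + 3 \<delta> z\<close> is divisible by 9 for some \<open>z\<close>,
  that is, \<open>h\<^sub>3 B\<close> is a coboundary modulo 3.
\<close>

section \<open>Alternating sums\<close>

text \<open>
  The sign \<open>(-1) ^ i\<close>, applied to an element of an abelian group.
\<close>

definition alt :: "nat \<Rightarrow> 'm::ab_group_add \<Rightarrow> 'm" where
  "alt i x = (if even i then x else - x)"

lemma alt_add: "alt i (x + y) = alt i x + alt i y"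
  by (simp add: alt_def)

lemma alt_alt: "alt i (alt j x) = alt (i + j) x"
  by (simp add: alt_def)

lemma alt_sum: "alt i (sum f I) = (\<Sum>j\<in>I. alt i (f j))"
  by (simp add: alt_def sum_negf)

lemma alt_Suc [simp]: "alt (Suc i) x = - alt i x"
  by (simp add: alt_def)

lemma alt_double [simp]: "alt (i + i) x = x"
  by (simp add: alt_def)

text \<open>
  The cancellation behind \<open>\<delta> \<circ> \<delta> = 0\<close>: the hypothesis is the cosimplicial identity for the
  composites \<open>D i j\<close> of two coface maps.
\<close>

lemma alternating_double_sum_eq_0:
  fixes D :: "nat \<Rightarrow> nat \<Rightarrow> 'm::ab_group_add"
  assumes "\<And>i j. i \<le> j \<Longrightarrow> j \<le> m \<Longrightarrow> D i j = D (Suc j) i"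
  shows "(\<Sum>i\<le>Suc m. \<Sum>j\<le>m. alt (i + j) (D i j)) = 0"
  using assms
proof (induction m)
  case 0
  show ?case using 0[of 0 0] by (simp add: alt_def)
next
  case (Suc m)
  have IH: "(\<Sum>i\<le>Suc m. \<Sum>j\<le>m. alt (i + j) (D i j)) = 0"
    by (rule Suc.IH) (use Suc.prems in auto)
  have "(\<Sum>i\<le>Suc (Suc m). \<Sum>j\<le>Suc m. alt (i + j) (D i j)) =
     (\<Sum>i\<le>Suc m. \<Sum>j\<le>m. alt (i + j) (D i j)) + (\<Sum>i\<le>Suc m. alt (i + Suc m) (D i (Suc m)))
      + (\<Sum>j\<le>Suc m. alt (Suc (Suc m) + j) (D (Suc (Suc m)) j))"
    by (simp only: sum.atMost_Suc[of _ "Suc m"] sum.atMost_Suc[of _ m] sum.distrib) (simp add: algebra_simps)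
  also have "\<dots> = (\<Sum>j\<le>Suc m. alt (j + Suc m) (D j (Suc m)) + alt (Suc (Suc m) + j) (D (Suc (Suc m)) j))"
    unfolding IH by (simp only: sum.distrib add_0_left)
  also have "\<dots> = 0"
    by (rule sum.neutral) (use Suc.prems in \<open>auto simp: alt_def\<close>)
  finally show ?case .
qed

text \<open>
  The cancellation behind the prism homotopy. Here \<open>A i j\<close> stands for the \<open>i\<close>-th coface evaluated at
  the \<open>j\<close>-th prism, and \<open>B i j\<close> for the \<open>j\<close>-th prism of the \<open>i\<close>-th face. The faces common to
  neighbouring prisms cancel, and only the two ends of the prism are left.
\<close>

lemma alternating_prism_sum:
  fixes A B :: "nat \<Rightarrow> nat \<Rightarrow> 'm::ab_group_add"
  assumes "\<And>i j. i < j \<Longrightarrow> j \<le> n \<Longrightarrow> A i j = B i (j - 1)"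
    and "\<And>i j. Suc j < i \<Longrightarrow> i \<le> Suc n \<Longrightarrow> A i j = B (i - 1) j"
    and "\<And>j. j < n \<Longrightarrow> A (Suc j) j = A (Suc j) (Suc j)"
  shows "(\<Sum>i\<le>n. \<Sum>j<n. alt (i + j) (B i j)) + (\<Sum>j\<le>n. \<Sum>i\<le>Suc n. alt (j + i) (A i j))
    = A 0 0 - A (Suc n) n"
  using assms
proof (induction n)
  case 0
  show ?case by (simp add: alt_def)
next
  case (Suc n)
  have IH: "(\<Sum>i\<le>n. \<Sum>j<n. alt (i + j) (B i j)) + (\<Sum>j\<le>n. \<Sum>i\<le>Suc n. alt (j + i) (A i j))
    = A 0 0 - A (Suc n) n"
    by (rule Suc.IH) (use Suc.prems in auto)
  have 1: "(\<Sum>i\<le>Suc n. \<Sum>j<Suc n. alt (i + j) (B i j)) =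
     (\<Sum>i\<le>n. \<Sum>j<n. alt (i + j) (B i j)) + (\<Sum>i\<le>n. alt (i + n) (B i n))
      + (\<Sum>j<Suc n. alt (Suc n + j) (B (Suc n) j))"
    by (simp add: sum.distrib algebra_simps)
  have 2: "(\<Sum>j\<le>Suc n. \<Sum>i\<le>Suc (Suc n). alt (j + i) (A i j)) =
     (\<Sum>j\<le>n. \<Sum>i\<le>Suc n. alt (j + i) (A i j)) + (\<Sum>j\<le>n. alt (j + Suc (Suc n)) (A (Suc (Suc n)) j))
      + ((\<Sum>i\<le>n. alt (Suc n + i) (A i (Suc n))) + A (Suc n) (Suc n) - A (Suc (Suc n)) (Suc n))"
    by (simp add: sum.distrib sum_negf sum_subtractf algebra_simps)
  have 3: "(\<Sum>j<Suc n. alt (Suc n + j) (B (Suc n) j)) + (\<Sum>j\<le>n. alt (j + Suc (Suc n)) (A (Suc (Suc n)) j)) = 0"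
    unfolding sum.distrib[symmetric] lessThan_Suc_atMost
    by (rule sum.neutral) (use Suc.prems(2) in \<open>auto simp: alt_def\<close>)
  have 4: "(\<Sum>i\<le>n. alt (i + n) (B i n)) + (\<Sum>i\<le>n. alt (Suc n + i) (A i (Suc n))) = 0"
    unfolding sum.distrib[symmetric]
    by (rule sum.neutral) (use Suc.prems(1) in \<open>auto simp: alt_def\<close>)
  have 5: "A (Suc n) n = A (Suc n) (Suc n)"
    using Suc.prems(3) by simp
  have regroup: "(b + b1 + b2) + (a + a1 + (a2 + x - y)) = (b + a) + (b2 + a1) + (b1 + a2) + x - y"
    for b b1 b2 a a1 a2 x y :: 'm
    by (simp add: algebra_simps)
  show ?case
    unfolding 1 2 regroup IH 3 4 5 by simp
qed

section \<open>Integral cochains and locally constant functions\<close>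

text \<open>
  The \<open>i\<close>-th term, without its sign, of the inhomogeneous coboundary of an \<open>n\<close>-cochain,
  for \<open>i = 0, \<dots>, n + 1\<close>; the group acts only in the term \<open>i = 0\<close>.
\<close>

definition coface :: "('a, 'x) monoid_scheme \<Rightarrow> ('a \<Rightarrow> 'm \<Rightarrow> 'm) \<Rightarrow> nat \<Rightarrow> nat \<Rightarrow>
    ((nat \<Rightarrow> 'a) \<Rightarrow> 'm) \<Rightarrow> (nat \<Rightarrow> 'a) \<Rightarrow> 'm" where
  "coface G act n i f g =
     (if i = 0 then act (g 0) (f (\<lambda>j\<in>{..<n}. g (Suc j)))
      else if i \<le> n then f (face G n (i - 1) g)
      else f (\<lambda>j\<in>{..<n}. g j))"

text \<open>
  The inhomogeneous coboundary for coefficients in a type of class \<^class>\<open>ab_group_add\<close>. Its values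
  outside the tuples over the group are irrelevant.
\<close>

definition codiff :: "('a, 'x) monoid_scheme \<Rightarrow> ('a \<Rightarrow> 'm \<Rightarrow> 'm) \<Rightarrow> nat \<Rightarrow>
    ((nat \<Rightarrow> 'a) \<Rightarrow> 'm) \<Rightarrow> (nat \<Rightarrow> 'a) \<Rightarrow> 'm::ab_group_add" where
  "codiff G act n f g = (\<Sum>i\<le>Suc n. alt i (coface G act n i f g))"

text \<open>
  Locally constant functions, that is, continuous maps to a discrete space.
\<close>

definition loc_const :: "'b topology \<Rightarrow> ('b \<Rightarrow> 'c) \<Rightarrow> bool" where
  "loc_const X f \<longleftrightarrow> (\<forall>p\<in>topspace X. \<exists>U. openin X U \<and> p \<in> U \<and> (\<forall>q\<in>U. f q = f p))"

abbreviation power_topology :: "'a topology \<Rightarrow> nat \<Rightarrow> (nat \<Rightarrow> 'a) topology" where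
  "power_topology T n \<equiv> product_topology (\<lambda>_. T) {..<n}"

lemma continuous_map_discrete_iff:
  "continuous_map X (discrete_topology C) f \<longleftrightarrow> f \<in> topspace X \<rightarrow> C \<and> loc_const X f"
proof
  assume L: "continuous_map X (discrete_topology C) f"
  then have *: "f \<in> topspace X \<rightarrow> C"
    by (auto simp: continuous_map_def)
  moreover have "loc_const X f"
    unfolding loc_const_def
  proof
    fix p assume p: "p \<in> topspace X"
    have "openin X {x \<in> topspace X. f x \<in> {f p}}"
      by (rule openin_continuous_map_preimage[OF L]) (use p * in auto)
    then show "\<exists>U. openin X U \<and> p \<in> U \<and> (\<forall>q\<in>U. f q = f p)"
      using p by (intro exI[of _ "{x \<in> topspace X. f x \<in> {f p}}"]) auto
  qed
  ultimately show "f \<in> topspace X \<rightarrow> C \<and> loc_const X f" by blast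
next
  assume R: "f \<in> topspace X \<rightarrow> C \<and> loc_const X f"
  show "continuous_map X (discrete_topology C) f"
    unfolding continuous_map_def
  proof (intro conjI allI impI)
    show "f \<in> topspace X \<rightarrow> topspace (discrete_topology C)" using R by simp
    fix U
    show "openin X {x \<in> topspace X. f x \<in> U}"
    proof (subst openin_subopen, intro ballI)
      fix x assume x: "x \<in> {x \<in> topspace X. f x \<in> U}"
      then obtain V where "openin X V" "x \<in> V" "\<forall>q\<in>V. f q = f x"
        using R unfolding loc_const_def by blast
      then show "\<exists>W. openin X W \<and> x \<in> W \<and> W \<subseteq> {x \<in> topspace X. f x \<in> U}"
        using x openin_subset by (intro exI[of _ V]) fastforce
    qed
  qed
qed

lemma loc_const_const: "loc_const X (\<lambda>x. c)"
  unfolding loc_const_def by blast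

lemma loc_const_map: "loc_const X f \<Longrightarrow> loc_const X (\<lambda>x. u (f x))"
  unfolding loc_const_def by metis

lemma loc_const_map2:
  assumes "loc_const X f" "loc_const X g" shows "loc_const X (\<lambda>x. u (f x) (g x))"
  unfolding loc_const_def
proof
  fix p assume p: "p \<in> topspace X"
  obtain U where U: "openin X U" "p \<in> U" "\<forall>q\<in>U. f q = f p"
    using assms(1) p unfolding loc_const_def by blast
  obtain V where V: "openin X V" "p \<in> V" "\<forall>q\<in>V. g q = g p"
    using assms(2) p unfolding loc_const_def by blast
  show "\<exists>U. openin X U \<and> p \<in> U \<and> (\<forall>q\<in>U. u (f q) (g q) = u (f p) (g p))"
    using openin_Int[OF U(1) V(1)] U(2,3) V(2,3) by (metis IntD1 IntD2 IntI)
qed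

lemma loc_const_sum:
  assumes "finite I" "\<And>i. i \<in> I \<Longrightarrow> loc_const X (\<lambda>x. f i x)"
  shows "loc_const X (\<lambda>x. \<Sum>i\<in>I. f i x)"
  using assms
proof (induction I rule: finite_induct)
  case empty then show ?case by (simp add: loc_const_const)
next
  case (insert a I)
  then show ?case
    using loc_const_map2[of X "f a" "\<lambda>x. \<Sum>i\<in>I. f i x" "(+)"] by simp
qed

lemma loc_const_cong: "loc_const X f \<Longrightarrow> (\<And>x. x \<in> topspace X \<Longrightarrow> f x = g x) \<Longrightarrow> loc_const X g"
  unfolding loc_const_def by (metis openin_subset subset_iff)

lemma loc_const_compose:
  assumes "continuous_map X Y h" "loc_const Y f" shows "loc_const X (\<lambda>x. f (h x))"
proof -
  have "continuous_map Y (discrete_topology UNIV) f"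
    using assms(2) by (simp add: continuous_map_discrete_iff)
  then have "continuous_map X (discrete_topology UNIV) (f \<circ> h)"
    by (rule continuous_map_compose[OF assms(1)])
  then show ?thesis
    by (simp add: continuous_map_discrete_iff comp_def)
qed

lemma loc_const_dependent:
  assumes "loc_const X h" "\<And>v. v \<in> h ` topspace X \<Longrightarrow> loc_const X (\<lambda>x. f v x)"
  shows "loc_const X (\<lambda>x. f (h x) x)"
  unfolding loc_const_def
proof
  fix p assume p: "p \<in> topspace X"
  obtain U where U: "openin X U" "p \<in> U" "\<forall>q\<in>U. h q = h p"
    using assms(1) p unfolding loc_const_def by blast
  obtain V where V: "openin X V" "p \<in> V" "\<forall>q\<in>V. f (h p) q = f (h p) p"
    using assms(2)[of "h p"] p unfolding loc_const_def by blast
  show "\<exists>U. openin X U \<and> p \<in> U \<and> (\<forall>q\<in>U. f (h q) q = f (h p) p)"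
    using openin_Int[OF U(1) V(1)] U(2,3) V(2,3) by (metis IntD1 IntD2 IntI)
qed

text \<open>
  The index type is finite, hence the intersection of the neighbourhoods on which the coordinates
  are constant is open.
\<close>

lemma loc_const_fun:
  fixes f :: "'b \<Rightarrow> 'i::finite \<Rightarrow> 'c"
  assumes "\<And>i. loc_const X (\<lambda>x. f x i)"
  shows "loc_const X f"
proof -
  have "loc_const X (\<lambda>x. restrict (f x) I)" if "finite I" for I
    using that
  proof (induction I rule: finite_induct)
    case empty
    show ?case by (rule loc_const_cong[OF loc_const_const[of _ "\<lambda>_. undefined"]]) (simp add: restrict_def)
  next
    case (insert a I)
    have "loc_const X (\<lambda>x. (restrict (f x) I)(a := f x a))"
      by (rule loc_const_map2[OF insert.IH assms, of "\<lambda>r v. r(a := v)"])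
    then show ?case
      by (rule loc_const_cong) (auto simp: restrict_def fun_eq_iff)
  qed
  from this[of UNIV] show ?thesis by (simp add: restrict_UNIV)
qed

lemma continuous_map_loc_const: "loc_const X f \<Longrightarrow> (\<And>x. x \<in> topspace X \<Longrightarrow> f x \<in> topspace Y) \<Longrightarrow> continuous_map X Y f"
  unfolding continuous_map_def
proof (intro conjI allI impI)
  assume f: "loc_const X f" "\<And>x. x \<in> topspace X \<Longrightarrow> f x \<in> topspace Y"
  show "f \<in> topspace X \<rightarrow> topspace Y" using f by auto
  fix U assume "openin Y U"
  have "continuous_map X (discrete_topology UNIV) f"
    using f by (simp add: continuous_map_discrete_iff)
  then show "openin X {x \<in> topspace X. f x \<in> U}"
    by (rule openin_continuous_map_preimage) simp
qed

text \<open>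
  A topological group, with no condition on its topology: the constructions below apply both to the
  given profinite group and to its closed subgroups.
\<close>

locale cochain_setting =
  fixes G :: "('a, 'x) monoid_scheme" and T :: "'a topology"
  assumes tg: "topological_group G T"
begin

sublocale group G
  using tg by (simp add: topological_group_def)

lemma topspace [simp]: "topspace T = carrier G"
  using tg by (simp add: topological_group_def)

lemma topspace_power: "topspace (power_topology T n) = tuples G n"
  by simp

lemma continuous_mult:
  assumes "continuous_map X T f" "continuous_map X T g"
  shows "continuous_map X T (\<lambda>x. f x \<otimes>\<^bsub>G\<^esub> g x)"
proof -
  have "continuous_map X (prod_topology T T) (\<lambda>x. (f x, g x))"
    using assms by (simp add: continuous_map_pairwise comp_def)
  moreover have "continuous_map (prod_topology T T) T (\<lambda>(x, y). x \<otimes>\<^bsub>G\<^esub> y)"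
    using tg by (simp add: topological_group_def)
  ultimately have "continuous_map X T ((\<lambda>(x, y). x \<otimes>\<^bsub>G\<^esub> y) \<circ> (\<lambda>x. (f x, g x)))"
    by (rule continuous_map_compose)
  then show ?thesis by (simp add: comp_def)
qed

lemma continuous_inv:
  assumes "continuous_map X T f"
  shows "continuous_map X T (\<lambda>x. inv\<^bsub>G\<^esub> f x)"
proof -
  have "continuous_map T T (\<lambda>x. inv\<^bsub>G\<^esub> x)"
    using tg by (simp add: topological_group_def)
  from continuous_map_compose[OF assms this] show ?thesis by (simp add: comp_def)
qed

lemma continuous_proj: "i < n \<Longrightarrow> continuous_map (power_topology T n) T (\<lambda>g. g i)"
  by (rule continuous_map_product_projection) simp

lemma continuous_tuple:
  assumes "\<And>i. i < n \<Longrightarrow> continuous_map X T (\<lambda>g. h g i)"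
  shows "continuous_map X (power_topology T n) (\<lambda>g. \<lambda>i\<in>{..<n}. h g i)"
  unfolding continuous_map_componentwise
  using assms by (auto intro: continuous_map_eq)

lemma face_in: "g \<in> tuples G (Suc n) \<Longrightarrow> i < n \<Longrightarrow> face G n i g \<in> tuples G n"
  by (auto simp: face_def PiE_iff intro!: m_closed)

lemma tail_in: "g \<in> tuples G (Suc n) \<Longrightarrow> (\<lambda>j\<in>{..<n}. g (Suc j)) \<in> tuples G n"
  by (auto simp: PiE_iff)

lemma init_in: "g \<in> tuples G (Suc n) \<Longrightarrow> (\<lambda>j\<in>{..<n}. g j) \<in> tuples G n"
  by (auto simp: PiE_iff)

lemma continuous_face: "i < n \<Longrightarrow> continuous_map (power_topology T (Suc n)) (power_topology T n) (face G n i)"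
  unfolding face_def
  by (rule continuous_tuple) (auto intro!: continuous_proj continuous_mult)

lemma continuous_tail: "continuous_map (power_topology T (Suc n)) (power_topology T n) (\<lambda>g. \<lambda>j\<in>{..<n}. g (Suc j))"
  by (rule continuous_tuple) (auto intro!: continuous_proj)

lemma continuous_init: "continuous_map (power_topology T (Suc n)) (power_topology T n) (\<lambda>g. \<lambda>j\<in>{..<n}. g j)"
  by (rule continuous_tuple) (auto intro!: continuous_proj)

end

text \<open>
  A module over the integers with a continuous action for the discrete topology. The axioms are
  required on the whole type \<open>'m\<close>; submodules appear as subsets of it.
\<close>

locale cochain_module = cochain_setting G T
  for G :: "('a, 'x) monoid_scheme" and T :: "'a topology" +
  fixes act :: "'a \<Rightarrow> 'm::ab_group_add \<Rightarrow> 'm"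
  assumes act_add: "\<gamma> \<in> carrier G \<Longrightarrow> act \<gamma> (v + w) = act \<gamma> v + act \<gamma> w"
    and act_mult: "\<gamma> \<in> carrier G \<Longrightarrow> \<gamma>' \<in> carrier G \<Longrightarrow> act (\<gamma> \<otimes>\<^bsub>G\<^esub> \<gamma>') v = act \<gamma> (act \<gamma>' v)"
    and act_loc_const: "loc_const T (\<lambda>\<gamma>. act \<gamma> v)"
begin

lemma act_0: "\<gamma> \<in> carrier G \<Longrightarrow> act \<gamma> 0 = 0"
  using act_add[of \<gamma> 0 0] by simp

lemma act_minus: "\<gamma> \<in> carrier G \<Longrightarrow> act \<gamma> (- v) = - act \<gamma> v"
  using act_add[of \<gamma> v "- v"] by (simp add: act_0 eq_neg_iff_add_eq_0 add.commute)

lemma act_sum: "\<gamma> \<in> carrier G \<Longrightarrow> act \<gamma> (sum f I) = (\<Sum>i\<in>I. act \<gamma> (f i))"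
  by (induction I rule: infinite_finite_induct) (simp_all add: act_0 act_add)

lemma act_alt: "\<gamma> \<in> carrier G \<Longrightarrow> act \<gamma> (alt i v) = alt i (act \<gamma> v)"
  by (simp add: alt_def act_minus)

lemma coface_add:
  "g \<in> tuples G (Suc n) \<Longrightarrow> coface G act n i (\<lambda>x. f x + f' x) g = coface G act n i f g + coface G act n i f' g"
  by (auto simp: coface_def act_add PiE_iff)

lemma coface_minus:
  "g \<in> tuples G (Suc n) \<Longrightarrow> coface G act n i (\<lambda>x. - f x) g = - coface G act n i f g"
  by (auto simp: coface_def act_minus PiE_iff)

lemma coface_cong:
  assumes "g \<in> tuples G (Suc n)" "\<And>g. g \<in> tuples G n \<Longrightarrow> f g = f' g"
  shows "coface G act n i f g = coface G act n i f' g"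
  using face_in[OF assms(1)] tail_in[OF assms(1)] init_in[OF assms(1)] assms(2)
  by (auto simp: coface_def)

lemma codiff_cong:
  assumes "g \<in> tuples G (Suc n)" "\<And>g. g \<in> tuples G n \<Longrightarrow> f g = f' g"
  shows "codiff G act n f g = codiff G act n f' g"
  unfolding codiff_def using coface_cong[OF assms] by simp

lemma codiff_add:
  "g \<in> tuples G (Suc n) \<Longrightarrow> codiff G act n (\<lambda>x. f x + f' x) g = codiff G act n f g + codiff G act n f' g"
  by (simp add: codiff_def coface_add alt_add sum.distrib)

lemma codiff_minus:
  "g \<in> tuples G (Suc n) \<Longrightarrow> codiff G act n (\<lambda>x. - f x) g = - codiff G act n f g"
  unfolding codiff_def sum_negf[symmetric] by (rule sum.cong) (auto simp: coface_minus alt_def)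

lemma codiff_diff:
  "g \<in> tuples G (Suc n) \<Longrightarrow> codiff G act n (\<lambda>x. f x - f' x) g = codiff G act n f g - codiff G act n f' g"
  using codiff_add[of g n f "\<lambda>x. - f' x"] by (simp add: codiff_minus)

lemma codiff_closed:
  assumes "g \<in> tuples G (Suc n)" "\<And>g. g \<in> tuples G n \<Longrightarrow> f g \<in> S"
    and "0 \<in> S" "\<And>x y. x \<in> S \<Longrightarrow> y \<in> S \<Longrightarrow> x + y \<in> S" "\<And>x. x \<in> S \<Longrightarrow> - x \<in> S"
    and "\<And>\<gamma> x. \<gamma> \<in> carrier G \<Longrightarrow> x \<in> S \<Longrightarrow> act \<gamma> x \<in> S"
  shows "codiff G act n f g \<in> S"
proof -
  have 1: "coface G act n i f g \<in> S" for i
    unfolding coface_def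
    using assms(1,2,6) face_in[OF assms(1)] tail_in[OF assms(1)] init_in[OF assms(1)]
    by (auto simp: PiE_iff)
  have 2: "(\<Sum>i\<in>I. h i) \<in> S" if "\<And>i. h i \<in> S" for h :: "nat \<Rightarrow> 'm" and I
    by (induction I rule: infinite_finite_induct) (auto intro: assms that)
  show ?thesis
    unfolding codiff_def by (rule 2) (use 1 assms(5) in \<open>auto simp: alt_def\<close>)
qed

lemma coface_coface:
  assumes g: "g \<in> tuples G (Suc (Suc n))" and ij: "i \<le> j" "j \<le> Suc n"
  shows "coface G act (Suc n) i (coface G act n j f) g = coface G act (Suc n) (Suc j) (coface G act n i f) g"
proof -
  have cl: "g k \<in> carrier G" if "k < Suc (Suc n)" for k
    using g that by (auto simp: PiE_iff)
  consider "i = 0" "j = 0" | "i = 0" "0 < j" "j \<le> n" | "i = 0" "j = Suc n" "0 < j"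
    | "0 < i" "j \<le> n" | "0 < i" "i \<le> n" "j = Suc n" | "0 < i" "i = Suc n" "j = Suc n"
    using ij by linarith
  then show ?thesis
  proof cases
    case 1
    have "(\<lambda>k\<in>{..<n}. (\<lambda>k\<in>{..<Suc n}. g (Suc k)) (Suc k)) = (\<lambda>k\<in>{..<n}. face G (Suc n) 0 g (Suc k))"
      by (auto simp: face_def fun_eq_iff)
    moreover have "face G (Suc n) 0 g 0 = g 0 \<otimes>\<^bsub>G\<^esub> g (Suc 0)"
      by (simp add: face_def)
    ultimately show ?thesis
      using 1 by (simp add: coface_def act_mult cl)
  next
    case 2
    have "(\<lambda>k\<in>{..<n}. face G (Suc n) j g (Suc k)) = face G n (j - 1) (\<lambda>k\<in>{..<Suc n}. g (Suc k))"
      using 2 by (auto simp: face_def fun_eq_iff)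
    moreover have "face G (Suc n) j g 0 = g 0"
      using 2 by (simp add: face_def)
    ultimately show ?thesis
      using 2 by (simp add: coface_def)
  next
    case 3
    have "(\<lambda>k\<in>{..<n}. (\<lambda>k\<in>{..<Suc n}. g k) (Suc k)) = (\<lambda>k\<in>{..<n}. g (Suc k))"
      "(\<lambda>k\<in>{..<n}. (\<lambda>k\<in>{..<Suc n}. g (Suc k)) k) = (\<lambda>k\<in>{..<n}. g (Suc k))"
      "(\<lambda>k\<in>{..<Suc n}. g k) 0 = g 0"
      by (auto simp: fun_eq_iff)
    with 3 show ?thesis
      by (simp add: coface_def del: restrict_apply restrict_restrict)
  next
    case 4
    have "face G n (j - 1) (face G (Suc n) (i - 1) g) = face G n (i - 1) (face G (Suc n) j g)"
    proof
      fix k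
      show "face G n (j - 1) (face G (Suc n) (i - 1) g) k = face G n (i - 1) (face G (Suc n) j g) k"
        using 4 ij cl
        by (cases k "i - 1" rule: linorder_cases; cases "Suc k" j rule: linorder_cases)
           (auto simp: face_def m_assoc)
    qed
    with 4 ij show ?thesis
      by (simp add: coface_def)
  next
    case 5
    have "(\<lambda>k\<in>{..<n}. face G (Suc n) (i - 1) g k) = face G n (i - 1) (\<lambda>k\<in>{..<Suc n}. g k)"
      using 5 by (auto simp: face_def fun_eq_iff)
    with 5 show ?thesis
      by (simp add: coface_def del: restrict_apply restrict_restrict)
  next
    case 6
    have "(\<lambda>k\<in>{..<n}. face G (Suc n) n g k) = (\<lambda>k\<in>{..<n}. (\<lambda>k\<in>{..<Suc n}. g k) k)"
      by (auto simp: face_def fun_eq_iff)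
    with 6 show ?thesis
      by (simp add: coface_def del: restrict_apply restrict_restrict)
  qed
qed

lemma coface_codiff:
  assumes "g \<in> tuples G (Suc (Suc n))"
  shows "coface G act (Suc n) i (codiff G act n f) g = (\<Sum>j\<le>Suc n. alt j (coface G act (Suc n) i (coface G act n j f) g))"
proof -
  have "g 0 \<in> carrier G" using assms by (auto simp: PiE_iff)
  then show ?thesis
    unfolding coface_def[of G act "Suc n" i] codiff_def by (simp add: act_sum act_alt del: sum.atMost_Suc alt_Suc)
qed

theorem codiff_codiff:
  assumes "g \<in> tuples G (Suc (Suc n))"
  shows "codiff G act (Suc n) (codiff G act n f) g = 0"
proof -
  have "codiff G act (Suc n) (codiff G act n f) g =
    (\<Sum>i\<le>Suc (Suc n). \<Sum>j\<le>Suc n. alt (i + j) (coface G act (Suc n) i (coface G act n j f) g))"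
    unfolding codiff_def[of G act "Suc n"] by (simp only: coface_codiff[OF assms] alt_sum alt_alt)
  also have "\<dots> = 0"
    by (rule alternating_double_sum_eq_0) (rule coface_coface[OF assms])
  finally show ?thesis .
qed

lemma loc_const_codiff:
  assumes "loc_const (power_topology T n) f"
  shows "loc_const (power_topology T (Suc n)) (codiff G act n f)"
proof -
  have *: "loc_const (power_topology T (Suc n)) (\<lambda>g. act (g 0) (f (\<lambda>j\<in>{..<n}. g (Suc j))))"
    by (rule loc_const_dependent[OF loc_const_compose[OF continuous_tail assms], of "\<lambda>v g. act (g 0) v"])
       (rule loc_const_compose[OF continuous_proj act_loc_const], simp)
  have "loc_const (power_topology T (Suc n)) (coface G act n i f)" for i
  proof -
    consider "i = 0" | "i \<noteq> 0" "i \<le> n" | "i > n" by linarith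
    then show ?thesis
    proof cases
      case 1
      then show ?thesis by (intro loc_const_cong[OF *]) (simp add: coface_def)
    next
      case 2
      then show ?thesis
        by (intro loc_const_cong[OF loc_const_compose[OF continuous_face assms, of "i - 1"]]) (simp_all add: coface_def)
    next
      case 3
      then show ?thesis
        by (intro loc_const_cong[OF loc_const_compose[OF continuous_init assms]]) (simp_all add: coface_def)
    qed
  qed
  then have "loc_const (power_topology T (Suc n)) (\<lambda>g. alt i (coface G act n i f g))" for i
    using loc_const_map[of _ "coface G act n i f" "alt i"] by blast
  then have "loc_const (power_topology T (Suc n)) (\<lambda>g. \<Sum>i\<le>Suc n. alt i (coface G act n i f g))"
    using loc_const_sum[of "{..Suc n}" _ "\<lambda>i g. alt i (coface G act n i f g)"] by blast
  then show ?thesis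
    unfolding codiff_def[abs_def] .
qed

end

section \<open>Cohomology in terms of integral lifts\<close>

text \<open>
  A discrete module \<open>(A, act')\<close> given as the image of a submodule \<open>S\<close> of an integral module under an
  equivariant homomorphism \<open>j\<close>.
\<close>

locale presentation = cochain_module G T act
  for G :: "('a, 'x) monoid_scheme" and T :: "'a topology" and act :: "'a \<Rightarrow> 'm::ab_group_add \<Rightarrow> 'm" +
  fixes A :: "('b, 'y) monoid_scheme" and act' :: "'a \<Rightarrow> 'b \<Rightarrow> 'b" and S :: "'m set" and j :: "'m \<Rightarrow> 'b"
  assumes comm_group_A: "comm_group A"
    and S_0: "0 \<in> S"
    and S_add: "x \<in> S \<Longrightarrow> y \<in> S \<Longrightarrow> x + y \<in> S"
    and S_minus: "x \<in> S \<Longrightarrow> - x \<in> S"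
    and S_act: "\<gamma> \<in> carrier G \<Longrightarrow> x \<in> S \<Longrightarrow> act \<gamma> x \<in> S"
    and j_add: "x \<in> S \<Longrightarrow> y \<in> S \<Longrightarrow> j (x + y) = j x \<otimes>\<^bsub>A\<^esub> j y"
    and j_image: "j ` S = carrier A"
    and j_act: "\<gamma> \<in> carrier G \<Longrightarrow> x \<in> S \<Longrightarrow> act' \<gamma> (j x) = j (act \<gamma> x)"
begin

sublocale A: comm_group A
  by (rule comm_group_A)

text \<open>
  The kernel of \<open>j\<close>.
\<close>

definition N :: "'m set" where "N = {x \<in> S. j x = \<one>\<^bsub>A\<^esub>}"

text \<open>
  Integral cochains with values in \<open>S\<close>, the cochain of \<open>A\<close> represented by one of them, and the
  integral cochains that represent coboundaries. In degree 0 the only coboundary is the neutral one.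
\<close>

definition lifts :: "nat \<Rightarrow> ((nat \<Rightarrow> 'a) \<Rightarrow> 'm) set" where
  "lifts n = {F. loc_const (power_topology T n) F \<and> (\<forall>g\<in>tuples G n. F g \<in> S)}"

definition reduce :: "nat \<Rightarrow> ((nat \<Rightarrow> 'a) \<Rightarrow> 'm) \<Rightarrow> (nat \<Rightarrow> 'a) \<Rightarrow> 'b" where
  "reduce n F = (\<lambda>g\<in>tuples G n. j (F g))"

definition null :: "nat \<Rightarrow> ((nat \<Rightarrow> 'a) \<Rightarrow> 'm) \<Rightarrow> bool" where
  "null n F \<longleftrightarrow> (case n of 0 \<Rightarrow> \<forall>g\<in>tuples G 0. F g \<in> N
     | Suc m \<Rightarrow> \<exists>K\<in>lifts m. \<forall>g\<in>tuples G n. F g - codiff G act m K g \<in> N)"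

lemma j_in: "x \<in> S \<Longrightarrow> j x \<in> carrier A"
  using j_image by blast

lemma j_0: "j 0 = \<one>\<^bsub>A\<^esub>"
proof -
  show ?thesis
    using j_add[of 0 0] j_in[of 0] S_0 by (simp add: A.l_cancel_one')
qed

lemma j_minus: "x \<in> S \<Longrightarrow> j (- x) = inv\<^bsub>A\<^esub> (j x)"
proof -
  assume x: "x \<in> S"
  then have "j (- x) \<otimes>\<^bsub>A\<^esub> j x = \<one>\<^bsub>A\<^esub>"
    using j_add[of "- x" x] S_minus[of x] by (simp add: j_0)
  then show ?thesis
    using x j_in S_minus by (metis A.inv_equality)
qed

lemma S_diff: "x \<in> S \<Longrightarrow> y \<in> S \<Longrightarrow> x - y \<in> S"
  using S_add[of x "- y"] S_minus[of y] by simp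

lemma j_eq_iff: "x \<in> S \<Longrightarrow> y \<in> S \<Longrightarrow> j x = j y \<longleftrightarrow> x - y \<in> N"
proof -
  assume xy: "x \<in> S" "y \<in> S"
  have "j x = j (x - y) \<otimes>\<^bsub>A\<^esub> j y"
    using j_add[of "x - y" y] xy S_diff by simp
  then have "j x = j y \<longleftrightarrow> j (x - y) = \<one>\<^bsub>A\<^esub>"
    using xy S_diff j_in by (metis A.l_one A.r_cancel_one')
  then show ?thesis
    unfolding N_def using xy S_diff by simp
qed

lemma N_S: "x \<in> N \<Longrightarrow> x \<in> S"
  by (simp add: N_def)

lemma N_0: "0 \<in> N"
  by (simp add: N_def S_0 j_0)

lemma N_minus: "x \<in> N \<Longrightarrow> - x \<in> N"
  using j_eq_iff[of 0 x] by (auto simp: N_def S_0 j_0 S_minus)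

lemma N_add: "x \<in> N \<Longrightarrow> y \<in> N \<Longrightarrow> x + y \<in> N"
proof -
  show "x \<in> N \<Longrightarrow> y \<in> N \<Longrightarrow> x + y \<in> N"
    by (simp add: N_def S_add j_add)
qed

lemma codiff_in_S: "g \<in> tuples G (Suc n) \<Longrightarrow> (\<And>g. g \<in> tuples G n \<Longrightarrow> F g \<in> S) \<Longrightarrow> codiff G act n F g \<in> S"
  by (rule codiff_closed) (auto intro: S_0 S_add S_minus S_act)

lemma lifts_add: "F \<in> lifts n \<Longrightarrow> F' \<in> lifts n \<Longrightarrow> (\<lambda>g. F g + F' g) \<in> lifts n"
  by (auto simp: lifts_def S_add intro: loc_const_map2)

lemma lifts_minus: "F \<in> lifts n \<Longrightarrow> (\<lambda>g. - F g) \<in> lifts n"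
  by (auto simp: lifts_def S_minus intro: loc_const_map)

lemma lifts_0: "(\<lambda>g. 0) \<in> lifts n"
  by (auto simp: lifts_def S_0 loc_const_const)

lemma codiff_lifts: "F \<in> lifts n \<Longrightarrow> codiff G act n F \<in> lifts (Suc n)"
  by (auto simp: lifts_def loc_const_codiff intro: codiff_in_S)

lemma codiff_zero: "g \<in> tuples G (Suc n) \<Longrightarrow> codiff G act n (\<lambda>g. 0) g = 0"
  using codiff_add[of g n "\<lambda>g. 0" "\<lambda>g. 0"] by simp

lemma null_add: "null n F \<Longrightarrow> null n F' \<Longrightarrow> null n (\<lambda>g. F g + F' g)"
proof (cases n)
  case 0
  then show "null n F \<Longrightarrow> null n F' \<Longrightarrow> ?thesis" by (auto simp: null_def N_add)
next
  case (Suc m)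
  assume "null n F" "null n F'"
  then obtain K K' where K: "K \<in> lifts m" "\<And>g. g \<in> tuples G n \<Longrightarrow> F g - codiff G act m K g \<in> N"
    and K': "K' \<in> lifts m" "\<And>g. g \<in> tuples G n \<Longrightarrow> F' g - codiff G act m K' g \<in> N"
    using Suc unfolding null_def by auto
  have "F g + F' g - codiff G act m (\<lambda>g. K g + K' g) g \<in> N" if "g \<in> tuples G n" for g
    using N_add[OF K(2)[OF that] K'(2)[OF that]] that Suc by (simp add: codiff_add algebra_simps)
  then show ?thesis
    unfolding null_def Suc using lifts_add[OF K(1) K'(1)] Suc by auto
qed

lemma null_minus: "null n F \<Longrightarrow> null n (\<lambda>g. - F g)"
proof (cases n)
  case 0
  then show "null n F \<Longrightarrow> ?thesis" by (auto simp: null_def N_minus)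
next
  case (Suc m)
  assume "null n F"
  then obtain K where K: "K \<in> lifts m" "\<And>g. g \<in> tuples G n \<Longrightarrow> F g - codiff G act m K g \<in> N"
    using Suc unfolding null_def by auto
  have "- F g - codiff G act m (\<lambda>g. - K g) g \<in> N" if "g \<in> tuples G n" for g
    using N_minus[OF K(2)[OF that]] that Suc by (simp add: codiff_minus algebra_simps)
  then show ?thesis
    unfolding null_def Suc using lifts_minus[OF K(1)] Suc by auto
qed

lemma null_N: "(\<And>g. g \<in> tuples G n \<Longrightarrow> F g \<in> N) \<Longrightarrow> null n F"
  by (cases n) (auto simp: null_def codiff_zero intro!: bexI[of _ "\<lambda>g. 0"] lifts_0)

lemma null_boundary: "K \<in> lifts m \<Longrightarrow> null (Suc m) (codiff G act m K)"
  unfolding null_def nat.case by (rule bexI[of _ K]) (simp_all only: diff_self N_0 ball_triv simp_thms)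

lemma null_S: "null n F \<Longrightarrow> g \<in> tuples G n \<Longrightarrow> F g \<in> S"
proof (cases n)
  case 0
  then show "null n F \<Longrightarrow> g \<in> tuples G n \<Longrightarrow> ?thesis" by (auto simp: null_def N_def)
next
  case (Suc m)
  assume "null n F" and g: "g \<in> tuples G n"
  then obtain K where K: "K \<in> lifts m" "\<And>g. g \<in> tuples G n \<Longrightarrow> F g - codiff G act m K g \<in> N"
    using Suc unfolding null_def by auto
  have "codiff G act m K g \<in> S"
    using codiff_lifts[OF K(1)] g Suc by (auto simp: lifts_def)
  from S_add[OF N_S[OF K(2)[OF g]] this] show ?thesis by simp
qed

lemma null_cong:
  assumes "null n F" "\<And>g. g \<in> tuples G n \<Longrightarrow> F' g - F g \<in> N" shows "null n F'"
  using null_add[OF assms(1) null_N[of n "\<lambda>g. F' g - F g"]] assms(2) by simp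

lemma reduce_in_cochains: "F \<in> lifts n \<Longrightarrow> reduce n F \<in> cochains G T A n"
  unfolding cochains_def lifts_def
proof clarify
  assume F: "loc_const (power_topology T n) F" "\<forall>g\<in>tuples G n. F g \<in> S"
  have "loc_const (power_topology T n) (reduce n F)"
    by (rule loc_const_cong[OF loc_const_map[OF F(1), of j]]) (simp add: reduce_def)
  moreover have "reduce n F \<in> extensional (tuples G n)"
    unfolding reduce_def by (rule restrict_extensional)
  moreover have "reduce n F \<in> tuples G n \<rightarrow> carrier A"
  proof (rule funcsetI)
    fix g assume g: "g \<in> tuples G n"
    show "reduce n F g \<in> carrier A"
      unfolding reduce_def restrict_apply'[OF g] by (rule j_in) (use F(2) g in blast)
  qed
  ultimately show "reduce n F \<in> extensional (tuples G n) \<and>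
      continuous_map (power_topology T n) (discrete_topology (carrier A)) (reduce n F)"
    unfolding continuous_map_discrete_iff topspace_power by (intro conjI)
qed

lemma cochains_lift:
  assumes "f \<in> cochains G T A n" obtains F where "F \<in> lifts n" "f = reduce n F"
proof -
  define s where "s = inv_into S j"
  have f: "f \<in> extensional (tuples G n)" "loc_const (power_topology T n) f"
      "\<And>g. g \<in> tuples G n \<Longrightarrow> f g \<in> carrier A"
    using assms by (auto simp: cochains_def continuous_map_discrete_iff)
  have s: "s v \<in> S" "j (s v) = v" if "v \<in> carrier A" for v
    using that unfolding s_def j_image[symmetric] by (auto intro: inv_into_into f_inv_into_f)
  show ?thesis
  proof
    show "(\<lambda>g. s (f g)) \<in> lifts n"
      using f s by (auto simp: lifts_def intro: loc_const_map)
    show "f = reduce n (\<lambda>g. s (f g))"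
      unfolding reduce_def
      by (rule extensionalityI[OF f(1), where g = "restrict _ _"]) (use f s in auto)
  qed
qed

lemma reduce_eq_iff:
  assumes "\<And>g. g \<in> tuples G n \<Longrightarrow> F g \<in> S" "\<And>g. g \<in> tuples G n \<Longrightarrow> F' g \<in> S"
  shows "reduce n F = reduce n F' \<longleftrightarrow> (\<forall>g\<in>tuples G n. F g - F' g \<in> N)"
proof -
  have "reduce n F = reduce n F' \<longleftrightarrow> (\<forall>g\<in>tuples G n. j (F g) = j (F' g))"
  proof (intro iffI ballI)
    fix g assume "reduce n F = reduce n F'" and g: "g \<in> tuples G n"
    then have "reduce n F g = reduce n F' g" by simp
    then show "j (F g) = j (F' g)"
      by (simp only: reduce_def restrict_apply'[OF g])
  next
    assume "\<forall>g\<in>tuples G n. j (F g) = j (F' g)"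
    then show "reduce n F = reduce n F'"
      unfolding reduce_def by (intro restrict_ext) blast
  qed
  then show ?thesis using assms by (simp add: j_eq_iff)
qed

lemma j_sum:
  assumes "finite I" "\<And>i. i \<in> I \<Longrightarrow> f i \<in> S"
  shows "sum f I \<in> S \<and> j (sum f I) = (\<Otimes>\<^bsub>A\<^esub>i\<in>I. j (f i))"
proof -
  show ?thesis
    using assms
  proof (induction I rule: finite_induct)
    case empty
    then show ?case by (simp add: j_0 S_0)
  next
    case (insert i I)
    then show ?case
      by (subst A.finprod_insert) (auto simp: j_add S_add j_in)
  qed
qed

lemma S_alt: "x \<in> S \<Longrightarrow> alt k x \<in> S"
  by (simp add: alt_def S_minus)

lemma j_alt: "x \<in> S \<Longrightarrow> j (alt k x) = j x [^]\<^bsub>A\<^esub> ((- 1) ^ k :: int)"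
proof -
  show "x \<in> S \<Longrightarrow> ?thesis"
    by (cases "even k") (simp_all add: alt_def j_minus j_in A.int_pow_neg A.int_pow_1)
qed

text \<open>
  The coboundary of the record \<open>A\<close>, written multiplicatively, is the reduction of \<^const>\<open>codiff\<close>.
\<close>

lemma coboundary_reduce:
  assumes F: "\<And>g. g \<in> tuples G n \<Longrightarrow> F g \<in> S"
  shows "coboundary G A act' n (reduce n F) = reduce (Suc n) (codiff G act n F)"
  unfolding coboundary_def reduce_def[of "Suc n"]
proof (rule restrict_ext)
  fix g assume g: "g \<in> tuples G (Suc n)"
  have g0: "g 0 \<in> carrier G" using g by (auto simp: PiE_iff)
  note cl = face_in[OF g] tail_in[OF g] init_in[OF g]
  define a where "a = act (g 0) (F (\<lambda>j\<in>{..<n}. g (Suc j)))"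
  define b where "b = (\<Sum>i<n. alt (Suc i) (F (face G n i g)))"
  define c where "c = alt (Suc n) (F (\<lambda>j\<in>{..<n}. g j))"
  have abc: "a \<in> S" "b \<in> S" "c \<in> S"
    using F cl g0 j_sum[of "{..<n}" "\<lambda>i. alt (Suc i) (F (face G n i g))"]
    by (auto simp: a_def b_def c_def S_act simp del: alt_Suc intro!: S_alt)
  have d: "codiff G act n F g = a + b + c"
    unfolding codiff_def sum.atMost_Suc[of _ n] sum.atMost_shift a_def b_def c_def
    by (simp add: coface_def) (simp add: alt_def)
  have ja: "act' (g 0) (reduce n F (\<lambda>j\<in>{..<n}. g (Suc j))) = j a"
    using cl(2) F g0 by (simp add: reduce_def a_def j_act del: restrict_apply PiE_restrict) (simp add: j_act)
  have jb: "(\<Otimes>\<^bsub>A\<^esub>i\<in>{..<n}. reduce n F (face G n i g) [^]\<^bsub>A\<^esub> ((-1) ^ Suc i :: int)) = j b"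
  proof -
    have "j b = (\<Otimes>\<^bsub>A\<^esub>i\<in>{..<n}. j (alt (Suc i) (F (face G n i g))))"
      unfolding b_def using j_sum[of "{..<n}" "\<lambda>i. alt (Suc i) (F (face G n i g))"] cl(1) F S_alt
      by (simp del: alt_Suc)
    also have "\<dots> = (\<Otimes>\<^bsub>A\<^esub>i\<in>{..<n}. reduce n F (face G n i g) [^]\<^bsub>A\<^esub> ((-1) ^ Suc i :: int))"
      by (rule A.finprod_cong') (use cl(1) F in \<open>auto simp: reduce_def j_alt j_in simp del: alt_Suc power_Suc\<close>)
    finally show ?thesis by simp
  qed
  have jc: "reduce n F (\<lambda>j\<in>{..<n}. g j) [^]\<^bsub>A\<^esub> ((-1) ^ Suc n :: int) = j c"
    unfolding c_def using cl(3) F by (simp add: reduce_def j_alt del: alt_Suc power_Suc)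
  show "act' (g 0) (reduce n F (\<lambda>j\<in>{..<n}. g (Suc j)))
        \<otimes>\<^bsub>A\<^esub> (\<Otimes>\<^bsub>A\<^esub>i\<in>{..<n}. reduce n F (face G n i g) [^]\<^bsub>A\<^esub> ((-1) ^ Suc i :: int))
        \<otimes>\<^bsub>A\<^esub> reduce n F (\<lambda>j\<in>{..<n}. g j) [^]\<^bsub>A\<^esub> ((-1) ^ Suc n :: int) = j (codiff G act n F g)"
    unfolding ja jb jc d using abc by (simp add: j_add S_add)
qed

lemma reduce_in_cocycles_iff:
  assumes "F \<in> lifts n"
  shows "reduce n F \<in> cocycles G T A act' n \<longleftrightarrow> (\<forall>g\<in>tuples G (Suc n). codiff G act n F g \<in> N)"
proof -
  have F: "F g \<in> S" if "g \<in> tuples G n" for g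
    using assms that by (auto simp: lifts_def)
  have "\<one>\<^bsub>cochain_group G T A (Suc n)\<^esub> = reduce (Suc n) (\<lambda>g. 0)"
    by (simp add: cochain_group_def reduce_def j_0)
  then show ?thesis
    using reduce_in_cochains[OF assms] reduce_eq_iff[of "Suc n" "codiff G act n F" "\<lambda>g. 0"] codiff_in_S[OF _ F]
    by (simp add: cocycles_def coboundary_reduce[OF F] S_0)
qed

lemma coboundaries_eq: "coboundaries G T A act' n = {reduce n F |F. null n F}"
proof (cases n)
  case 0
  have 1: "\<one>\<^bsub>cochain_group G T A 0\<^esub> = reduce 0 F" if "null 0 F" for F
    using that by (auto simp: cochain_group_def reduce_def null_def N_def simp del: lessThan_0 intro!: restrict_ext)
  have 2: "null 0 (\<lambda>g. 0)" by (rule null_N) (rule N_0)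
  have "{\<one>\<^bsub>cochain_group G T A 0\<^esub>} = {reduce 0 F |F. null 0 F}"
  proof (intro equalityI subsetI)
    fix x assume "x \<in> {\<one>\<^bsub>cochain_group G T A 0\<^esub>}"
    then have "x = reduce 0 (\<lambda>g. 0)" using 1[OF 2] by simp
    with 2 show "x \<in> {reduce 0 F |F. null 0 F}" by blast
  next
    fix x assume "x \<in> {reduce 0 F |F. null 0 F}"
    then obtain F where "null 0 F" "x = reduce 0 F" by blast
    then show "x \<in> {\<one>\<^bsub>cochain_group G T A 0\<^esub>}" using 1[of F] by simp
  qed
  then show ?thesis
    unfolding coboundaries_def 0 by simp
next
  case (Suc m)
  have "reduce n F \<in> coboundary G A act' m ` cochains G T A m" if F: "null n F" for F
  proof -
    obtain K where K: "K \<in> lifts m" "\<And>g. g \<in> tuples G n \<Longrightarrow> F g - codiff G act m K g \<in> N"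
      using F Suc unfolding null_def by auto
    have "reduce n F = reduce n (codiff G act m K)"
      using K null_S[OF F] codiff_lifts[OF K(1)] Suc by (subst reduce_eq_iff) (auto simp: lifts_def)
    also have "\<dots> = coboundary G A act' m (reduce m K)"
      using K Suc by (subst coboundary_reduce) (auto simp: lifts_def)
    finally show ?thesis using reduce_in_cochains[OF K(1)] by auto
  qed
  moreover have "\<exists>F. coboundary G A act' m f = reduce n F \<and> null n F" if f: "f \<in> cochains G T A m" for f
  proof -
    obtain K where K: "K \<in> lifts m" "f = reduce m K"
      using cochains_lift[OF f] .
    then have "coboundary G A act' m f = reduce n (codiff G act m K)"
      using Suc by (subst K(2), subst coboundary_reduce) (auto simp: lifts_def)
    then show ?thesis
      using null_boundary[OF K(1)] Suc by blast
  qed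
  ultimately show ?thesis
    unfolding coboundaries_def Suc by auto
qed

lemma reduce_mult:
  assumes "\<And>g. g \<in> tuples G n \<Longrightarrow> F g \<in> S" "\<And>g. g \<in> tuples G n \<Longrightarrow> F' g \<in> S"
  shows "reduce n F \<otimes>\<^bsub>cochain_group G T A n\<^esub> reduce n F' = reduce n (\<lambda>g. F g + F' g)"
  using assms by (auto simp: cochain_group_def reduce_def j_add intro!: restrict_ext)

text \<open>
  The cohomology class represented by \<open>F\<close>, as a set of cochains of \<open>A\<close>. It is also defined for an
  \<open>F\<close> that does not represent a cocycle.
\<close>

definition coh_class :: "nat \<Rightarrow> ((nat \<Rightarrow> 'a) \<Rightarrow> 'm) \<Rightarrow> ((nat \<Rightarrow> 'a) \<Rightarrow> 'b) set" where
  "coh_class n F = {reduce n F' |F'. null n (\<lambda>g. F' g - F g)}"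

lemma reduce_in_coh_class: "reduce n F \<in> coh_class n F"
proof -
  have "null n (\<lambda>g. F g - F g)"
    by (rule null_N) (simp add: N_0)
  then show ?thesis
    unfolding coh_class_def by blast
qed

lemma coset_eq:
  assumes F: "\<And>g. g \<in> tuples G n \<Longrightarrow> F g \<in> S"
  shows "r_coset (cochain_group G T A n) (coboundaries G T A act' n) (reduce n F) = coh_class n F"
proof -
  have "\<exists>F'. reduce n H \<otimes>\<^bsub>cochain_group G T A n\<^esub> reduce n F = reduce n F' \<and> null n (\<lambda>g. F' g - F g)"
    if "null n H" for H
    using that by (intro exI[of _ "\<lambda>g. H g + F g"]) (simp add: reduce_mult[OF null_S[OF that] F])
  moreover have "\<exists>H. null n H \<and> reduce n F' = reduce n H \<otimes>\<^bsub>cochain_group G T A n\<^esub> reduce n F"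
    if "null n (\<lambda>g. F' g - F g)" for F'
    using that by (intro exI[of _ "\<lambda>g. F' g - F g"]) (simp add: reduce_mult[OF null_S[OF that] F])
  ultimately show ?thesis
    unfolding coh_class_def r_coset_def coboundaries_eq by blast
qed

lemma coh_class_eq_iff:
  assumes F: "\<And>g. g \<in> tuples G n \<Longrightarrow> F g \<in> S" and F': "\<And>g. g \<in> tuples G n \<Longrightarrow> F' g \<in> S"
  shows "coh_class n F = coh_class n F' \<longleftrightarrow> null n (\<lambda>g. F g - F' g)"
proof
  assume "coh_class n F = coh_class n F'"
  moreover have "reduce n F \<in> coh_class n F"
    by (rule reduce_in_coh_class)
  ultimately obtain F'' where F'': "reduce n F = reduce n F''" "null n (\<lambda>g. F'' g - F' g)"
    unfolding coh_class_def by blast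
  have S'': "F'' g \<in> S" if "g \<in> tuples G n" for g
    using S_add[OF null_S[OF F''(2) that] F'[OF that]] by simp
  from F''(1) have "F g - F'' g \<in> N" if "g \<in> tuples G n" for g
    using reduce_eq_iff[of n F F'', OF F S''] that by blast
  then show "null n (\<lambda>g. F g - F' g)"
    by (intro null_cong[OF F''(2)]) (simp add: algebra_simps)
next
  have *: "coh_class n F1 \<subseteq> coh_class n F2" if "null n (\<lambda>g. F1 g - F2 g)" for F1 F2
    using null_add[OF _ that] unfolding coh_class_def by fastforce
  assume a: "null n (\<lambda>g. F g - F' g)"
  then have "null n (\<lambda>g. F' g - F g)"
    using null_minus[OF a] by simp
  with a show "coh_class n F = coh_class n F'"
    using * by blast
qed

lemma coh_class_memD:
  assumes "\<And>g. g \<in> tuples G n \<Longrightarrow> F g \<in> S" "\<And>g. g \<in> tuples G n \<Longrightarrow> F' g \<in> S" "reduce n F' \<in> coh_class n F"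
  shows "null n (\<lambda>g. F' g - F g)"
proof -
  obtain F'' where F'': "reduce n F' = reduce n F''" "null n (\<lambda>g. F'' g - F g)"
    using assms(3) unfolding coh_class_def by blast
  have S'': "F'' g \<in> S" if "g \<in> tuples G n" for g
    using S_add[OF null_S[OF F''(2) that] assms(1)[OF that]] by simp
  from F''(1) have "F' g - F'' g \<in> N" if "g \<in> tuples G n" for g
    using reduce_eq_iff[of n F' F'', OF assms(2) S''] that by blast
  then show ?thesis
    by (intro null_cong[OF F''(2)]) (simp add: algebra_simps)
qed

lemma carrier_cohomology:
  "carrier (cohomology G T A act' n) =
    {coh_class n F |F. F \<in> lifts n \<and> (\<forall>g\<in>tuples G (Suc n). codiff G act n F g \<in> N)}"
proof -
  have "carrier (cohomology G T A act' n) =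
    (\<lambda>f. r_coset (cochain_group G T A n) (coboundaries G T A act' n) f) ` cocycles G T A act' n"
    unfolding cohomology_def FactGroup_def RCOSETS_def by (auto simp: r_coset_def)
  also have "cocycles G T A act' n = reduce n ` {F \<in> lifts n. \<forall>g\<in>tuples G (Suc n). codiff G act n F g \<in> N}"
  proof (intro subset_antisym subsetI)
    fix f assume f: "f \<in> cocycles G T A act' n"
    then obtain F where "F \<in> lifts n" "f = reduce n F"
      using cochains_lift unfolding cocycles_def by blast
    with f show "f \<in> reduce n ` {F \<in> lifts n. \<forall>g\<in>tuples G (Suc n). codiff G act n F g \<in> N}"
      using reduce_in_cocycles_iff by blast
  next
    fix f assume "f \<in> reduce n ` {F \<in> lifts n. \<forall>g\<in>tuples G (Suc n). codiff G act n F g \<in> N}"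
    then show "f \<in> cocycles G T A act' n"
      using reduce_in_cocycles_iff by blast
  qed
  finally have "carrier (cohomology G T A act' n) =
    (\<lambda>F. r_coset (cochain_group G T A n) (coboundaries G T A act' n) (reduce n F)) `
      {F \<in> lifts n. \<forall>g\<in>tuples G (Suc n). codiff G act n F g \<in> N}"
    by (simp only: image_image)
  also have "\<dots> = coh_class n ` {F \<in> lifts n. \<forall>g\<in>tuples G (Suc n). codiff G act n F g \<in> N}"
    by (rule image_cong[OF refl]) (simp add: lifts_def coset_eq)
  finally show ?thesis by (simp only: image_Collect)
qed

lemma one_cohomology:
  assumes "null n F"
  shows "\<one>\<^bsub>cohomology G T A act' n\<^esub> = coh_class n F"
proof -
  have "coh_class n F = coh_class n (\<lambda>g. 0)"
    using null_S[OF assms] assms by (subst coh_class_eq_iff) (auto simp: S_0)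
  then show ?thesis
    by (simp add: cohomology_def FactGroup_def coboundaries_eq coh_class_def)
qed

end

text \<open>
  A homomorphism \<open>\<phi>\<close> of discrete modules that lifts to an equivariant map \<open>\<psi>\<close> of the integral
  modules presenting them.
\<close>

locale presentation_map =
  P: presentation G T act A act' S j + Q: presentation G T bct B bct' S' j'
  for G :: "('a, 'x) monoid_scheme" and T :: "'a topology"
    and act :: "'a \<Rightarrow> 'm::ab_group_add \<Rightarrow> 'm" and A :: "('b, 'y) monoid_scheme"
    and act' :: "'a \<Rightarrow> 'b \<Rightarrow> 'b" and S :: "'m set" and j :: "'m \<Rightarrow> 'b"
    and bct :: "'a \<Rightarrow> 'm2::ab_group_add \<Rightarrow> 'm2" and B :: "('b2, 'y2) monoid_scheme"
    and bct' :: "'a \<Rightarrow> 'b2 \<Rightarrow> 'b2" and S' :: "'m2 set" and j' :: "'m2 \<Rightarrow> 'b2" +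
  fixes \<phi> :: "'b \<Rightarrow> 'b2" and \<psi> :: "'m \<Rightarrow> 'm2"
  assumes \<psi>_in: "x \<in> S \<Longrightarrow> \<psi> x \<in> S'"
    and \<psi>_add: "x \<in> S \<Longrightarrow> y \<in> S \<Longrightarrow> \<psi> (x + y) = \<psi> x + \<psi> y"
    and \<psi>_act: "\<gamma> \<in> carrier G \<Longrightarrow> x \<in> S \<Longrightarrow> \<psi> (act \<gamma> x) = bct \<gamma> (\<psi> x)"
    and \<phi>_j: "x \<in> S \<Longrightarrow> \<phi> (j x) = j' (\<psi> x)"
begin

lemma \<psi>_0: "\<psi> 0 = 0"
  using \<psi>_add[of 0 0] P.S_0 by simp

lemma \<psi>_minus: "x \<in> S \<Longrightarrow> \<psi> (- x) = - \<psi> x"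
  using \<psi>_add[of x "- x"] P.S_minus[of x] by (simp add: \<psi>_0 eq_neg_iff_add_eq_0 add.commute)

lemma \<psi>_diff: "x \<in> S \<Longrightarrow> y \<in> S \<Longrightarrow> \<psi> (x - y) = \<psi> x - \<psi> y"
  using \<psi>_add[of x "- y"] P.S_minus[of y] by (simp add: \<psi>_minus)

lemma \<psi>_sum: "finite I \<Longrightarrow> (\<And>i. i \<in> I \<Longrightarrow> f i \<in> S) \<Longrightarrow> \<psi> (sum f I) = (\<Sum>i\<in>I. \<psi> (f i))"
proof (induction I rule: finite_induct)
  case empty show ?case by (simp add: \<psi>_0)
next
  case (insert i I)
  then show ?case using P.j_sum[of I f] by (simp add: \<psi>_add)
qed

lemma \<psi>_diff_comm:
  assumes g: "g \<in> tuples G (Suc n)" and F: "\<And>g. g \<in> tuples G n \<Longrightarrow> F g \<in> S"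
  shows "codiff G bct n (\<lambda>g. \<psi> (F g)) g = \<psi> (codiff G act n F g)"
proof -
  have g0: "g 0 \<in> carrier G" using g by (auto simp: PiE_iff)
  note cl = P.face_in[OF g] P.tail_in[OF g] P.init_in[OF g]
  have 1: "coface G act n i F g \<in> S" "coface G bct n i (\<lambda>g. \<psi> (F g)) g = \<psi> (coface G act n i F g)" for i
    using cl F g0 by (auto simp: coface_def \<psi>_act P.S_act)
  have 2: "\<psi> (alt i x) = alt i (\<psi> x)" if "x \<in> S" for i x
    using that by (simp add: alt_def \<psi>_minus)
  show ?thesis
    unfolding codiff_def by (subst \<psi>_sum) (auto simp: 1 2 P.S_alt simp del: alt_Suc sum.atMost_Suc)
qed

lemma \<psi>_N: "x \<in> P.N \<Longrightarrow> \<psi> x \<in> Q.N"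
  using \<phi>_j[of x] \<phi>_j[of 0] by (auto simp: P.N_def Q.N_def \<psi>_in \<psi>_0 P.S_0 P.j_0 Q.j_0)

lemma \<psi>_lifts: "F \<in> P.lifts n \<Longrightarrow> (\<lambda>g. \<psi> (F g)) \<in> Q.lifts n"
  by (auto simp: P.lifts_def Q.lifts_def \<psi>_in intro: loc_const_map)

lemma \<psi>_null:
  assumes "P.null n F" shows "Q.null n (\<lambda>g. \<psi> (F g))"
proof (cases n)
  case 0
  then show ?thesis using assms by (auto simp: P.null_def Q.null_def \<psi>_N)
next
  case (Suc m)
  then obtain K where K: "K \<in> P.lifts m" "\<And>g. g \<in> tuples G n \<Longrightarrow> F g - codiff G act m K g \<in> P.N"
    using assms unfolding P.null_def by auto
  have "\<psi> (F g) - codiff G bct m (\<lambda>g. \<psi> (K g)) g \<in> Q.N" if g: "g \<in> tuples G n" for g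
  proof -
    have "codiff G act m K g \<in> S"
      using P.codiff_lifts[OF K(1)] g Suc by (auto simp: P.lifts_def)
    then have "\<psi> (F g - codiff G act m K g) = \<psi> (F g) - codiff G bct m (\<lambda>g. \<psi> (K g)) g"
      using K(1) g Suc P.null_S[OF assms g] by (subst \<psi>_diff_comm) (auto simp: \<psi>_diff P.lifts_def)
    then show ?thesis using \<psi>_N[OF K(2)[OF g]] by simp
  qed
  then show ?thesis
    unfolding Q.null_def using Suc \<psi>_lifts[OF K(1)] by auto
qed

theorem cohomology_map_coh_class:
  assumes F: "\<And>g. g \<in> tuples G n \<Longrightarrow> F g \<in> S"
  shows "cohomology_map G T B bct' \<phi> n (P.coh_class n F) = Q.coh_class n (\<lambda>g. \<psi> (F g))"
proof -
  have 1: "r_coset (cochain_group G T B n) (coboundaries G T B bct' n) (\<lambda>g\<in>tuples G n. \<phi> (x g))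
     = Q.coh_class n (\<lambda>g. \<psi> (F g))" if x: "x \<in> P.coh_class n F" for x
  proof -
    obtain F' where F': "x = P.reduce n F'" "P.null n (\<lambda>g. F' g - F g)"
      using x unfolding P.coh_class_def by blast
    have S': "F' g \<in> S" if "g \<in> tuples G n" for g
      using P.S_add[OF P.null_S[OF F'(2) that] F[OF that]] by simp
    have "(\<lambda>g\<in>tuples G n. \<phi> (x g)) = Q.reduce n (\<lambda>g. \<psi> (F' g))"
      unfolding F'(1) P.reduce_def Q.reduce_def by (rule restrict_ext) (simp add: \<phi>_j S')
    moreover have "Q.null n (\<lambda>g. \<psi> (F' g) - \<psi> (F g))"
      by (rule Q.null_cong[OF \<psi>_null[OF F'(2)]]) (simp add: \<psi>_diff S' F Q.N_0)
    ultimately show ?thesis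
      using S' F by (simp add: Q.coset_eq \<psi>_in Q.coh_class_eq_iff)
  qed
  have "P.reduce n F \<in> P.coh_class n F"
    by (rule P.reduce_in_coh_class)
  then have "(\<lambda>x. r_coset (cochain_group G T B n) (coboundaries G T B bct' n) (\<lambda>g\<in>tuples G n. \<phi> (x g)))
      ` P.coh_class n F = {Q.coh_class n (\<lambda>g. \<psi> (F g))}"
    using 1 by (auto simp: image_iff)
  then show ?thesis
    unfolding cohomology_map_def quotient_map_of_def by simp
qed

end

section \<open>Vanishing of the Bockstein map\<close>

text \<open>
  Multiplication by 3 in an abelian group.
\<close>

definition triple :: "'m::ab_group_add \<Rightarrow> 'm" where "triple x = x + x + x"

text \<open>
  Vanishing of the Bockstein map from degree \<open>n\<close> to degree \<open>n + 1\<close> with coefficients in \<open>S\<close>, for \<open>S\<close>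
  without 3-torsion: a cochain \<open>u\<close> that is a cocycle modulo 3 can be changed by a multiple of 3 so that
  its coboundary is divisible by 9. Changing \<open>u\<close> by a coboundary as well would not weaken the
  condition, because \<open>\<delta> \<circ> \<delta> = 0\<close>.
\<close>

definition bockstein_vanishes :: "('a, 'x) monoid_scheme \<Rightarrow> 'a topology \<Rightarrow> ('a \<Rightarrow> 'm \<Rightarrow> 'm::ab_group_add) \<Rightarrow> 'm set \<Rightarrow> nat \<Rightarrow> bool" where
  "bockstein_vanishes G T act S n \<longleftrightarrow>
    (\<forall>u. loc_const (power_topology T n) u \<and> (\<forall>g\<in>tuples G n. u g \<in> S) \<and>
        (\<forall>g\<in>tuples G (Suc n). codiff G act n u g \<in> triple ` S) \<longrightarrow>
      (\<exists>z. loc_const (power_topology T n) z \<and> (\<forall>g\<in>tuples G n. z g \<in> S) \<and>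
        (\<forall>g\<in>tuples G (Suc n). codiff G act n u g + triple (codiff G act n z g) \<in> triple ` triple ` S)))"

lemma codiff_additive:
  assumes "cochain_module G T act" "cochain_module G T act'"
    and add: "\<And>x y. \<Phi> (x + y) = \<Phi> x + \<Phi> y"
    and eqv: "\<And>\<gamma> x. \<gamma> \<in> carrier G \<Longrightarrow> \<Phi> (act \<gamma> x) = act' \<gamma> (\<Phi> x)"
    and g: "g \<in> tuples G (Suc n)"
  shows "\<Phi> (codiff G act n f g) = codiff G act' n (\<lambda>g. \<Phi> (f g)) g"
proof -
  have 0: "\<Phi> 0 = 0" using add[of 0 0] by simp
  have m: "\<Phi> (- x) = - \<Phi> x" for x
    using add[of x "- x"] 0 by (simp add: eq_neg_iff_add_eq_0 add.commute)
  have s: "\<Phi> (sum h I) = (\<Sum>i\<in>I. \<Phi> (h i))" for h :: "nat \<Rightarrow> 'c" and I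
    by (induction I rule: infinite_finite_induct) (simp_all add: 0 add)
  have g0: "g 0 \<in> carrier G" using g by (auto simp: PiE_iff)
  have "\<Phi> (alt i (coface G act n i f g)) = alt i (coface G act' n i (\<lambda>g. \<Phi> (f g)) g)" for i
    using eqv[OF g0] by (simp add: alt_def m coface_def)
  then show ?thesis
    unfolding codiff_def s by simp
qed

lemma triple_additive:
  assumes "\<And>x y. \<Phi> (x + y) = \<Phi> x + \<Phi> y"
  shows "\<Phi> (triple x) = triple (\<Phi> x)"
  by (simp add: triple_def assms)

lemma bockstein_vanishes_iso:
  assumes "cochain_module G T act" "cochain_module G T act'"
    and add: "\<And>x y. \<Phi> (x + y) = \<Phi> x + \<Phi> y"
    and eqv: "\<And>\<gamma> x. \<gamma> \<in> carrier G \<Longrightarrow> \<Phi> (act \<gamma> x) = act' \<gamma> (\<Phi> x)"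
    and inv: "\<And>v. \<Phi> v \<in> S" "\<And>v. \<Lambda> (\<Phi> v) = v" "\<And>y. y \<in> S \<Longrightarrow> \<Phi> (\<Lambda> y) = y"
    and bv: "bockstein_vanishes G T act UNIV n"
  shows "bockstein_vanishes G T act' S n"
  unfolding bockstein_vanishes_def
proof (intro allI impI, elim conjE)
  interpret A: cochain_module G T act by fact
  interpret B: cochain_module G T act' by fact
  have hom: "\<Phi> (codiff G act n f g) = codiff G act' n (\<lambda>g. \<Phi> (f g)) g" if "g \<in> tuples G (Suc n)" for f g
    by (rule codiff_additive[OF assms(1,2) _ _ that]) (simp_all only: add eqv)
  fix u assume u: "loc_const (power_topology T n) u" "\<forall>g\<in>tuples G n. u g \<in> S"
    "\<forall>g\<in>tuples G (Suc n). codiff G act' n u g \<in> triple ` S"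
  define v where "v = (\<lambda>g. \<Lambda> (u g))"
  have v: "loc_const (power_topology T n) v"
    unfolding v_def using loc_const_map[OF u(1), of \<Lambda>] .
  have \<Phi>v: "\<Phi> (codiff G act n v g) = codiff G act' n u g" if g: "g \<in> tuples G (Suc n)" for g
    unfolding hom[OF g] using g by (rule B.codiff_cong) (use u(2) inv(3) in \<open>simp add: v_def\<close>)
  have "codiff G act n v g \<in> range triple" if g: "g \<in> tuples G (Suc n)" for g
  proof -
    obtain s where s: "s \<in> S" "codiff G act' n u g = triple s" using u(3) g by blast
    have "\<Phi> (triple (\<Lambda> s)) = \<Phi> (codiff G act n v g)"
      unfolding \<Phi>v[OF g] s(2) triple_additive[of \<Phi>, OF add] using inv(3)[OF s(1)] by simp
    then have "triple (\<Lambda> s) = codiff G act n v g"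
      using inv(2) by metis
    then show ?thesis by (metis rangeI)
  qed
  then obtain z where z: "loc_const (power_topology T n) z"
    "\<And>g. g \<in> tuples G (Suc n) \<Longrightarrow> codiff G act n v g + triple (codiff G act n z g) \<in> triple ` range triple"
    using bv v unfolding bockstein_vanishes_def by auto
  show "\<exists>z. loc_const (power_topology T n) z \<and> (\<forall>g\<in>tuples G n. z g \<in> S) \<and>
        (\<forall>g\<in>tuples G (Suc n). codiff G act' n u g + triple (codiff G act' n z g) \<in> triple ` triple ` S)"
  proof (intro exI conjI ballI)
    show "loc_const (power_topology T n) (\<lambda>g. \<Phi> (z g))" using loc_const_map[OF z(1), of \<Phi>] .
    show "\<Phi> (z g) \<in> S" for g by (rule inv(1))
    fix g assume g: "g \<in> tuples G (Suc n)"
    obtain w where "codiff G act n v g + triple (codiff G act n z g) = triple (triple w)"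
      using z(2)[OF g] by blast
    then have "\<Phi> (codiff G act n v g) + triple (\<Phi> (codiff G act n z g)) = triple (triple (\<Phi> w))"
      using arg_cong[of _ _ \<Phi>] triple_additive[of \<Phi>, OF add] add by metis
    then show "codiff G act' n u g + triple (codiff G act' n (\<lambda>g. \<Phi> (z g)) g) \<in> triple ` triple ` S"
      using \<Phi>v[OF g] hom[OF g] inv(1) by (metis imageI)
  qed
qed

lemma bockstein_vanishes_prod:
  assumes "cochain_module G T act" "cochain_module G T act'"
    "cochain_module G T (\<lambda>\<gamma> (x, y). (act \<gamma> x, act' \<gamma> y))"
    and bv: "bockstein_vanishes G T act S n" "bockstein_vanishes G T act' S' n"
  shows "bockstein_vanishes G T (\<lambda>\<gamma> (x, y). (act \<gamma> x, act' \<gamma> y)) (S \<times> S') n"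
  unfolding bockstein_vanishes_def
proof (intro allI impI, elim conjE)
  let ?a = "\<lambda>\<gamma> (x, y). (act \<gamma> x, act' \<gamma> y)"
  have f: "fst (codiff G ?a n u g) = codiff G act n (\<lambda>g. fst (u g)) g"
    if "g \<in> tuples G (Suc n)" for u g
    by (rule codiff_additive[OF assms(3,1) _ _ that]) (auto simp: fst_add)
  have s: "snd (codiff G ?a n u g) = codiff G act' n (\<lambda>g. snd (u g)) g"
    if "g \<in> tuples G (Suc n)" for u g
    by (rule codiff_additive[OF assms(3,2) _ _ that]) (auto simp: snd_add)
  have tr: "triple (x, y) = (triple x, triple y)" for x :: 'c and y :: 'd
    by (simp add: triple_def)
  fix u assume u: "loc_const (power_topology T n) u" "\<forall>g\<in>tuples G n. u g \<in> S \<times> S'"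
    "\<forall>g\<in>tuples G (Suc n). codiff G ?a n u g \<in> triple ` (S \<times> S')"
  have u3: "codiff G act n (\<lambda>g. fst (u g)) g \<in> triple ` S \<and> codiff G act' n (\<lambda>g. snd (u g)) g \<in> triple ` S'"
    if g: "g \<in> tuples G (Suc n)" for g
  proof -
    obtain a b where ab: "a \<in> S" "b \<in> S'" "codiff G ?a n u g = (triple a, triple b)"
      using bspec[OF u(3) g] tr by auto
    have "codiff G act n (\<lambda>g. fst (u g)) g = triple a" "codiff G act' n (\<lambda>g. snd (u g)) g = triple b"
      using f[OF g, of u] s[OF g, of u] ab(3) by simp_all
    then show ?thesis using ab(1,2) by blast
  qed
  obtain z where z: "loc_const (power_topology T n) z" "\<And>g. g \<in> tuples G n \<Longrightarrow> z g \<in> S"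
    "\<And>g. g \<in> tuples G (Suc n) \<Longrightarrow> codiff G act n (\<lambda>g. fst (u g)) g + triple (codiff G act n z g) \<in> triple ` triple ` S"
    using bv(1)[unfolded bockstein_vanishes_def, rule_format, of "\<lambda>g. fst (u g)"] loc_const_map[OF u(1), of fst] u(2) u3
    by (auto simp: mem_Times_iff)
  obtain z' where z': "loc_const (power_topology T n) z'" "\<And>g. g \<in> tuples G n \<Longrightarrow> z' g \<in> S'"
    "\<And>g. g \<in> tuples G (Suc n) \<Longrightarrow> codiff G act' n (\<lambda>g. snd (u g)) g + triple (codiff G act' n z' g) \<in> triple ` triple ` S'"
    using bv(2)[unfolded bockstein_vanishes_def, rule_format, of "\<lambda>g. snd (u g)"] loc_const_map[OF u(1), of snd] u(2) u3
    by (auto simp: mem_Times_iff)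
  show "\<exists>z. loc_const (power_topology T n) z \<and> (\<forall>g\<in>tuples G n. z g \<in> S \<times> S') \<and>
        (\<forall>g\<in>tuples G (Suc n). codiff G ?a n u g + triple (codiff G ?a n z g) \<in> triple ` triple ` (S \<times> S'))"
  proof (intro exI conjI ballI)
    show "loc_const (power_topology T n) (\<lambda>g. (z g, z' g))" using loc_const_map2[OF z(1) z'(1), of Pair] .
    show "(z g, z' g) \<in> S \<times> S'" if "g \<in> tuples G n" for g using z(2) z'(2) that by blast
    fix g assume g: "g \<in> tuples G (Suc n)"
    have e: "codiff G ?a n u g = (codiff G act n (\<lambda>g. fst (u g)) g, codiff G act' n (\<lambda>g. snd (u g)) g)"
      "codiff G ?a n (\<lambda>g. (z g, z' g)) g = (codiff G act n z g, codiff G act' n z' g)"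
      using f[OF g, of u] s[OF g, of u] f[OF g, of "\<lambda>g. (z g, z' g)"] s[OF g, of "\<lambda>g. (z g, z' g)"]
      by (auto simp: prod_eq_iff)
    obtain a b where ab: "a \<in> S" "b \<in> S'"
      "codiff G act n (\<lambda>g. fst (u g)) g + triple (codiff G act n z g) = triple (triple a)"
      "codiff G act' n (\<lambda>g. snd (u g)) g + triple (codiff G act' n z' g) = triple (triple b)"
      using z(3)[OF g] z'(3)[OF g] by blast
    have "codiff G ?a n u g + triple (codiff G ?a n (\<lambda>g. (z g, z' g)) g) = triple (triple (a, b))"
      unfolding e tr using ab(3,4) by simp
    then show "codiff G ?a n u g + triple (codiff G ?a n (\<lambda>g. (z g, z' g)) g) \<in> triple ` triple ` (S \<times> S')"
      using ab(1,2) by blast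
  qed
qed

lemma (in cochain_setting) trivial_cochain_module: "cochain_module G T (trivial_act :: 'a \<Rightarrow> int \<Rightarrow> int)"
  by unfold_locales (simp_all add: loc_const_const)

lemma (in cochain_setting) presentation_Zmod:
  assumes "k > 0"
  shows "presentation G T (trivial_act :: 'a \<Rightarrow> int \<Rightarrow> int) (Zmod k) trivial_act UNIV (\<lambda>x. x mod int k)"
proof -
  interpret cochain_module G T "trivial_act :: 'a \<Rightarrow> int \<Rightarrow> int" by (rule trivial_cochain_module)
  show ?thesis
  proof (intro_locales, unfold presentation_axioms_def, intro conjI allI impI)
    show "comm_group (Zmod k)" by simp
    show "range (\<lambda>x. x mod int k) = carrier (Zmod k)"
    proof
      show "range (\<lambda>x. x mod int k) \<subseteq> carrier (Zmod k)"
        using assms by (auto simp: carrier_integer_mod_group)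
      show "carrier (Zmod k) \<subseteq> range (\<lambda>x. x mod int k)"
      proof
        fix x assume "x \<in> carrier (Zmod k)"
        then have "x = x mod int k" using assms by (simp add: carrier_integer_mod_group)
        then show "x \<in> range (\<lambda>x. x mod int k)" by blast
      qed
    qed
  qed (simp_all add: mod_simps)
qed

lemma triple_int: "x \<in> range (triple :: int \<Rightarrow> int) \<longleftrightarrow> 3 dvd x"
  by (auto simp: triple_def dvd_def image_iff)

text \<open>
  If \<open>u\<close> is a cocycle modulo 3 and \<open>w\<close> is a cocycle modulo 9 whose class reduces to the class of \<open>u\<close>,
  then \<open>w = u - y + 3 z\<close> with \<open>\<delta> y = 0\<close>, and \<open>z\<close> is the cochain sought.
\<close>

lemma (in cochain_setting) bockstein_vanishes_trivial:
  assumes surj: "cohomology_map G T (Zmod 3) trivial_act (\<lambda>x. x mod 3) n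
          ` carrier (cohomology G T (Zmod 9) trivial_act n)
        = carrier (cohomology G T (Zmod 3) trivial_act n)"
  shows "bockstein_vanishes G T (trivial_act :: 'a \<Rightarrow> int \<Rightarrow> int) UNIV n"
proof -
  interpret P9: presentation G T "trivial_act :: 'a \<Rightarrow> int \<Rightarrow> int" "Zmod 9" trivial_act UNIV "\<lambda>x. x mod 9"
    using presentation_Zmod[of 9] by simp
  interpret P3: presentation G T "trivial_act :: 'a \<Rightarrow> int \<Rightarrow> int" "Zmod 3" trivial_act UNIV "\<lambda>x. x mod 3"
    using presentation_Zmod[of 3] by simp
  interpret M: presentation_map G T "trivial_act :: 'a \<Rightarrow> int \<Rightarrow> int" "Zmod 9" trivial_act UNIV "\<lambda>x. x mod 9"
    "trivial_act :: 'a \<Rightarrow> int \<Rightarrow> int" "Zmod 3" trivial_act UNIV "\<lambda>x. x mod 3" "\<lambda>x. x mod 3" "\<lambda>x. x"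
    by unfold_locales (simp_all add: mod_mod_cancel)
  have N3: "x \<in> P3.N \<longleftrightarrow> 3 dvd x" for x by (auto simp: P3.N_def)
  have N9: "x \<in> P9.N \<longleftrightarrow> 9 dvd x" for x by (auto simp: P9.N_def)
  show ?thesis
    unfolding bockstein_vanishes_def
  proof (intro allI impI, elim conjE)
    fix u :: "(nat \<Rightarrow> 'a) \<Rightarrow> int"
    assume u: "loc_const (power_topology T n) u" "\<forall>g\<in>tuples G (Suc n). codiff G trivial_act n u g \<in> range triple"
    have "u \<in> P3.lifts n" using u(1) by (simp add: P3.lifts_def)
    then have "P3.coh_class n u \<in> carrier (cohomology G T (Zmod 3) trivial_act n)"
      unfolding P3.carrier_cohomology using u(2) by (auto simp: N3 triple_int)
    then obtain w where w: "w \<in> P9.lifts n" "\<And>g. g \<in> tuples G (Suc n) \<Longrightarrow> codiff G trivial_act n w g \<in> P9.N"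
      and "P3.coh_class n u = cohomology_map G T (Zmod 3) trivial_act (\<lambda>x. x mod 3) n (P9.coh_class n w)"
      unfolding surj[symmetric] P9.carrier_cohomology by blast
    then have "P3.coh_class n u = P3.coh_class n w"
      by (simp add: M.cohomology_map_coh_class)
    then have nul: "P3.null n (\<lambda>g. u g - w g)"
      by (subst (asm) P3.coh_class_eq_iff) simp_all
    have lw: "loc_const (power_topology T n) w" using w(1) by (simp add: P9.lifts_def)
    obtain y where y: "loc_const (power_topology T n) y" "\<And>g. g \<in> tuples G n \<Longrightarrow> 3 dvd u g - w g - y g"
      "\<And>g. g \<in> tuples G (Suc n) \<Longrightarrow> codiff G trivial_act n y g = 0"
    proof (cases n)
      case 0
      show ?thesis
        by (rule that[of "\<lambda>g. 0"]) (use nul in \<open>auto simp: 0 loc_const_const P3.null_def N3 P3.codiff_zero simp del: lessThan_0\<close>)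
    next
      case (Suc m)
      obtain K where K: "K \<in> P3.lifts m" "\<And>g. g \<in> tuples G n \<Longrightarrow> u g - w g - codiff G trivial_act m K g \<in> P3.N"
        using nul Suc unfolding P3.null_def by auto
      show ?thesis
      proof (rule that[of "codiff G trivial_act m K"])
        show "loc_const (power_topology T n) (codiff G trivial_act m K)"
          using P3.codiff_lifts[OF K(1)] Suc by (simp add: P3.lifts_def)
        show "3 dvd u g - w g - codiff G trivial_act m K g" if "g \<in> tuples G n" for g
          using K(2)[OF that] by (simp add: N3)
        show "codiff G trivial_act n (codiff G trivial_act m K) g = 0" if "g \<in> tuples G (Suc n)" for g
          using that unfolding Suc by (rule P9.codiff_codiff)
      qed
    qed
    define z where "z = (\<lambda>g. (w g + y g - u g) div 3)"
    have lz: "loc_const (power_topology T n) z"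
      unfolding z_def
      using loc_const_map2[OF loc_const_map2[OF lw y(1), of "(+)"] u(1), of "\<lambda>a b. (a - b) div 3"] .
    have z: "w g = u g - y g + (z g + z g + z g)" if "g \<in> tuples G n" for g
    proof -
      have "3 dvd w g + y g - u g"
        using y(2)[OF that] by (metis add.commute diff_diff_eq2 dvd_minus_iff minus_diff_eq diff_diff_eq)
      then have "w g + y g - u g = 3 * z g" unfolding z_def by simp
      then show ?thesis by simp
    qed
    have "codiff G trivial_act n u g + triple (codiff G trivial_act n z g) \<in> triple ` range triple"
      if g: "g \<in> tuples G (Suc n)" for g
    proof -
      have "codiff G trivial_act n w g = codiff G trivial_act n (\<lambda>g. u g - y g + (z g + z g + z g)) g"
        using g z by (rule P9.codiff_cong)
      also have "\<dots> = codiff G trivial_act n u g + triple (codiff G trivial_act n z g)"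
        by (simp only: P9.codiff_add[OF g] P9.codiff_diff[OF g] y(3)[OF g] triple_def diff_0_right)
      finally have "9 dvd codiff G trivial_act n u g + triple (codiff G trivial_act n z g)"
        using w(2)[OF g] by (simp add: N9)
      then obtain s where "codiff G trivial_act n u g + triple (codiff G trivial_act n z g) = 9 * s" ..
      then have "codiff G trivial_act n u g + triple (codiff G trivial_act n z g) = triple (triple s)"
        by (simp add: triple_def)
      then show ?thesis by blast
    qed
    then show "\<exists>z. loc_const (power_topology T n) z \<and> (\<forall>g\<in>tuples G n. z g \<in> UNIV) \<and>
        (\<forall>g\<in>tuples G (Suc n). codiff G trivial_act n u g + triple (codiff G trivial_act n z g) \<in> triple ` range triple)"
      using lz by blast
  qed
qed

section \<open>Shapiro's lemma for permutation modules\<close>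

lemma sum_fun_apply: "(\<Sum>i\<in>I. h i) x = (\<Sum>i\<in>I. h i x)" for h :: "'i \<Rightarrow> 'b \<Rightarrow> 'c::comm_monoid_add"
  by (induction I rule: infinite_finite_induct) simp_all

lemma alt_fun_apply: "alt i h x = alt i (h x)" for h :: "'b \<Rightarrow> 'c::ab_group_add"
  by (simp add: alt_def)

text \<open>
  A continuous surjection \<open>\<theta>\<close> to a finite abelian group \<open>'q\<close>. The group acts on \<open>'q\<close> by translations
  and on the integral functions on \<open>'q\<close> by \<open>perm\<close>; this is the module coinduced from the kernel
  \<open>ker\<close> of \<open>\<theta>\<close>, which is a group \<open>GK\<close> with topology \<open>TK\<close>.
\<close>

locale finite_quotient = cochain_setting G T
  for G :: "('a, 'x) monoid_scheme" and T :: "'a topology" +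
  fixes \<theta> :: "'a \<Rightarrow> 'q::{finite, ab_group_add}"
  assumes \<theta>_mult: "g \<in> carrier G \<Longrightarrow> h \<in> carrier G \<Longrightarrow> \<theta> (g \<otimes>\<^bsub>G\<^esub> h) = \<theta> g + \<theta> h"
    and \<theta>_loc_const: "loc_const T \<theta>"
    and \<theta>_surj: "\<theta> ` carrier G = UNIV"
begin

definition perm :: "'a \<Rightarrow> ('q \<Rightarrow> int) \<Rightarrow> 'q \<Rightarrow> int" where
  "perm \<gamma> v = (\<lambda>x. v (x - \<theta> \<gamma>))"

definition ker :: "'a set" where "ker = {g \<in> carrier G. \<theta> g = 0}"

definition GK :: "('a, 'x) monoid_scheme" where "GK = G\<lparr>carrier := ker\<rparr>"

definition TK :: "'a topology" where "TK = subtopology T ker"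

lemma \<theta>_one: "\<theta> \<one>\<^bsub>G\<^esub> = 0"
  using \<theta>_mult[of "\<one>\<^bsub>G\<^esub>" "\<one>\<^bsub>G\<^esub>"] by simp

lemma \<theta>_inv: "g \<in> carrier G \<Longrightarrow> \<theta> (inv\<^bsub>G\<^esub> g) = - \<theta> g"
  using \<theta>_mult[of g "inv\<^bsub>G\<^esub> g"] by (simp add: \<theta>_one eq_neg_iff_add_eq_0 add.commute)

lemma subgroup_ker: "subgroup ker G"
  by (rule subgroupI) (auto simp: ker_def \<theta>_inv \<theta>_mult intro: exI[of _ "\<one>\<^bsub>G\<^esub>"] \<theta>_one)

lemma closedin_ker: "closedin T ker"
proof -
  have "continuous_map T (discrete_topology UNIV) \<theta>"
    using \<theta>_loc_const by (simp add: continuous_map_discrete_iff)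
  then have "closedin T {x \<in> topspace T. \<theta> x \<in> {0}}"
    by (rule closedin_continuous_map_preimage) simp
  then show ?thesis by (simp add: ker_def)
qed

lemma ker_G: "g \<in> ker \<Longrightarrow> g \<in> carrier G"
  by (simp add: ker_def)

sublocale K: cochain_setting GK TK
proof
  have grp: "group GK"
    unfolding GK_def by (rule subgroup.subgroup_is_group[OF subgroup_ker is_group])
  have inv: "inv\<^bsub>GK\<^esub> x = inv\<^bsub>G\<^esub> x" if "x \<in> ker" for x
    unfolding GK_def using m_inv_consistent[OF subgroup_ker that] .
  have tops: "topspace TK = ker"
    using ker_G by (auto simp: TK_def)
  have into: "continuous_map TK T (\<lambda>x. x)"
    unfolding TK_def by (rule continuous_map_from_subtopology) simp
  have "continuous_map (prod_topology TK TK) T (\<lambda>p. fst p \<otimes>\<^bsub>G\<^esub> snd p)"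
    by (rule continuous_mult)
      (use continuous_map_compose[OF continuous_map_fst into] continuous_map_compose[OF continuous_map_snd into]
        in \<open>simp_all add: comp_def\<close>)
  then have "continuous_map (prod_topology TK TK) TK (\<lambda>p. fst p \<otimes>\<^bsub>G\<^esub> snd p)"
    unfolding TK_def[of] by (subst continuous_map_in_subtopology)
      (auto simp: TK_def[symmetric] tops subgroup.m_closed[OF subgroup_ker])
  moreover have "continuous_map TK TK (\<lambda>x. inv\<^bsub>G\<^esub> x)"
    using continuous_inv[OF into] unfolding TK_def
    by (auto simp: continuous_map_in_subtopology subgroup.m_inv_closed[OF subgroup_ker])
  then have "continuous_map TK TK (\<lambda>x. inv\<^bsub>GK\<^esub> x)"
    by (rule continuous_map_eq) (simp add: tops inv)
  ultimately show "topological_group GK TK"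
    unfolding topological_group_def using grp tops by (simp add: GK_def case_prod_unfold)
qed

sublocale cochain_module G T perm
proof
  fix \<gamma> \<gamma>' v w
  show "perm \<gamma> (v + w) = perm \<gamma> v + perm \<gamma> w" by (auto simp: perm_def)
  show "perm (\<gamma> \<otimes>\<^bsub>G\<^esub> \<gamma>') v = perm \<gamma> (perm \<gamma>' v)"
    if "\<gamma> \<in> carrier G" "\<gamma>' \<in> carrier G"
    using that by (auto simp: perm_def \<theta>_mult algebra_simps)
  show "loc_const T (\<lambda>\<gamma>. perm \<gamma> v)"
    unfolding perm_def using loc_const_map[OF \<theta>_loc_const, of "\<lambda>t x. v (x - t)"] .
qed

lemma trivial_K: "cochain_module GK TK (trivial_act :: 'a \<Rightarrow> int \<Rightarrow> int)"
  by (rule K.trivial_cochain_module)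

text \<open>
  A section of \<open>\<theta>\<close>; it need not be a homomorphism, nor map \<open>0\<close> to the neutral element.
\<close>

definition \<sigma> :: "'q \<Rightarrow> 'a" where "\<sigma> = inv_into (carrier G) \<theta>"

lemma \<sigma>_in: "\<sigma> x \<in> carrier G" and \<theta>_\<sigma>: "\<theta> (\<sigma> x) = x"
  using \<theta>_surj unfolding \<sigma>_def by (simp_all add: inv_into_into f_inv_into_f)

text \<open>
  A cochain with values in functions on \<open>'q\<close> is a cochain of the action groupoid: \<open>g\<close> and \<open>x\<close> determine
  a chain of arrows through the points \<open>vertex g x i\<close>, starting at \<open>x\<close>. The section \<open>\<sigma>\<close> moves every
  arrow to a loop at the point \<open>0\<close>, that is, to an element of \<open>ker\<close>. This retraction of the groupoid
  onto \<open>ker\<close> is naturally isomorphic to the identity, and \<open>prism\<close> and \<open>homotopy\<close> are the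
  prisms and the cochain homotopy of that isomorphism: in the \<open>j\<close>-th prism the first \<open>j\<close> arrows have
  been moved, the remaining ones have not, and \<open>\<sigma>\<close> joins the two parts.
\<close>

definition vertex :: "(nat \<Rightarrow> 'a) \<Rightarrow> 'q \<Rightarrow> nat \<Rightarrow> 'q" where
  "vertex g x i = x - (\<Sum>l<i. \<theta> (g l))"

definition loop :: "(nat \<Rightarrow> 'a) \<Rightarrow> 'q \<Rightarrow> nat \<Rightarrow> 'a" where
  "loop g x i = inv\<^bsub>G\<^esub> \<sigma> (vertex g x i) \<otimes>\<^bsub>G\<^esub> g i \<otimes>\<^bsub>G\<^esub> \<sigma> (vertex g x (Suc i))"

definition loops :: "nat \<Rightarrow> (nat \<Rightarrow> 'a) \<Rightarrow> 'q \<Rightarrow> nat \<Rightarrow> 'a" where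
  "loops n g x = (\<lambda>i\<in>{..<n}. loop g x i)"

definition prism :: "nat \<Rightarrow> nat \<Rightarrow> (nat \<Rightarrow> 'a) \<Rightarrow> 'q \<Rightarrow> nat \<Rightarrow> 'a" where
  "prism n j g x = (\<lambda>i\<in>{..<Suc n}. if i < j then loop g x i
     else if i = j then inv\<^bsub>G\<^esub> \<sigma> (vertex g x j) else g (i - 1))"

definition homotopy :: "nat \<Rightarrow> ((nat \<Rightarrow> 'a) \<Rightarrow> 'q \<Rightarrow> int) \<Rightarrow> (nat \<Rightarrow> 'a) \<Rightarrow> 'q \<Rightarrow> int" where
  "homotopy n f g x = (\<Sum>j<Suc n. alt j (f (prism n j g x) 0))"

lemma vertex_0 [simp]: "vertex g x 0 = x"
  by (simp add: vertex_def)

lemma vertex_Suc: "vertex g x (Suc i) = vertex g x i - \<theta> (g i)"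
  by (simp add: vertex_def algebra_simps)

lemma vertex_tail: "i \<le> n \<Longrightarrow> vertex (\<lambda>j\<in>{..<n}. g (Suc j)) (x - \<theta> (g 0)) i = vertex g x (Suc i)"
  by (induction i) (simp_all add: vertex_Suc)

lemma vertex_init: "i \<le> n \<Longrightarrow> vertex (\<lambda>j\<in>{..<n}. g j) x i = vertex g x i"
  by (induction i) (simp_all add: vertex_Suc)

lemma tuple_in: "g \<in> tuples G n \<Longrightarrow> i < n \<Longrightarrow> g i \<in> carrier G"
  by (auto simp: PiE_iff)

lemma vertex_face:
  assumes "g \<in> tuples G (Suc n)" "i < n"
  shows "k \<le> n \<Longrightarrow> vertex (face G n i g) x k = (if k \<le> i then vertex g x k else vertex g x (Suc k))"
proof (induction k)
  case 0
  show ?case by simp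
next
  case (Suc k)
  then show ?case
    using assms(2) tuple_in[OF assms(1), of k] tuple_in[OF assms(1), of "Suc k"]
    by (cases k i rule: linorder_cases) (auto simp: vertex_Suc face_def \<theta>_mult)
qed

lemma loop_in_ker: "g i \<in> carrier G \<Longrightarrow> loop g x i \<in> ker"
  by (simp add: ker_def loop_def \<theta>_mult \<theta>_inv \<sigma>_in \<theta>_\<sigma> vertex_Suc)

lemma loop_tail: "i < n \<Longrightarrow> loop (\<lambda>j\<in>{..<n}. g (Suc j)) (x - \<theta> (g 0)) i = loop g x (Suc i)"
  unfolding loop_def by (simp add: vertex_tail del: restrict_apply) simp

lemma loop_init: "i < n \<Longrightarrow> loop (\<lambda>j\<in>{..<n}. g j) x i = loop g x i"
  unfolding loop_def by (simp add: vertex_init del: restrict_apply) simp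

lemma cancel_middle:
  assumes "a \<in> carrier G" "b \<in> carrier G" "c \<in> carrier G" "d \<in> carrier G" "s \<in> carrier G"
  shows "a \<otimes>\<^bsub>G\<^esub> b \<otimes>\<^bsub>G\<^esub> s \<otimes>\<^bsub>G\<^esub> (inv\<^bsub>G\<^esub> s \<otimes>\<^bsub>G\<^esub> c \<otimes>\<^bsub>G\<^esub> d) = a \<otimes>\<^bsub>G\<^esub> (b \<otimes>\<^bsub>G\<^esub> c) \<otimes>\<^bsub>G\<^esub> d"
proof -
  have "s \<otimes>\<^bsub>G\<^esub> (inv\<^bsub>G\<^esub> s \<otimes>\<^bsub>G\<^esub> (c \<otimes>\<^bsub>G\<^esub> d)) = c \<otimes>\<^bsub>G\<^esub> d"
    using assms by (simp add: m_assoc[symmetric])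
  then show ?thesis using assms by (simp add: m_assoc)
qed

lemma loop_face:
  assumes g: "g \<in> tuples G (Suc n)" and "i < n" "k < n"
  shows "loop (face G n i g) x k =
    (if k < i then loop g x k else if k = i then loop g x i \<otimes>\<^bsub>G\<^esub> loop g x (Suc i) else loop g x (Suc k))"
proof -
  note c = tuple_in[OF g]
  have f: "face G n i g k = (if k < i then g k else if k = i then g i \<otimes>\<^bsub>G\<^esub> g (Suc i) else g (Suc k))"
    if "k < n" for k
    using that by (simp add: face_def)
  show ?thesis
    using assms(2,3) c[of i] c[of "Suc i"]
    by (cases k i rule: linorder_cases)
      (auto simp: loop_def vertex_face[OF g assms(2)] f cancel_middle \<sigma>_in simp del: vertex_0)
qed

lemma loop_cancel:
  "g i \<in> carrier G \<Longrightarrow> loop g x i \<otimes>\<^bsub>G\<^esub> inv\<^bsub>G\<^esub> \<sigma> (vertex g x (Suc i)) = inv\<^bsub>G\<^esub> \<sigma> (vertex g x i) \<otimes>\<^bsub>G\<^esub> g i"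
  by (simp add: loop_def m_assoc \<sigma>_in)

lemma loops_in: "g \<in> tuples G n \<Longrightarrow> loops n g x \<in> tuples GK n"
  by (auto simp: loops_def PiE_iff GK_def intro!: loop_in_ker)

lemma prism_in: "g \<in> tuples G n \<Longrightarrow> j \<le> n \<Longrightarrow> prism n j g x \<in> tuples G (Suc n)"
  using ker_G loop_in_ker by (auto simp: prism_def PiE_iff \<sigma>_in)

lemma face_GK: "face GK = face G"
  by (auto simp: face_def GK_def fun_eq_iff)

lemma loops_tail: "(\<lambda>j\<in>{..<n}. loops (Suc n) g x (Suc j)) = loops n (\<lambda>j\<in>{..<n}. g (Suc j)) (x - \<theta> (g 0))"
  unfolding loops_def by (rule restrict_ext) (simp add: loop_tail)

lemma loops_init: "(\<lambda>j\<in>{..<n}. loops (Suc n) g x j) = loops n (\<lambda>j\<in>{..<n}. g j) x"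
  unfolding loops_def by (rule restrict_ext) (simp add: loop_init del: restrict_restrict)

lemma loops_face:
  assumes "g \<in> tuples G (Suc n)" "i < n"
  shows "face G n i (loops (Suc n) g x) = loops n (face G n i g) x"
  unfolding face_def[of G n i "loops _ _ _"] loops_def[of n]
  by (rule restrict_ext) (use assms in \<open>auto simp: loops_def loop_face\<close>)

text \<open>
  Pulling back along the retraction commutes with the coboundary, and so does the restriction to \<open>ker\<close>
  followed by evaluation at \<open>0\<close> in the next lemma.
\<close>

lemma codiff_loops:
  assumes g: "g \<in> tuples G (Suc n)"
  shows "codiff G perm n (\<lambda>g x. F (loops n g x)) g x = codiff GK trivial_act n F (loops (Suc n) g x)"
proof -
  have "coface G perm n i (\<lambda>g x. F (loops n g x)) g x = coface GK trivial_act n i F (loops (Suc n) g x)" for i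
    using loops_face[OF g, of "i - 1" x] loops_tail[of n g x] loops_init[of n g x]
    by (simp add: coface_def perm_def face_GK)
  then show ?thesis
    unfolding codiff_def sum_fun_apply alt_fun_apply by simp
qed

lemma codiff_restrict_base:
  assumes k: "k \<in> tuples GK (Suc n)"
  shows "codiff GK trivial_act n (\<lambda>k. f k 0) k = codiff G perm n f k 0"
proof -
  have "\<theta> (k 0) = 0" using k by (auto simp: PiE_iff GK_def ker_def)
  then have "coface GK trivial_act n i (\<lambda>k. f k 0) k = coface G perm n i f k 0" for i
    by (simp add: coface_def perm_def face_GK)
  then show ?thesis
    unfolding codiff_def sum_fun_apply alt_fun_apply by simp
qed

lemma prism_tail_0:
  assumes "g \<in> tuples G n" shows "(\<lambda>i\<in>{..<n}. prism n 0 g x (Suc i)) = g"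
  using assms by (auto simp: prism_def PiE_iff extensional_def fun_eq_iff)

lemma prism_tail:
  assumes "0 < j" "j \<le> n"
  shows "(\<lambda>i\<in>{..<n}. prism n j g x (Suc i)) = prism (n - 1) (j - 1) (\<lambda>i\<in>{..<n - 1}. g (Suc i)) (x - \<theta> (g 0))"
proof -
  obtain m j' where [simp]: "n = Suc m" "j = Suc j'" using assms by (cases n; cases j) auto
  show ?thesis
    unfolding prism_def[of "n - 1"] using assms
    by (auto simp: prism_def loop_tail vertex_tail intro!: restrict_ext simp del: restrict_apply)
      (auto simp: fun_eq_iff)
qed

lemma prism_init_last: "(\<lambda>i\<in>{..<n}. prism n n g x i) = loops n g x"
  unfolding loops_def by (rule restrict_ext) (simp add: prism_def)

lemma prism_init:
  assumes "j < n"
  shows "(\<lambda>i\<in>{..<n}. prism n j g x i) = prism (n - 1) j (\<lambda>i\<in>{..<n - 1}. g i) x"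
proof
  fix i
  obtain m where [simp]: "n = Suc m" using assms by (cases n) auto
  show "(\<lambda>i\<in>{..<n}. prism n j g x i) i = prism (n - 1) j (\<lambda>i\<in>{..<n - 1}. g i) x i"
    using assms loop_init[of i m g x] vertex_init[of j m g x] by (auto simp: prism_def)
qed

lemma prism_face_low:
  assumes g: "g \<in> tuples G n" and ij: "Suc i < j" "j \<le> n"
  shows "face G n i (prism n j g x) = prism (n - 1) (j - 1) (face G (n - 1) i g) x"
proof
  fix k
  obtain m j' where [simp]: "n = Suc m" "j = Suc j'" using ij by (cases n; cases j) auto
  note g' = g[simplified \<open>n = Suc m\<close>]
  show "face G n i (prism n j g x) k = prism (n - 1) (j - 1) (face G (n - 1) i g) x k"
  proof (cases "k < n")
    case True
    have 1: "vertex (face G m i g) x j' = vertex g x (Suc j')"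
      using vertex_face[OF g', of i j' x] ij by simp
    show ?thesis
    proof (cases k j' rule: linorder_cases)
      case less
      then show ?thesis
        using True ij loop_face[OF g', of i k x] by (auto simp: prism_def face_def)
    next
      case equal
      then show ?thesis
        using True ij 1 by (simp add: prism_def) (simp add: face_def prism_def)
    next
      case greater
      then show ?thesis
        using True ij by (auto simp: prism_def face_def)
    qed
  qed (simp add: face_def prism_def)
qed

lemma prism_face_high:
  assumes g: "g \<in> tuples G n" and ij: "j < i" "i < n"
  shows "face G n i (prism n j g x) = prism (n - 1) j (face G (n - 1) (i - 1) g) x"
proof
  fix k
  obtain m i' where [simp]: "n = Suc m" "i = Suc i'" using ij by (cases n; cases i) auto
  note g' = g[simplified \<open>n = Suc m\<close>]
  show "face G n i (prism n j g x) k = prism (n - 1) j (face G (n - 1) (i - 1) g) x k"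
  proof (cases "k < n")
    case True
    have 1: "vertex (face G m i' g) x j = vertex g x j"
      using vertex_face[OF g', of i' j x] ij by simp
    show ?thesis
    proof (cases k j rule: linorder_cases)
      case less
      then show ?thesis
        using True ij loop_face[OF g', of i' k x] by (auto simp: prism_def face_def)
    next
      case equal
      then show ?thesis
        using True ij 1 by (simp add: prism_def) (simp add: face_def prism_def)
    next
      case greater
      then show ?thesis
        using True ij by (auto simp: prism_def face_def)
    qed
  qed (simp add: face_def prism_def)
qed

lemma prism_face_diagonal:
  assumes g: "g \<in> tuples G n" and j: "j < n"
  shows "face G n j (prism n j g x) = face G n j (prism n (Suc j) g x)"
proof
  fix k
  show "face G n j (prism n j g x) k = face G n j (prism n (Suc j) g x) k"
    using j loop_cancel[of g j x] tuple_in[OF g j] by (auto simp: face_def prism_def)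
qed

text \<open>
  The homotopy formula. The double sum is the coboundary of \<open>homotopy (n - 1) f\<close> if \<open>n > 0\<close>, and empty
  if \<open>n = 0\<close>.
\<close>

lemma prism_sum:
  assumes g: "g \<in> tuples G n"
  shows "(\<Sum>i\<le>n. \<Sum>j<n. alt (i + j) (coface G perm (n - 1) i (\<lambda>g x. f (prism (n - 1) j g x) 0) g x))
      + homotopy n (codiff G perm n f) g x = f g x - f (loops n g x) 0"
proof -
  define A where "A i j = coface G perm n i f (prism n j g x) 0" for i j
  define B where "B i j = coface G perm (n - 1) i (\<lambda>g x. f (prism (n - 1) j g x) 0) g x" for i j
  have "(\<Sum>i\<le>n. \<Sum>j<n. alt (i + j) (B i j)) + (\<Sum>j\<le>n. \<Sum>i\<le>Suc n. alt (j + i) (A i j))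
      = A 0 0 - A (Suc n) n"
  proof (rule alternating_prism_sum)
    fix i j assume ij: "i < j" "j \<le> n"
    show "A i j = B i (j - 1)"
    proof (cases "i = 0")
      case True
      have "\<theta> (prism n j g x 0) = 0"
        using ij True loop_in_ker[of g 0 x] tuple_in[OF g, of 0] by (simp add: prism_def ker_def)
      with True ij show ?thesis
        unfolding A_def B_def coface_def by (simp add: perm_def prism_tail)
    next
      case False
      moreover have "i \<le> n - Suc 0" using ij by linarith
      ultimately show ?thesis
        unfolding A_def B_def coface_def using ij prism_face_low[OF g, of "i - 1" j x] by simp
    qed
  next
    fix i j assume ij: "Suc j < i" "i \<le> Suc n"
    show "A i j = B (i - 1) j"
    proof (cases "i \<le> n")
      case True
      with ij show ?thesis
        unfolding A_def B_def coface_def using prism_face_high[OF g, of j "i - 1" x] by auto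
    next
      case False
      with ij have "i = Suc n" "j < n" by auto
      then show ?thesis
        unfolding A_def B_def coface_def using prism_init[of j n g x] by auto
    qed
  next
    fix j assume "j < n"
    then show "A (Suc j) j = A (Suc j) (Suc j)"
      unfolding A_def coface_def using prism_face_diagonal[OF g, of j x] by simp
  qed
  moreover have "A 0 0 = f g x"
    unfolding A_def coface_def using prism_tail_0[OF g, of x]
    by (simp add: perm_def prism_def \<theta>_inv \<sigma>_in \<theta>_\<sigma>)
  moreover have "A (Suc n) n = f (loops n g x) 0"
    unfolding A_def coface_def using prism_init_last[of n g x] by simp
  moreover have "(\<Sum>j\<le>n. \<Sum>i\<le>Suc n. alt (j + i) (A i j)) = homotopy n (codiff G perm n f) g x"
    unfolding homotopy_def lessThan_Suc_atMost codiff_def sum_fun_apply alt_fun_apply alt_sum alt_alt A_def ..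
  ultimately show ?thesis unfolding B_def by simp
qed

lemma homotopy_Suc:
  assumes g: "g \<in> tuples G (Suc m)"
  shows "codiff G perm m (homotopy m f) g x + homotopy (Suc m) (codiff G perm (Suc m) f) g x
    = f g x - f (loops (Suc m) g x) 0"
proof -
  have "coface G perm m i (homotopy m f) g x
     = (\<Sum>j<Suc m. alt j (coface G perm m i (\<lambda>g x. f (prism m j g x) 0) g x))" for i
    unfolding coface_def homotopy_def perm_def by simp
  then have "codiff G perm m (homotopy m f) g x =
      (\<Sum>i\<le>Suc m. \<Sum>j<Suc m. alt (i + j) (coface G perm m i (\<lambda>g x. f (prism m j g x) 0) g x))"
    unfolding codiff_def sum_fun_apply alt_fun_apply by (simp only: alt_sum alt_alt)
  then show ?thesis
    using prism_sum[OF g, of f x] by (simp only: diff_Suc_1)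
qed

lemma homotopy_0:
  assumes g: "g \<in> tuples G 0"
  shows "homotopy 0 (codiff G perm 0 f) g x = f g x - f (loops 0 g x) 0"
  using prism_sum[OF g, of f x] by simp

lemma loc_const_vertex: "i \<le> n \<Longrightarrow> loc_const (power_topology T n) (\<lambda>g. vertex g x i)"
proof -
  assume "i \<le> n"
  then have "loc_const (power_topology T n) (\<lambda>g. \<Sum>l<i. \<theta> (g l))"
    by (intro loc_const_sum loc_const_compose[OF continuous_proj \<theta>_loc_const]) auto
  then show ?thesis
    unfolding vertex_def by (rule loc_const_map)
qed

lemma continuous_\<sigma>_vertex: "i \<le> n \<Longrightarrow> continuous_map (power_topology T n) T (\<lambda>g. \<sigma> (vertex g x i))"
  by (rule continuous_map_loc_const[OF loc_const_map[OF loc_const_vertex]]) (simp_all add: \<sigma>_in)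

lemma continuous_loop: "i < n \<Longrightarrow> continuous_map (power_topology T n) T (\<lambda>g. loop g x i)"
  unfolding loop_def by (intro continuous_mult continuous_inv continuous_\<sigma>_vertex continuous_proj) auto

lemma continuous_loops: "continuous_map (power_topology T n) (power_topology TK n) (\<lambda>g. loops n g x)"
  unfolding loops_def
proof (rule K.continuous_tuple)
  fix i assume i: "i < n"
  have "(\<lambda>g. loop g x i) \<in> tuples G n \<rightarrow> ker"
    using i tuple_in by (auto intro!: loop_in_ker)
  then show "continuous_map (power_topology T n) TK (\<lambda>g. loop g x i)"
    unfolding TK_def continuous_map_in_subtopology using continuous_loop[OF i] by simp
qed

lemma continuous_prism:
  assumes "j \<le> n" shows "continuous_map (power_topology T n) (power_topology T (Suc n)) (\<lambda>g. prism n j g x)"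
  unfolding prism_def
proof (rule continuous_tuple)
  fix i assume i: "i < Suc n"
  consider "i < j" | "i = j" | "j < i" by linarith
  then show "continuous_map (power_topology T n) T
     (\<lambda>g. if i < j then loop g x i else if i = j then inv\<^bsub>G\<^esub> \<sigma> (vertex g x j) else g (i - 1))"
  proof cases
    case 1
    then show ?thesis using continuous_loop[of i n x] assms by simp
  next
    case 2
    then show ?thesis using continuous_inv[OF continuous_\<sigma>_vertex[of j n x]] assms by simp
  next
    case 3
    then show ?thesis using continuous_proj[of "i - 1" n] i by simp
  qed
qed

lemma loc_const_loops: "loc_const (power_topology TK n) F \<Longrightarrow> loc_const (power_topology T n) (\<lambda>g x. F (loops n g x))"
  by (rule loc_const_fun) (rule loc_const_compose[OF continuous_loops])

lemma loc_const_homotopy: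
  assumes "loc_const (power_topology T (Suc n)) f" shows "loc_const (power_topology T n) (homotopy n f)"
proof (rule loc_const_fun)
  fix x
  have "loc_const (power_topology T n) (\<lambda>g. alt j (f (prism n j g x) 0))" if "j < Suc n" for j
    using loc_const_map[OF loc_const_compose[OF continuous_prism assms], of j "\<lambda>v. alt j (v 0)" x] that by simp
  then show "loc_const (power_topology T n) (\<lambda>g. homotopy n f g x)"
    unfolding homotopy_def by (intro loc_const_sum) auto
qed

lemma loc_const_restrict_base:
  assumes "loc_const (power_topology T n) f" shows "loc_const (power_topology TK n) (\<lambda>k. f k 0)"
proof -
  have "continuous_map (power_topology TK n) (power_topology T n) (\<lambda>k. \<lambda>i\<in>{..<n}. k i)"
  proof (rule continuous_tuple)
    fix i assume "i < n"
    then show "continuous_map (power_topology TK n) T (\<lambda>k. k i)"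
      using K.continuous_proj unfolding TK_def continuous_map_in_subtopology by blast
  qed
  then have "loc_const (power_topology TK n) (\<lambda>k. f (\<lambda>i\<in>{..<n}. k i) 0)"
    using loc_const_map[OF loc_const_compose[OF _ assms], of _ _ "\<lambda>v. v 0"] by blast
  then show ?thesis
    by (rule loc_const_cong) (auto simp: PiE_restrict)
qed

lemma tuples_GK: "k \<in> tuples GK n \<Longrightarrow> k \<in> tuples G n"
  using ker_G by (auto simp: PiE_iff GK_def)

text \<open>
  Let \<open>y\<close> be the correcting cochain for the restriction of \<open>f\<close> to the kernel, and \<open>\<delta> f = 3 f1\<close>. The
  correcting cochain for \<open>f\<close> is the pullback of \<open>y\<close> along the retraction minus the homotopy
  applied to \<open>f1\<close>.
\<close>

theorem bockstein_vanishes_perm: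
  assumes bv: "bockstein_vanishes GK TK (trivial_act :: 'a \<Rightarrow> int \<Rightarrow> int) UNIV n"
  shows "bockstein_vanishes G T perm UNIV n"
  unfolding bockstein_vanishes_def
proof (intro allI impI, elim conjE)
  interpret KM: cochain_module GK TK "trivial_act :: 'a \<Rightarrow> int \<Rightarrow> int" by (rule trivial_K)
  fix f assume f: "loc_const (power_topology T n) f" "\<forall>g\<in>tuples G (Suc n). codiff G perm n f g \<in> range triple"
  define f1 where "f1 g = (\<lambda>x. codiff G perm n f g x div 3)" for g
  have f1: "codiff G perm n f g x = f1 g x + f1 g x + f1 g x" if g: "g \<in> tuples G (Suc n)" for g x
  proof -
    obtain s where "codiff G perm n f g = triple s" using f(2) g by blast
    then have "codiff G perm n f g x = 3 * s x" by (simp add: triple_def)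
    then show ?thesis by (simp add: f1_def)
  qed
  have lf1: "loc_const (power_topology T (Suc n)) f1"
    unfolding f1_def[abs_def] using loc_const_map[OF loc_const_codiff[OF f(1)], of "\<lambda>v x. v x div 3"] .
  have "codiff GK trivial_act n (\<lambda>k. f k 0) k \<in> range triple" if "k \<in> tuples GK (Suc n)" for k
    unfolding codiff_restrict_base[OF that] f1[OF tuples_GK[OF that]] by (simp add: triple_def)
  then obtain y where y: "loc_const (power_topology TK n) y"
    "\<And>k. k \<in> tuples GK (Suc n) \<Longrightarrow>
        codiff GK trivial_act n (\<lambda>k. f k 0) k + triple (codiff GK trivial_act n y k) \<in> triple ` range triple"
    using bv loc_const_restrict_base[OF f(1)] unfolding bockstein_vanishes_def by auto
  define z where "z = (\<lambda>g. (\<lambda>x. y (loops n g x)) - homotopy n f1 g)"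
  have "loc_const (power_topology T n) z"
    unfolding z_def by (rule loc_const_map2[OF loc_const_loops[OF y(1)] loc_const_homotopy[OF lf1]])
  moreover have "codiff G perm n f g + triple (codiff G perm n z g) \<in> triple ` range triple"
    if g: "g \<in> tuples G (Suc n)" for g
  proof -
    define \<Psi> where "\<Psi> = (\<lambda>g x. f (loops n g x) (0::'q))"
    define h where "h = homotopy n f1"
    have hom: "homotopy n (codiff G perm n f) g x = h g x + h g x + h g x" if "g \<in> tuples G n" for g x
      unfolding h_def homotopy_def sum.distrib[symmetric]
      by (rule sum.cong) (use f1 prism_in[OF that] in \<open>auto simp: alt_def\<close>)
    \<comment> \<open>\<open>D\<close> is the coboundary of the homotopy applied to \<open>f\<close>, or \<open>0\<close> in degree 0.\<close>
    obtain D where D: "\<And>g. g \<in> tuples G n \<Longrightarrow> f g = D g + \<Psi> g + (h g + h g + h g)"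
      and dD: "codiff G perm n D g = 0"
    proof (cases n)
      case 0
      have "f g = 0 + \<Psi> g + (h g + h g + h g)" if "g \<in> tuples G n" for g
      proof
        fix x show "f g x = (0 + \<Psi> g + (h g + h g + h g)) x"
          using homotopy_0[of g f x] hom[OF that, of x] that 0 by (simp add: \<Psi>_def)
      qed
      moreover have "codiff G perm n (\<lambda>g. 0) g = 0"
        using codiff_add[OF g, of "\<lambda>g. 0" "\<lambda>g. 0"] by simp
      ultimately show ?thesis using that[of "\<lambda>g. 0"] by blast
    next
      case (Suc m)
      have "f g = codiff G perm m (homotopy m f) g + \<Psi> g + (h g + h g + h g)" if "g \<in> tuples G n" for g
      proof
        fix x show "f g x = (codiff G perm m (homotopy m f) g + \<Psi> g + (h g + h g + h g)) x"
          using homotopy_Suc[of g m f x] hom[OF that, of x] that Suc by (simp add: \<Psi>_def)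
      qed
      moreover have "codiff G perm n (codiff G perm m (homotopy m f)) g = 0"
        using g unfolding Suc by (rule codiff_codiff)
      ultimately show ?thesis using that by blast
    qed
    have "codiff G perm n f g = codiff G perm n (\<lambda>g. D g + \<Psi> g + (h g + h g + h g)) g"
      by (rule codiff_cong[OF g]) (rule D)
    then have 1: "codiff G perm n f g = codiff G perm n \<Psi> g + triple (codiff G perm n h g)"
      by (simp only: codiff_add[OF g] dD triple_def add_0_left)
    have 2: "codiff G perm n z g = codiff G perm n (\<lambda>g x. y (loops n g x)) g - codiff G perm n h g"
      unfolding z_def h_def by (rule codiff_diff[OF g])
    have 3: "codiff G perm n f g + triple (codiff G perm n z g)
        = codiff G perm n \<Psi> g + triple (codiff G perm n (\<lambda>g x. y (loops n g x)) g)"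
      unfolding 1 2 triple_def by (simp add: algebra_simps)
    have "\<forall>x. \<exists>s. codiff G perm n \<Psi> g x + triple (codiff G perm n (\<lambda>g x. y (loops n g x)) g x) = triple (triple s)"
    proof
      fix x
      have "codiff G perm n \<Psi> g x + triple (codiff G perm n (\<lambda>g x. y (loops n g x)) g x)
         = codiff GK trivial_act n (\<lambda>k. f k 0) (loops (Suc n) g x) + triple (codiff GK trivial_act n y (loops (Suc n) g x))"
        using codiff_loops[OF g, of "\<lambda>k. f k 0" x] codiff_loops[OF g, of y x] by (simp add: \<Psi>_def)
      then show "\<exists>s. codiff G perm n \<Psi> g x + triple (codiff G perm n (\<lambda>g x. y (loops n g x)) g x) = triple (triple s)"
        using y(2)[OF loops_in[OF g, of x]] by auto
    qed
    then obtain s where "\<And>x. codiff G perm n \<Psi> g x + triple (codiff G perm n (\<lambda>g x. y (loops n g x)) g x) = triple (triple (s x))"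
      by metis
    then have "codiff G perm n f g + triple (codiff G perm n z g) = triple (triple s)"
      unfolding 3 by (simp add: fun_eq_iff triple_def)
    then show ?thesis by blast
  qed
  ultimately show "\<exists>z. loc_const (power_topology T n) z \<and> (\<forall>g\<in>tuples G n. z g \<in> UNIV) \<and>
        (\<forall>g\<in>tuples G (Suc n). codiff G perm n f g + triple (codiff G perm n z g) \<in> triple ` range triple)"
    by blast
qed

end

section \<open>Tensor products with cyclic groups\<close>

text \<open>
  The element \<open>m \<otimes> 1\<close> of \<open>M \<otimes> \<int>/k\<close>. The lemmas below show that \<open>m \<mapsto> m \<otimes> 1\<close> is a surjective
  homomorphism whose kernel consists of the \<open>k\<close>-th powers.
\<close>

definition tensor1 :: "('m, 'x) monoid_scheme \<Rightarrow> nat \<Rightarrow> 'm \<Rightarrow> ('m \<times> int \<Rightarrow>\<^sub>0 int) set" where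
  "tensor1 M k m = r_coset (free_Abelian_group (carrier M \<times> carrier (Zmod k)))
     (tensor_relations M (Zmod k)) (frag_of (m, 1))"

locale tensor_with_Zmod = comm_group M for M :: "('m, 'x) monoid_scheme" (structure) +
  fixes k :: nat
  assumes k: "k > 1"
begin

abbreviation "FA \<equiv> free_Abelian_group (carrier M \<times> carrier (Zmod k))"
abbreviation "Rel \<equiv> tensor_relations M (Zmod k)"

definition gens :: "('m \<times> int \<Rightarrow>\<^sub>0 int) set" where
  "gens = {frag_of (a \<otimes>\<^bsub>M\<^esub> a', b) - frag_of (a, b) - frag_of (a', b) | a a' b.
           a \<in> carrier M \<and> a' \<in> carrier M \<and> b \<in> carrier (Zmod k)} \<union>
        {frag_of (a, b \<otimes>\<^bsub>Zmod k\<^esub> b') - frag_of (a, b) - frag_of (a, b') | a b b'.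
           a \<in> carrier M \<and> b \<in> carrier (Zmod k) \<and> b' \<in> carrier (Zmod k)}"

lemma Rel_generate: "Rel = generate FA gens"
  unfolding tensor_relations_def gens_def ..

sublocale FA: comm_group FA
  by (rule abelian_free_Abelian_group)

lemma FA_diff: "x \<in> carrier FA \<Longrightarrow> y \<in> carrier FA \<Longrightarrow> x - y \<in> carrier FA"
  using keys_diff[of x y] by auto

lemma carrier_Zmod: "b \<in> carrier (Zmod k) \<longleftrightarrow> 0 \<le> b \<and> b < int k"
  using k by (auto simp: carrier_integer_mod_group)

lemma Zmod_m_closed: "b \<in> carrier (Zmod k) \<Longrightarrow> b' \<in> carrier (Zmod k) \<Longrightarrow> (b + b') mod int k \<in> carrier (Zmod k)"
  using k by (simp add: carrier_Zmod)

lemma frag_of_FA: "m \<in> carrier M \<Longrightarrow> b \<in> carrier (Zmod k) \<Longrightarrow> frag_of (m, b) \<in> carrier FA"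
  by (simp add: keys_frag_of)

lemma gens_FA: "gens \<subseteq> carrier FA"
  unfolding gens_def
  by (auto simp del: carrier_free_Abelian_group_iff intro!: FA_diff frag_of_FA Zmod_m_closed)

lemma subgroup_Rel: "subgroup Rel FA"
  unfolding Rel_generate by (rule FA.generate_is_subgroup[OF gens_FA])

lemma Rel_FA: "x \<in> Rel \<Longrightarrow> x \<in> carrier FA"
  using subgroup.subset[OF subgroup_Rel] by blast

lemma Rel_0: "0 \<in> Rel"
  using subgroup.one_closed[OF subgroup_Rel] by simp

lemma Rel_add: "x \<in> Rel \<Longrightarrow> y \<in> Rel \<Longrightarrow> x + y \<in> Rel"
  using subgroup.m_closed[OF subgroup_Rel] by simp

lemma Rel_minus: "x \<in> Rel \<Longrightarrow> - x \<in> Rel"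
  using subgroup.m_inv_closed[OF subgroup_Rel, of x] Rel_FA[of x] by simp

lemma Rel_diff: "x \<in> Rel \<Longrightarrow> y \<in> Rel \<Longrightarrow> x - y \<in> Rel"
  using Rel_add[of x "- y"] Rel_minus[of y] by simp

abbreviation eqv :: "('m \<times> int \<Rightarrow>\<^sub>0 int) \<Rightarrow> ('m \<times> int \<Rightarrow>\<^sub>0 int) \<Rightarrow> bool" (infix "\<sim>" 50) where
  "x \<sim> y \<equiv> x - y \<in> Rel"

lemma eqv_trans: "x \<sim> y \<Longrightarrow> y \<sim> z \<Longrightarrow> x \<sim> z"
  using Rel_add[of "x - y" "y - z"] by simp

lemma eqv_sym: "x \<sim> y \<Longrightarrow> y \<sim> x"
  using Rel_minus[of "x - y"] by simp

lemma eqv_add: "x \<sim> y \<Longrightarrow> x' \<sim> y' \<Longrightarrow> x + x' \<sim> y + y'"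
  using Rel_add[of "x - y" "x' - y'"] by (simp add: algebra_simps)

lemma eqv_diff: "x \<sim> y \<Longrightarrow> x' \<sim> y' \<Longrightarrow> x - x' \<sim> y - y'"
  using Rel_diff[of "x - y" "x' - y'"] by (simp add: algebra_simps)

lemma eqv_left:
  assumes "a \<in> carrier M" "a' \<in> carrier M" "b \<in> carrier (Zmod k)"
  shows "frag_of (a \<otimes> a', b) \<sim> frag_of (a, b) + frag_of (a', b)"
proof -
  have "frag_of (a \<otimes> a', b) - frag_of (a, b) - frag_of (a', b) \<in> gens"
    unfolding gens_def using assms by blast
  then have "frag_of (a \<otimes> a', b) - frag_of (a, b) - frag_of (a', b) \<in> Rel"
    unfolding Rel_generate by (rule generate.incl)
  then show ?thesis by (simp add: algebra_simps)
qed

lemma eqv_right: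
  assumes "a \<in> carrier M" "b \<in> carrier (Zmod k)" "b' \<in> carrier (Zmod k)"
  shows "frag_of (a, (b + b') mod int k) \<sim> frag_of (a, b) + frag_of (a, b')"
proof -
  have "frag_of (a, b \<otimes>\<^bsub>Zmod k\<^esub> b') - frag_of (a, b) - frag_of (a, b') \<in> gens"
    unfolding gens_def using assms by blast
  then have "frag_of (a, b \<otimes>\<^bsub>Zmod k\<^esub> b') - frag_of (a, b) - frag_of (a, b') \<in> Rel"
    unfolding Rel_generate by (rule generate.incl)
  then show ?thesis by (simp add: algebra_simps)
qed

lemma one_Zmod: "1 \<in> carrier (Zmod k)"
  using k by (simp add: carrier_Zmod)

lemma eqv_pow: "m \<in> carrier M \<Longrightarrow> frag_of (m [^] (i::nat), 1) \<sim> frag_cmul (int i) (frag_of (m, 1))"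
proof (induction i)
  case 0
  have "frag_of (\<one>, 1) \<sim> frag_of (\<one>, 1) + frag_of (\<one>, 1)"
    using eqv_left[of \<one> \<one> 1] one_Zmod by simp
  then show ?case using Rel_minus by fastforce
next
  case (Suc i)
  have "frag_of (m [^] Suc i, 1) \<sim> frag_of (m [^] i, 1) + frag_of (m, 1)"
    using eqv_left[of "m [^] i" m 1] Suc.prems one_Zmod by simp
  moreover have "frag_of (m [^] i, 1) + frag_of (m, 1) \<sim> frag_cmul (int i) (frag_of (m, 1)) + frag_of (m, 1)"
    using eqv_add[OF Suc.IH[OF Suc.prems], of "frag_of (m, 1)" "frag_of (m, 1)"] Rel_0 by simp
  ultimately show ?case
    using eqv_trans by (simp add: frag_cmul_distrib add.commute)
qed

lemma eqv_scalar: "m \<in> carrier M \<Longrightarrow> i < k \<Longrightarrow> frag_of (m, int i) \<sim> frag_cmul (int i) (frag_of (m, 1))"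
proof (induction i)
  case 0
  have "frag_of (m, 0) \<sim> frag_of (m, 0) + frag_of (m, 0)"
    using eqv_right[of m 0 0] 0 by simp
  then show ?case using Rel_minus by fastforce
next
  case (Suc i)
  have "frag_of (m, int (Suc i)) \<sim> frag_of (m, int i) + frag_of (m, 1)"
    using eqv_right[of m "int i" 1] Suc.prems one_Zmod by (simp add: carrier_Zmod add.commute)
  moreover have "frag_of (m, int i) + frag_of (m, 1) \<sim> frag_cmul (int i) (frag_of (m, 1)) + frag_of (m, 1)"
    using eqv_add[OF Suc.IH, of "frag_of (m, 1)" "frag_of (m, 1)"] Suc.prems Rel_0 by simp
  ultimately show ?case
    using eqv_trans by (simp add: frag_cmul_distrib add.commute)
qed

lemma eqv_scalar_pow: "m \<in> carrier M \<Longrightarrow> i < k \<Longrightarrow> frag_of (m, int i) \<sim> frag_of (m [^] i, 1)"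
  using eqv_trans[OF eqv_scalar eqv_sym[OF eqv_pow]] by blast

text \<open>
  Multiplicatively, \<open>m ^ k \<otimes> 1 = m \<otimes> ((k - 1) + 1) = m \<otimes> 0\<close>.
\<close>

lemma eqv_k: "m \<in> carrier M \<Longrightarrow> frag_of (m [^] k, 1) \<sim> 0"
proof -
  assume m: "m \<in> carrier M"
  have "frag_of (m, (int (k - 1) + 1) mod int k) \<sim> frag_of (m, int (k - 1)) + frag_of (m, 1)"
    using m k one_Zmod by (intro eqv_right) (auto simp: carrier_Zmod)
  then have 1: "frag_of (m, 0) \<sim> frag_of (m, int (k - 1)) + frag_of (m, 1)"
    using k by (simp add: of_nat_diff)
  have "frag_of (m, int (k - 1)) + frag_of (m, 1) \<sim> frag_cmul (int (k - 1)) (frag_of (m, 1)) + frag_of (m, 1)"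
    using eqv_add[OF eqv_scalar[OF m, of "k - 1"], of "frag_of (m, 1)" "frag_of (m, 1)"] k Rel_0 by simp
  also have "frag_cmul (int (k - 1)) (frag_of (m, 1)) + frag_of (m, 1) = frag_cmul (int k) (frag_of (m, 1))"
    using k by (simp add: of_nat_diff frag_cmul_diff_distrib)
  finally have 2: "frag_of (m, 0) \<sim> frag_cmul (int k) (frag_of (m, 1))"
    using eqv_trans[OF 1] by blast
  have 3: "frag_of (m, 0) \<sim> 0"
    using eqv_scalar[OF m, of 0] k by simp
  show ?thesis
    using eqv_trans[OF eqv_pow[OF m, of k] eqv_trans[OF eqv_sym[OF 2] 3]] .
qed

abbreviation cs :: "('m \<times> int \<Rightarrow>\<^sub>0 int) \<Rightarrow> ('m \<times> int \<Rightarrow>\<^sub>0 int) set" where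
  "cs x \<equiv> r_coset FA Rel x"

lemma mem_cs: "y \<in> cs x \<longleftrightarrow> y \<sim> x"
proof -
  have "y \<in> cs x \<longleftrightarrow> (\<exists>h\<in>Rel. y = h + x)"
    by (auto simp: r_coset_def)
  also have "\<dots> \<longleftrightarrow> y - x \<in> Rel"
    by (metis add_diff_cancel_right' diff_add_cancel)
  finally show ?thesis .
qed

lemma cs_eq_iff: "cs x = cs y \<longleftrightarrow> x \<sim> y"
proof
  assume "cs x = cs y"
  then have "x \<in> cs y" using mem_cs[of x x] Rel_0 by simp
  then show "x \<sim> y" by (simp add: mem_cs)
next
  assume "x \<sim> y"
  then show "cs x = cs y"
    using eqv_trans eqv_sym mem_cs by blast
qed

lemma comm_group_tensor: "comm_group (tensor_product M (Zmod k))"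
  unfolding tensor_product_def by (rule FA.abelian_FactGroup[OF subgroup_Rel])

lemma normal_Rel: "Rel \<lhd> FA"
  using FA.normal_iff_subgroup subgroup_Rel by blast

lemma cs_add:
  assumes "x \<in> carrier FA" "y \<in> carrier FA"
  shows "cs (x + y) = cs x \<otimes>\<^bsub>tensor_product M (Zmod k)\<^esub> cs y"
  using normal.rcos_sum[OF normal_Rel assms] by (simp add: tensor_product_def FactGroup_def)

lemma tensor1_add:
  assumes "a \<in> carrier M" "a' \<in> carrier M"
  shows "tensor1 M k (a \<otimes> a') = tensor1 M k a \<otimes>\<^bsub>tensor_product M (Zmod k)\<^esub> tensor1 M k a'"
proof -
  have "cs (frag_of (a \<otimes> a', 1)) = cs (frag_of (a, 1) + frag_of (a', 1))"
    unfolding cs_eq_iff by (rule eqv_left[OF assms one_Zmod])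
  then show ?thesis
    unfolding tensor1_def using cs_add[OF frag_of_FA frag_of_FA] assms one_Zmod by simp
qed

lemma carrier_tensor: "carrier (tensor_product M (Zmod k)) = cs ` carrier FA"
  unfolding tensor_product_def FactGroup_def RCOSETS_def by auto

lemma eqv_surj: "x \<in> carrier FA \<Longrightarrow> \<exists>m\<in>carrier M. x \<sim> frag_of (m, 1)"
proof -
  assume "x \<in> carrier FA"
  then have "Poly_Mapping.keys x \<subseteq> carrier M \<times> carrier (Zmod k)" by simp
  then show ?thesis
  proof (induction x rule: frag_induction)
    case zero
    have "0 \<sim> frag_of (\<one>, 1)"
      using eqv_sym[OF eqv_pow[of \<one> 0]] by simp
    then show ?case by blast
  next
    case (one x)
    then obtain m b where x: "x = (m, b)" "m \<in> carrier M" "b \<in> carrier (Zmod k)" by blast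
    then have "frag_of (m, int (nat b)) \<sim> frag_of (m [^] nat b, 1)"
      by (intro eqv_scalar_pow) (auto simp: carrier_Zmod)
    then show ?case using x by (auto simp: carrier_Zmod intro!: bexI[of _ "m [^] nat b"])
  next
    case (diff a b)
    then obtain m m' where m: "m \<in> carrier M" "a \<sim> frag_of (m, 1)"
      and m': "m' \<in> carrier M" "b \<sim> frag_of (m', 1)" by blast
    have "frag_of ((m \<otimes> inv m') \<otimes> m', 1) \<sim> frag_of (m \<otimes> inv m', 1) + frag_of (m', 1)"
      using m m' one_Zmod by (intro eqv_left) auto
    then have "frag_of (m, 1) - frag_of (m', 1) \<sim> frag_of (m \<otimes> inv m', 1)"
      using m m' by (simp add: m_assoc algebra_simps)
    then have "a - b \<sim> frag_of (m \<otimes> inv m', 1)"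
      using eqv_trans eqv_diff[OF m(2) m'(2)] by blast
    then show ?case using m m' by auto
  qed
qed

lemma tensor1_image: "tensor1 M k ` carrier M = carrier (tensor_product M (Zmod k))"
proof
  show "tensor1 M k ` carrier M \<subseteq> carrier (tensor_product M (Zmod k))"
    unfolding carrier_tensor tensor1_def using frag_of_FA[OF _ one_Zmod] by blast
  show "carrier (tensor_product M (Zmod k)) \<subseteq> tensor1 M k ` carrier M"
  proof
    fix v assume "v \<in> carrier (tensor_product M (Zmod k))"
    then obtain x where x: "x \<in> carrier FA" "v = cs x" unfolding carrier_tensor by blast
    then obtain m where "m \<in> carrier M" "x \<sim> frag_of (m, 1)" using eqv_surj by blast
    then show "v \<in> tensor1 M k ` carrier M"
      unfolding tensor1_def using x cs_eq_iff by blast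
  qed
qed

text \<open>
  For the kernel, \<open>m \<otimes> b \<mapsto> m ^ b\<close> defines a homomorphism \<open>h\<close> from the free abelian group to \<open>M\<close>
  that maps the relations into the subgroup of \<open>k\<close>-th powers.
\<close>

lemma tensor1_eq_one_iff:
  assumes m: "m \<in> carrier M"
  shows "tensor1 M k m = \<one>\<^bsub>tensor_product M (Zmod k)\<^esub> \<longleftrightarrow> (\<exists>m'\<in>carrier M. m = m' [^] k)"
proof -
  have "\<one>\<^bsub>tensor_product M (Zmod k)\<^esub> = cs 0"
    using FA.coset_join2[OF FA.one_closed subgroup_Rel] Rel_0
    by (simp add: tensor_product_def FactGroup_def)
  then have "tensor1 M k m = \<one>\<^bsub>tensor_product M (Zmod k)\<^esub> \<longleftrightarrow> frag_of (m, 1) \<in> Rel"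
    unfolding tensor1_def by (simp add: cs_eq_iff)
  also have "\<dots> \<longleftrightarrow> (\<exists>m'\<in>carrier M. m = m' [^] k)"
  proof
    assume "\<exists>m'\<in>carrier M. m = m' [^] k"
    then show "frag_of (m, 1) \<in> Rel" using eqv_k by auto
  next
    assume mR: "frag_of (m, 1) \<in> Rel"
    define Q where "Q = {m' [^] k |m'. m' \<in> carrier M}"
    have Q1: "\<one> \<in> Q"
      unfolding Q_def using nat_pow_one by (metis (mono_tags, lifting) mem_Collect_eq one_closed)
    have Qm: "x \<otimes> y \<in> Q" if xy: "x \<in> Q" "y \<in> Q" for x y
    proof -
      obtain a b where ab: "x = a [^] k" "y = b [^] k" "a \<in> carrier M" "b \<in> carrier M"
        using xy unfolding Q_def by blast
      then have "x \<otimes> y = (a \<otimes> b) [^] k" by (simp add: nat_pow_distrib)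
      with ab show ?thesis unfolding Q_def by blast
    qed
    have Qi: "inv x \<in> Q" if x: "x \<in> Q" for x
    proof -
      obtain a where a: "x = a [^] k" "a \<in> carrier M"
        using x unfolding Q_def by blast
      then have "inv x = (inv a) [^] k" by (simp add: nat_pow_inv)
      with a show ?thesis unfolding Q_def by blast
    qed
    obtain h where h: "h \<in> hom FA M"
        "\<And>x. x \<in> carrier M \<times> carrier (Zmod k) \<Longrightarrow> h (frag_of x) = (case x of (a, b) \<Rightarrow> a [^] b)"
    proof (rule free_Abelian_group_universal)
      show "(\<lambda>x. case x of (a, b) \<Rightarrow> a [^] b) ` (carrier M \<times> carrier (Zmod k)) \<subseteq> carrier M"
        by auto
    qed blast
    interpret h: group_hom FA M h
      by unfold_locales (rule h(1))
    have hd: "h (x - y) = h x \<otimes> inv h y" if "x \<in> carrier FA" "y \<in> carrier FA" for x y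
    proof -
      have "h (x \<otimes>\<^bsub>FA\<^esub> inv\<^bsub>FA\<^esub> y) = h x \<otimes> inv h y"
        using that by (metis FA.inv_closed h.hom_mult h.hom_inv)
      then show ?thesis using that by simp
    qed
    have hf: "h (frag_of (a, b)) = a [^] b" if "a \<in> carrier M" "b \<in> carrier (Zmod k)" for a b
      using h(2)[of "(a, b)"] that by simp
    have gensQ: "h x \<in> Q" if "x \<in> gens" for x
    proof -
      consider a a' b where "x = frag_of (a \<otimes> a', b) - frag_of (a, b) - frag_of (a', b)"
          "a \<in> carrier M" "a' \<in> carrier M" "b \<in> carrier (Zmod k)"
        | a b b' where "x = frag_of (a, (b + b') mod int k) - frag_of (a, b) - frag_of (a, b')"
          "a \<in> carrier M" "b \<in> carrier (Zmod k)" "b' \<in> carrier (Zmod k)"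
        using \<open>x \<in> gens\<close> unfolding gens_def by auto
      then show ?thesis
      proof cases
        case 1
        have "h x = (a \<otimes> a') [^] b \<otimes> inv (a [^] b) \<otimes> inv (a' [^] b)"
          unfolding 1(1) using 1(2-) by (simp only: hd FA_diff frag_of_FA hf m_closed)
        also have "\<dots> = \<one>"
          using 1(2-) by (simp add: int_pow_distrib m_ac int_pow_closed)
        finally show ?thesis using Q1 by simp
      next
        case 2
        define q where "q = (b + b') div int k"
        have "h x = a [^] ((b + b') mod int k) \<otimes> inv (a [^] b) \<otimes> inv (a [^] b')"
          unfolding 2(1) using 2(2-) by (simp only: hd FA_diff frag_of_FA hf Zmod_m_closed)
        also have "\<dots> = a [^] ((b + b') mod int k - b - b')"
          using 2(2) by (simp add: int_pow_diff)
        also have "(b + b') mod int k - b - b' = (- q) * int k"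
          unfolding q_def by (simp add: minus_div_mult_eq_mod[symmetric] algebra_simps)
        also have "a [^] ((- q) * int k) = (a [^] (- q)) [^] k"
          using 2(2) by (metis int_pow_int int_pow_pow)
        finally show ?thesis using 2(2) unfolding Q_def by blast
      qed
    qed
    have "h x \<in> Q" if "x \<in> Rel" for x
      using that unfolding Rel_generate
    proof (induction x rule: generate.induct)
      case one
      show ?case using h.hom_one Q1 by simp
    next
      case (incl x)
      then show ?case by (rule gensQ)
    next
      case (inv x)
      then have "h (inv\<^bsub>FA\<^esub> x) = inv (h x)"
        using gens_FA by (intro h.hom_inv) blast
      then show ?case using Qi[OF gensQ[OF inv]] by (simp only:)
    next
      case (eng x y)
      then have "x \<in> carrier FA" "y \<in> carrier FA"
        using FA.generate_in_carrier[OF gens_FA] by blast+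
      then have "h (x \<otimes>\<^bsub>FA\<^esub> y) = h x \<otimes> h y"
        by (rule h.hom_mult)
      then show ?case using Qm[OF eng(3,4)] by (simp only:)
    qed
    from this[OF mR] have "m [^] (1::int) \<in> Q"
      using hf[OF m one_Zmod] by simp
    then show "\<exists>m'\<in>carrier M. m = m' [^] k"
      using m unfolding Q_def by (auto simp: int_pow_1)
  qed
  finally show ?thesis .
qed

end

lemma tensor_map_tensor1:
  assumes "comm_group M" "comm_group M'" "k > 1" "k' > 1"
    and \<phi>: "\<phi> \<in> hom M M'" and \<psi>: "\<psi> \<in> hom (Zmod k) (Zmod k')" and m: "m \<in> carrier M"
  shows "tensor_map M' (Zmod k') \<phi> \<psi> (tensor1 M k m) = tensor1 M' k' (\<phi> m [^]\<^bsub>M'\<^esub> nat (\<psi> 1))"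
proof -
  interpret A: tensor_with_Zmod M k
    using assms(1,3) by (simp add: tensor_with_Zmod_def tensor_with_Zmod_axioms_def)
  interpret B: tensor_with_Zmod M' k'
    using assms(2,4) by (simp add: tensor_with_Zmod_def tensor_with_Zmod_axioms_def)
  define E where "E = frag_extend (\<lambda>(c, d). frag_of (\<phi> c, \<psi> d))"
  have Ef: "E (frag_of (a, b)) = frag_of (\<phi> a, \<psi> b)" for a b
    by (simp add: E_def)
  have Ed: "E (x - y) = E x - E y" and Ea: "E (x + y) = E x + E y" for x y
    by (simp_all add: E_def frag_extend_diff frag_extend_add)
  have \<phi>c: "\<phi> a \<in> carrier M'" if "a \<in> carrier M" for a
    using \<phi> that by (simp add: hom_def Pi_iff)
  have \<psi>c: "\<psi> b \<in> carrier (Zmod k')" if "b \<in> carrier (Zmod k)" for b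
    using \<psi> that by (simp add: hom_def Pi_iff)
  have gens: "E x \<in> B.gens" if x: "x \<in> A.gens" for x
  proof -
    consider a a' b where "x = frag_of (a \<otimes>\<^bsub>M\<^esub> a', b) - frag_of (a, b) - frag_of (a', b)"
        "a \<in> carrier M" "a' \<in> carrier M" "b \<in> carrier (Zmod k)"
      | a b b' where "x = frag_of (a, b \<otimes>\<^bsub>Zmod k\<^esub> b') - frag_of (a, b) - frag_of (a, b')"
        "a \<in> carrier M" "b \<in> carrier (Zmod k)" "b' \<in> carrier (Zmod k)"
      using x unfolding A.gens_def by blast
    then show ?thesis
    proof cases
      case 1
      have "E x = frag_of (\<phi> a \<otimes>\<^bsub>M'\<^esub> \<phi> a', \<psi> b) - frag_of (\<phi> a, \<psi> b) - frag_of (\<phi> a', \<psi> b)"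
        unfolding 1(1) Ed Ef using \<phi> 1(2-) by (simp only: hom_mult)
      then show ?thesis
        unfolding B.gens_def using \<phi>c \<psi>c 1(2-) by blast
    next
      case 2
      have "E x = frag_of (\<phi> a, \<psi> b \<otimes>\<^bsub>Zmod k'\<^esub> \<psi> b') - frag_of (\<phi> a, \<psi> b) - frag_of (\<phi> a, \<psi> b')"
        unfolding 2(1) Ed Ef hom_mult[OF \<psi> 2(3,4)] ..
      then show ?thesis
        unfolding B.gens_def using \<phi>c \<psi>c 2(2-) by blast
    qed
  qed
  have Rel: "E x \<in> B.Rel" if "x \<in> A.Rel" for x
    using that unfolding A.Rel_generate
  proof (induction x rule: generate.induct)
    case one
    show ?case using B.Rel_0 by (simp add: E_def)
  next
    case (incl x)
    then show ?case using gens generate.incl unfolding B.Rel_generate by metis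
  next
    case (inv x)
    have "E (inv\<^bsub>A.FA\<^esub> x) = - E x"
      using A.gens_FA inv Ed[of 0 x] by (auto simp: E_def)
    moreover have "E x \<in> B.Rel"
      using gens[OF inv] generate.incl unfolding B.Rel_generate by metis
    ultimately show ?case using B.Rel_minus by simp
  next
    case (eng x y)
    then show ?case using B.Rel_add by (simp add: Ea)
  qed
  have "B.cs (E x) = B.cs (frag_of (\<phi> m, \<psi> 1))" if "x \<in> tensor1 M k m" for x
  proof -
    have "E x - E (frag_of (m, 1)) \<in> B.Rel"
      using that Rel[of "x - frag_of (m, 1)"] A.mem_cs by (simp add: Ed tensor1_def)
    then show ?thesis
      by (simp only: B.cs_eq_iff Ef)
  qed
  moreover have "frag_of (m, 1) \<in> tensor1 M k m"
    unfolding tensor1_def A.mem_cs using A.Rel_0 by simp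
  ultimately have "(\<lambda>x. B.cs (E x)) ` tensor1 M k m = {B.cs (frag_of (\<phi> m, \<psi> 1))}"
    by (auto simp: image_iff)
  then have "tensor_map M' (Zmod k') \<phi> \<psi> (tensor1 M k m) = B.cs (frag_of (\<phi> m, \<psi> 1))"
    unfolding tensor_map_def quotient_map_of_def E_def by simp
  also have "\<dots> = tensor1 M' k' (\<phi> m [^]\<^bsub>M'\<^esub> nat (\<psi> 1))"
    using B.eqv_scalar_pow[OF \<phi>c[OF m], of "nat (\<psi> 1)"] \<psi>c[OF A.one_Zmod]
    unfolding tensor1_def B.cs_eq_iff by (auto simp: B.carrier_Zmod)
  finally show ?thesis .
qed

section \<open>The group ring of $\mathbb{Z}/3 \oplus \mathbb{Z}/3$\<close>

abbreviation lookup :: "('g \<Rightarrow>\<^sub>0 'c::zero) \<Rightarrow> 'g \<Rightarrow> 'c" where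
  "lookup \<equiv> Poly_Mapping.lookup"

lemma lookup_times_finite:
  fixes f g :: "'g::{finite, ab_group_add} \<Rightarrow>\<^sub>0 int"
  shows "lookup (f * g) k = (\<Sum>l\<in>UNIV. lookup f l * lookup g (k - l))"
proof -
  have "Sum_any (\<lambda>q. lookup g q when k = l + q) = lookup g (k - l)" for l
  proof -
    have "Sum_any (\<lambda>q. lookup g q when k = l + q) = (\<Sum>q\<in>UNIV. lookup g q when k = l + q)"
      by (rule Sum_any.expand_superset) auto
    also have "\<dots> = (\<Sum>q\<in>UNIV. if q = k - l then lookup g q else 0)"
      by (rule sum.cong) (auto simp: when_def algebra_simps)
    also have "\<dots> = lookup g (k - l)"
      by simp
    finally show ?thesis .
  qed
  then have "lookup (f * g) k = Sum_any (\<lambda>l. lookup f l * lookup g (k - l))"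
    by (simp add: lookup_mult)
  also have "\<dots> = (\<Sum>l\<in>UNIV. lookup f l * lookup g (k - l))"
    by (rule Sum_any.expand_superset) auto
  finally show ?thesis .
qed

lemma lookup_single_times:
  fixes y :: "'g::{finite, ab_group_add} \<Rightarrow>\<^sub>0 int"
  shows "lookup (Poly_Mapping.single a c * y) x = c * lookup y (x - a)"
proof -
  have "lookup (Poly_Mapping.single a c * y) x = (\<Sum>l\<in>UNIV. if l = a then c * lookup y (x - l) else 0)"
    unfolding lookup_times_finite by (rule sum.cong) (auto simp: lookup_single when_def)
  then show ?thesis by simp
qed

lemma three_eq_0: "(3::3) = 0"
  by simp

lemma exhaust3: "(x::3) = 0 \<or> x = 1 \<or> x = 2"
  using exhaust_3[of x] by auto

lemma sum3: "(\<Sum>x\<in>(UNIV::3 set). f x) = f 0 + f 1 + f 2"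
  unfolding sum_3 three_eq_0 by (simp add: add_ac)

text \<open>
  The sum of the elements of the line \<open>{(k, e * k)}\<close>, and the group ring elements whose coefficients
  are constant on the cosets of this line; the coset of \<open>(a, b)\<close> is represented by \<open>(0, b - e * a)\<close>.
  The lines of slope 1 and 2 are generated by \<open>\<tau>\<^sub>3\<close> and \<open>\<tau>\<^sub>4\<close>.
\<close>

definition norm_elem :: "3 \<Rightarrow> zg" where
  "norm_elem e = (\<Sum>k\<in>UNIV. Poly_Mapping.single (k, e * k) 1)"

definition line_invariant :: "3 \<Rightarrow> zg set" where
  "line_invariant e = {y. \<forall>a b. lookup y (a, b) = lookup y (0, b - e * a)}"

lemma lookup_times_norm_elem: "lookup (\<xi> * norm_elem e) (a, b) = (\<Sum>k\<in>UNIV. lookup \<xi> (a - k, b - e * k))"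
  unfolding norm_elem_def sum_distrib_left lookup_sum
  by (rule sum.cong) (simp_all add: mult.commute[of \<xi>] lookup_single_times)

lemma line_invariant_eq: "line_invariant e = {\<xi> * norm_elem e |\<xi>. True}"
proof (intro equalityI subsetI)
  fix y assume "y \<in> {\<xi> * norm_elem e |\<xi>. True}"
  then obtain \<xi> where y: "y = \<xi> * norm_elem e" by blast
  have "lookup y (a, b) = lookup y (0, b - e * a)" for a b
    unfolding y lookup_times_norm_elem
    by (rule sum.reindex_bij_witness[of _ "\<lambda>k. k + a" "\<lambda>k. k - a"]) (auto simp: algebra_simps)
  then show "y \<in> line_invariant e" by (simp add: line_invariant_def)
next
  fix y assume y: "y \<in> line_invariant e"
  define \<xi> :: zg where "\<xi> = Abs_poly_mapping (\<lambda>(a, b). if a = 0 then lookup y (a, b) else 0)"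
  have "y = \<xi> * norm_elem e"
  proof (rule poly_mapping_eqI)
    fix x :: "3 \<times> 3"
    obtain a b where x: "x = (a, b)" by fastforce
    have "lookup (\<xi> * norm_elem e) x = (\<Sum>k\<in>UNIV. if k = a then lookup y (a - k, b - e * k) else 0)"
      unfolding x lookup_times_norm_elem by (rule sum.cong) (auto simp: \<xi>_def)
    also have "\<dots> = lookup y (0, b - e * a)" by simp
    finally show "lookup y x = lookup (\<xi> * norm_elem e) x"
      using y unfolding x line_invariant_def by simp
  qed
  then show "y \<in> {\<xi> * norm_elem e |\<xi>. True}" by blast
qed

lemma T\<^sub>3_eq: "T\<^sub>3 = norm_elem 1"
  by (simp add: T\<^sub>3_def norm_elem_def sum3 \<tau>\<^sub>3_def \<tau>\<^sub>1_def \<tau>\<^sub>2_def mult_single power2_eq_square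
      flip: single_one zero_prod_def)

lemma T\<^sub>4_eq: "T\<^sub>4 = norm_elem 2"
  by (simp add: T\<^sub>4_def norm_elem_def sum3 \<tau>\<^sub>4_def \<tau>\<^sub>1_def \<tau>\<^sub>2_def mult_single power2_eq_square
      flip: single_one zero_prod_def)

lemma lookup_T\<^sub>G: "lookup T\<^sub>G x = 1"
proof -
  have "lookup T\<^sub>G x = (\<Sum>g\<in>UNIV. if g = x then 1 else 0)"
    unfolding T\<^sub>G_def lookup_sum by (rule sum.cong) (auto simp: lookup_single when_def)
  then show ?thesis by simp
qed

lemma lookup_times_T\<^sub>G: "lookup (m * T\<^sub>G) x = (\<Sum>l\<in>UNIV. lookup m l)"
  by (simp add: lookup_times_finite lookup_T\<^sub>G)

lemma T\<^sub>G_multiple_iff: "(\<exists>m. y = m * T\<^sub>G) \<longleftrightarrow> (\<forall>x. lookup y x = lookup y 0)"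
proof
  assume y: "\<forall>x. lookup y x = lookup y 0"
  have "y = Poly_Mapping.single 0 (lookup y 0) * T\<^sub>G"
  proof (rule poly_mapping_eqI)
    fix k
    show "lookup y k = lookup (Poly_Mapping.single 0 (lookup y 0) * T\<^sub>G) k"
      unfolding lookup_single_times lookup_T\<^sub>G using y[rule_format, of k] by simp
  qed
  then show "\<exists>m. y = m * T\<^sub>G" by blast
qed (auto simp: lookup_times_T\<^sub>G)

lemma \<tau>\<^sub>1_cube: "\<tau>\<^sub>1 ^ 3 = 1" and \<tau>\<^sub>2_cube: "\<tau>\<^sub>2 ^ 3 = 1"
  by (simp_all add: \<tau>\<^sub>1_def \<tau>\<^sub>2_def power3_eq_cube mult_single three_eq_0 flip: single_one zero_prod_def)

lemma T\<^sub>G_absorb: "T\<^sub>G * Poly_Mapping.single g 1 = T\<^sub>G"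
  by (rule poly_mapping_eqI) (simp add: mult.commute[of T\<^sub>G] lookup_single_times lookup_T\<^sub>G)

lemma T\<^sub>G_t: "T\<^sub>G * t\<^sub>1 = 0" "T\<^sub>G * t\<^sub>2 = 0"
  by (simp_all add: t\<^sub>1_def t\<^sub>2_def \<tau>\<^sub>1_def \<tau>\<^sub>2_def right_diff_distrib T\<^sub>G_absorb)

lemma T\<^sub>G_norm_elem: "T\<^sub>G * norm_elem e = 3 * T\<^sub>G"
  by (simp add: norm_elem_def sum3 distrib_left T\<^sub>G_absorb)

lemma T\<^sub>G_T\<^sub>G: "T\<^sub>G * T\<^sub>G = 9 * T\<^sub>G"
proof -
  have "T\<^sub>G * T\<^sub>G = (\<Sum>g\<in>(UNIV :: (3 \<times> 3) set). T\<^sub>G)"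
    by (subst (2) T\<^sub>G_def) (simp only: sum_distrib_left T\<^sub>G_absorb)
  also have "\<dots> = 9 * T\<^sub>G" by simp
  finally show ?thesis .
qed

lemma T\<^sub>G_product: "T\<^sub>G = (1 + \<tau>\<^sub>1 + \<tau>\<^sub>1 ^ 2) * (1 + \<tau>\<^sub>2 + \<tau>\<^sub>2 ^ 2)"
proof -
  have "T\<^sub>G = (\<Sum>a\<in>UNIV. \<Sum>b\<in>UNIV. Poly_Mapping.single (a, b) 1)"
    unfolding T\<^sub>G_def by (simp only: UNIV_Times_UNIV[symmetric] sum.cartesian_product) simp
  also have "\<dots> = (1 + \<tau>\<^sub>1 + \<tau>\<^sub>1 ^ 2) * (1 + \<tau>\<^sub>2 + \<tau>\<^sub>2 ^ 2)"
    by (simp add: sum3 \<tau>\<^sub>1_def \<tau>\<^sub>2_def algebra_simps power2_eq_square mult_single flip: single_one zero_prod_def)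
  finally show ?thesis .
qed

lemma kappa_identity: "t\<^sub>1 * \<kappa>\<^sub>1 + t\<^sub>2 * \<kappa>\<^sub>2 + T\<^sub>3 + T\<^sub>4 = T\<^sub>G - 3"
proof -
  have 1: "\<tau>\<^sub>1 * (\<tau>\<^sub>1 * \<tau>\<^sub>1) = 1" "\<tau>\<^sub>2 * (\<tau>\<^sub>2 * \<tau>\<^sub>2) = 1"
    using \<tau>\<^sub>1_cube \<tau>\<^sub>2_cube by (simp_all add: power3_eq_cube mult.assoc)
  have 2: "\<tau>\<^sub>1 * (\<tau>\<^sub>1 * (\<tau>\<^sub>1 * x)) = x" "\<tau>\<^sub>2 * (\<tau>\<^sub>2 * (\<tau>\<^sub>2 * x)) = x" for x
    using arg_cong[OF 1(1), of "\<lambda>u. u * x"] arg_cong[OF 1(2), of "\<lambda>u. u * x"] by (simp_all add: mult.assoc)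
  show ?thesis
    unfolding t\<^sub>1_def t\<^sub>2_def \<kappa>\<^sub>1_def \<kappa>\<^sub>2_def T\<^sub>3_def T\<^sub>4_def \<tau>\<^sub>3_def \<tau>\<^sub>4_def T\<^sub>G_product
    by (simp add: power2_eq_square algebra_simps 1 2)
qed

lemma lookup_triple: "lookup (triple x) k = 3 * lookup x k" for x :: zg
  unfolding triple_def lookup_add by simp

section \<open>The modules $\mathcal{M}_3$ and $\mathcal{M}_4$\<close>

text \<open>
  The image of \<open>d\<^sub>2\<close>, so that \<open>M\<^sub>4\<close> is the quotient of \<open>M\<^sub>3\<close> by \<open>D\<close>.
\<close>

definition D :: "zg4 set" where "D = d\<^sub>2 ` M\<^sub>2"

text \<open>
  The map \<open>3 - d\<^sub>2 h\<^sub>2\<close> of \<open>M\<^sub>3\<close>, which induces \<open>h\<^sub>3\<close> on the quotient by \<open>D\<close>.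
\<close>

definition h3lift :: "zg4 \<Rightarrow> zg4" where "h3lift m = smult4 3 m - d\<^sub>2 (h\<^sub>2 m)"

lemma carrier_M\<^sub>3: "carrier M\<^sub>3 = UNIV \<times> UNIV \<times> line_invariant 1 \<times> line_invariant 2"
  unfolding line_invariant_eq T\<^sub>3_eq[symmetric] T\<^sub>4_eq[symmetric] by (auto simp: M\<^sub>3_def)

lemma M\<^sub>3_mult [simp]: "x \<otimes>\<^bsub>M\<^sub>3\<^esub> y = x + y" and M\<^sub>3_one [simp]: "\<one>\<^bsub>M\<^sub>3\<^esub> = 0"
  by (simp_all add: M\<^sub>3_def)

lemma line_invariant_closed:
  "0 \<in> line_invariant e" "x \<in> line_invariant e \<Longrightarrow> y \<in> line_invariant e \<Longrightarrow> x + y \<in> line_invariant e"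
  "x \<in> line_invariant e \<Longrightarrow> - x \<in> line_invariant e" "x \<in> line_invariant e \<Longrightarrow> u * x \<in> line_invariant e"
proof -
  show "x \<in> line_invariant e \<Longrightarrow> u * x \<in> line_invariant e"
    unfolding line_invariant_eq by (auto simp flip: mult.assoc)
qed (simp_all add: line_invariant_def lookup_add)

lemma M\<^sub>3_0: "0 \<in> carrier M\<^sub>3"
  by (simp add: carrier_M\<^sub>3 zero_prod_def line_invariant_closed)

lemma M\<^sub>3_add: "x \<in> carrier M\<^sub>3 \<Longrightarrow> y \<in> carrier M\<^sub>3 \<Longrightarrow> x + y \<in> carrier M\<^sub>3"
  by (auto simp: carrier_M\<^sub>3 line_invariant_closed)

lemma M\<^sub>3_minus: "x \<in> carrier M\<^sub>3 \<Longrightarrow> - x \<in> carrier M\<^sub>3"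
  by (auto simp: carrier_M\<^sub>3 line_invariant_closed)

lemma M\<^sub>3_smult: "x \<in> carrier M\<^sub>3 \<Longrightarrow> smult4 u x \<in> carrier M\<^sub>3"
  by (auto simp: carrier_M\<^sub>3 line_invariant_closed)

lemma comm_group_M\<^sub>3: "comm_group M\<^sub>3"
proof (rule comm_groupI)
  fix x assume "x \<in> carrier M\<^sub>3"
  then show "\<exists>y\<in>carrier M\<^sub>3. y \<otimes>\<^bsub>M\<^sub>3\<^esub> x = \<one>\<^bsub>M\<^sub>3\<^esub>"
    by (intro bexI[of _ "- x"]) (simp_all add: M\<^sub>3_minus)
qed (simp_all add: M\<^sub>3_0 M\<^sub>3_add add_ac)

lemma inv_M\<^sub>3: "x \<in> carrier M\<^sub>3 \<Longrightarrow> inv\<^bsub>M\<^sub>3\<^esub> x = - x"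
  by (rule group.inv_equality[OF comm_group.axioms(2)[OF comm_group_M\<^sub>3]]) (simp_all add: M\<^sub>3_minus)

lemma smult4_add: "smult4 u (x + y) = smult4 u x + smult4 u y"
  by (cases x; cases y) (simp add: distrib_left)

lemma smult4_smult4: "smult4 u (smult4 v x) = smult4 (u * v) x"
  by (cases x) (simp add: mult.assoc)

lemma d\<^sub>2_add: "d\<^sub>2 (x + y) = d\<^sub>2 x + d\<^sub>2 y"
  by (cases x; cases y) (simp add: algebra_simps)

lemma d\<^sub>2_smult: "d\<^sub>2 (u * fst x, u * snd x) = smult4 u (d\<^sub>2 x)"
  by (cases x) (simp add: algebra_simps)

lemma h\<^sub>2_add: "h\<^sub>2 (x + y) = h\<^sub>2 x + h\<^sub>2 y"
  by (cases x; cases y) (simp add: algebra_simps)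

lemma h\<^sub>2_smult: "h\<^sub>2 (smult4 u x) = (u * fst (h\<^sub>2 x), u * snd (h\<^sub>2 x))"
  by (cases x) (simp add: algebra_simps)

lemma h3lift_add: "h3lift (x + y) = h3lift x + h3lift y"
  by (simp add: h3lift_def smult4_add h\<^sub>2_add d\<^sub>2_add)

lemma h3lift_smult: "h3lift (smult4 u x) = smult4 u (h3lift x)"
proof -
  have "smult4 u (a - b) = smult4 u a - smult4 u b" for a b
    using smult4_add[of u "a - b" b] by (simp add: algebra_simps)
  then show ?thesis
    by (simp only: h3lift_def h\<^sub>2_smult d\<^sub>2_smult smult4_smult4 mult.commute)
qed

lemma M\<^sub>2_iff: "(\<xi>, y) \<in> M\<^sub>2 \<longleftrightarrow> (\<forall>x. lookup y x = lookup y 0)"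
  unfolding T\<^sub>G_multiple_iff[symmetric] by (auto simp: M\<^sub>2_def)

lemma D_add: "x \<in> D \<Longrightarrow> y \<in> D \<Longrightarrow> x + y \<in> D"
proof -
  have "p + q \<in> M\<^sub>2" if "p \<in> M\<^sub>2" "q \<in> M\<^sub>2" for p q
    using that by (cases p; cases q) (auto simp: M\<^sub>2_iff lookup_add)
  then show "x \<in> D \<Longrightarrow> y \<in> D \<Longrightarrow> x + y \<in> D"
    unfolding D_def by (metis (no_types, lifting) d\<^sub>2_add image_iff)
qed

lemma D_smult: "x \<in> D \<Longrightarrow> smult4 u x \<in> D"
proof -
  have "(u * fst p, u * snd p) \<in> M\<^sub>2" if "p \<in> M\<^sub>2" for p
    using that unfolding M\<^sub>2_def by (auto simp flip: mult.assoc)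
  then show "x \<in> D \<Longrightarrow> smult4 u x \<in> D"
    unfolding D_def by (metis (no_types, lifting) d\<^sub>2_smult image_iff)
qed

lemma D_0: "0 \<in> D"
proof -
  have "d\<^sub>2 (0, 0) = 0" by (simp add: zero_prod_def)
  moreover have "(0, 0) \<in> M\<^sub>2" by (simp add: M\<^sub>2_iff)
  ultimately show ?thesis unfolding D_def by force
qed

lemma D_minus: "x \<in> D \<Longrightarrow> - x \<in> D"
proof -
  have "smult4 (- 1) x = - x" by (cases x) simp
  then show "x \<in> D \<Longrightarrow> - x \<in> D" using D_smult[of x "- 1"] by simp
qed

lemma D_M\<^sub>3: "D \<subseteq> carrier M\<^sub>3"
proof
  fix x assume "x \<in> D"
  then obtain \<xi> y where x: "x = d\<^sub>2 (\<xi>, y)" and y: "\<forall>x. lookup y x = lookup y 0"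
    unfolding D_def using M\<^sub>2_iff by auto
  have "y \<in> line_invariant e" for e
  proof -
    have "lookup y (a, b) = lookup y (0, b - e * a)" for a b
      using y[rule_format, of "(a, b)"] y[rule_format, of "(0, b - e * a)"] by (rule trans[OF _ sym])
    then show ?thesis unfolding line_invariant_def by (intro CollectI allI)
  qed
  moreover have m: "\<xi> * norm_elem e \<in> line_invariant e" for e
    unfolding line_invariant_eq by blast
  ultimately show "x \<in> carrier M\<^sub>3"
    unfolding x d\<^sub>2.simps carrier_M\<^sub>3 T\<^sub>3_eq T\<^sub>4_eq using m by (simp add: line_invariant_closed)
qed

lemma subgroup_D: "subgroup D M\<^sub>3"
  by (rule subgroup.intro) (use D_M\<^sub>3 D_0 D_add D_minus inv_M\<^sub>3 in auto)

lemma h3lift_M\<^sub>3: "x \<in> carrier M\<^sub>3 \<Longrightarrow> h3lift x \<in> carrier M\<^sub>3"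
proof -
  assume x: "x \<in> carrier M\<^sub>3"
  have "h\<^sub>2 x \<in> M\<^sub>2" by (cases x) (auto simp: M\<^sub>2_def)
  then have "d\<^sub>2 (h\<^sub>2 x) \<in> carrier M\<^sub>3" using D_M\<^sub>3 unfolding D_def by blast
  then show ?thesis
    unfolding h3lift_def using M\<^sub>3_add[OF M\<^sub>3_smult[OF x, of 3] M\<^sub>3_minus] by fastforce
qed

text \<open>
  On \<open>D\<close> one has \<open>d\<^sub>2 h\<^sub>2 = 3\<close>: by the identity for \<open>\<kappa>\<^sub>1\<close> and \<open>\<kappa>\<^sub>2\<close>, the composite \<open>h\<^sub>2 d\<^sub>2\<close>
  is multiplication by 3 up to elements that \<open>d\<^sub>2\<close> annihilates.
\<close>

lemma h3lift_D: "x \<in> D \<Longrightarrow> h3lift x = 0"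
proof -
  assume "x \<in> D"
  then obtain \<xi> m where x: "x = d\<^sub>2 (\<xi>, m * T\<^sub>G)"
    unfolding D_def M\<^sub>2_def by auto
  define y where "y = m * T\<^sub>G"
  define z where "z = \<xi> * T\<^sub>G"
  have y: "y * t\<^sub>1 = 0" "y * t\<^sub>2 = 0" "y * T\<^sub>3 = 3 * y" "y * T\<^sub>4 = 3 * y" "y * T\<^sub>G = 9 * y"
    unfolding y_def mult.assoc T\<^sub>3_eq T\<^sub>4_eq T\<^sub>G_t T\<^sub>G_norm_elem T\<^sub>G_T\<^sub>G by simp_all
  have z: "z * t\<^sub>1 = 0" "z * t\<^sub>2 = 0" "z * T\<^sub>3 = 3 * z" "z * T\<^sub>4 = 3 * z"
    unfolding z_def mult.assoc T\<^sub>3_eq T\<^sub>4_eq T\<^sub>G_t T\<^sub>G_norm_elem by simp_all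
  have "- \<xi> * t\<^sub>1 * \<kappa>\<^sub>1 + - \<xi> * t\<^sub>2 * \<kappa>\<^sub>2 - (\<xi> * T\<^sub>3 + y) - (\<xi> * T\<^sub>4 + y)
      = - \<xi> * (t\<^sub>1 * \<kappa>\<^sub>1 + t\<^sub>2 * \<kappa>\<^sub>2 + T\<^sub>3 + T\<^sub>4) - 2 * y"
    by (simp add: algebra_simps)
  also have "\<dots> = 3 * \<xi> - z - 2 * y"
    unfolding kappa_identity z_def by (simp add: algebra_simps)
  finally have 1: "- \<xi> * t\<^sub>1 * \<kappa>\<^sub>1 + - \<xi> * t\<^sub>2 * \<kappa>\<^sub>2 - (\<xi> * T\<^sub>3 + y) - (\<xi> * T\<^sub>4 + y) = 3 * \<xi> - z - 2 * y" .
  have "\<xi> * T\<^sub>3 * T\<^sub>G = 3 * z"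
  proof -
    have "\<xi> * T\<^sub>3 * T\<^sub>G = \<xi> * (T\<^sub>G * T\<^sub>3)" by (simp only: mult_ac)
    then show ?thesis unfolding z_def T\<^sub>3_eq T\<^sub>G_norm_elem by simp
  qed
  then have 2: "(\<xi> * T\<^sub>3 + y) * T\<^sub>G = 3 * z + 9 * y"
    by (simp add: distrib_right y)
  have h: "h\<^sub>2 (d\<^sub>2 (\<xi>, y)) = (3 * \<xi> - z - 2 * y, 3 * z + 9 * y)"
    unfolding d\<^sub>2.simps h\<^sub>2.simps 1 2 ..
  have 3: "(3 * \<xi> - z - 2 * y) * T\<^sub>3 + (3 * z + 9 * y) = 3 * (\<xi> * T\<^sub>3 + y)"
    "(3 * \<xi> - z - 2 * y) * T\<^sub>4 + (3 * z + 9 * y) = 3 * (\<xi> * T\<^sub>4 + y)"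
    by (simp_all add: left_diff_distrib mult.assoc y z)
  have 4: "- (3 * \<xi> - z - 2 * y) * t\<^sub>1 = 3 * (- \<xi> * t\<^sub>1)" "- (3 * \<xi> - z - 2 * y) * t\<^sub>2 = 3 * (- \<xi> * t\<^sub>2)"
    by (simp_all add: left_diff_distrib mult.assoc y z)
  have "d\<^sub>2 (h\<^sub>2 (d\<^sub>2 (\<xi>, y))) = smult4 3 (d\<^sub>2 (\<xi>, y))"
    unfolding h unfolding d\<^sub>2.simps smult4.simps 3 4 ..
  then show ?thesis
    unfolding x h3lift_def y_def by simp
qed

lemma triple_zg_inj: "triple x = triple y \<Longrightarrow> x = (y::zg)"
proof (rule poly_mapping_eqI)
  fix k assume "triple x = triple y"
  then have "lookup (triple x) k = lookup (triple y) k" by simp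
  then show "lookup x k = lookup y k" by (simp add: lookup_triple)
qed

text \<open>
  An element that \<open>t\<^sub>1\<close> and \<open>t\<^sub>2\<close> annihilate modulo 3 is invariant modulo 3, hence a multiple of \<open>T\<^sub>G\<close>
  modulo 3.
\<close>

lemma constant_mod_3:
  assumes "\<And>x. 3 dvd lookup (\<xi> * t\<^sub>1) x" "\<And>x. 3 dvd lookup (\<xi> * t\<^sub>2) x"
  shows "\<exists>c \<xi>'. \<xi> = Poly_Mapping.single 0 c * T\<^sub>G + triple \<xi>'"
proof -
  have "lookup (\<xi> * t\<^sub>1) (a + 1, b) = lookup \<xi> (a, b) - lookup \<xi> (a + 1, b)" for a b
    by (simp add: t\<^sub>1_def \<tau>\<^sub>1_def right_diff_distrib lookup_minus mult.commute[of \<xi>] lookup_single_times)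
  then have 1: "3 dvd lookup \<xi> (a, b) - lookup \<xi> (a + 1, b)" for a b
    using assms(1)[of "(a + 1, b)"] by simp
  have "lookup (\<xi> * t\<^sub>2) (a, b + 1) = lookup \<xi> (a, b) - lookup \<xi> (a, b + 1)" for a b
    by (simp add: t\<^sub>2_def \<tau>\<^sub>2_def right_diff_distrib lookup_minus mult.commute[of \<xi>] lookup_single_times)
  then have 2: "3 dvd lookup \<xi> (a, b) - lookup \<xi> (a, b + 1)" for a b
    using assms(2)[of "(a, b + 1)"] by simp
  have 3: "3 dvd lookup \<xi> (0, b) - lookup \<xi> (a, b)" for a b
    using exhaust3[of a] 1[of 0 b] dvd_add[OF 1[of 0 b] 1[of 1 b]] by auto
  have 4: "3 dvd lookup \<xi> (0, 0) - lookup \<xi> (0, b)" for b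
    using exhaust3[of b] 2[of 0 0] dvd_add[OF 2[of 0 0] 2[of 0 1]] by auto
  have 5: "3 dvd lookup \<xi> (a, b) - lookup \<xi> 0" for a b
    using dvd_add[OF 4[of b] 3[of b a]] dvd_minus_iff[of 3 "lookup \<xi> (a, b) - lookup \<xi> 0"]
    by (simp add: zero_prod_def)
  define \<xi>' :: zg where "\<xi>' = Abs_poly_mapping (\<lambda>x. (lookup \<xi> x - lookup \<xi> 0) div 3)"
  have "\<xi> = Poly_Mapping.single 0 (lookup \<xi> 0) * T\<^sub>G + triple \<xi>'"
  proof (rule poly_mapping_eqI)
    fix x :: "3 \<times> 3"
    obtain a b where "x = (a, b)" by fastforce
    with 5[of a b] have "3 * ((lookup \<xi> x - lookup \<xi> 0) div 3) = lookup \<xi> x - lookup \<xi> 0" by simp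
    then show "lookup \<xi> x = lookup (Poly_Mapping.single 0 (lookup \<xi> 0) * T\<^sub>G + triple \<xi>') x"
      by (simp add: lookup_add lookup_single_times lookup_T\<^sub>G lookup_triple \<xi>'_def)
  qed
  then show ?thesis by blast
qed

text \<open>
  If \<open>3 m = d\<^sub>2 (\<xi>, y)\<close>, the first two components show that \<open>\<xi>\<close> is a multiple \<open>cT\<close> of \<open>T\<^sub>G\<close>
  modulo 3; moving \<open>cT\<close> to the second argument of \<open>d\<^sub>2\<close> leaves a preimage divisible by 3.
\<close>

lemma D_torsion_free:
  assumes "triple m \<in> D" shows "m \<in> D"
proof -
  obtain m1 m2 m3 m4 where m: "m = (m1, m2, m3, m4)" by (cases m) auto
  obtain \<xi> y where y: "\<forall>x. lookup y x = lookup y 0" and "triple m = d\<^sub>2 (\<xi>, y)"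
    using assms M\<^sub>2_iff unfolding D_def by auto
  then have e: "triple m1 = - \<xi> * t\<^sub>1" "triple m2 = - \<xi> * t\<^sub>2" "triple m3 = \<xi> * T\<^sub>3 + y" "triple m4 = \<xi> * T\<^sub>4 + y"
    by (simp_all add: m triple_def)
  have dv: "3 dvd lookup (z * t) x" if "triple w = - z * t" for w z t :: zg and x
  proof -
    have "z * t = - triple w" using that by simp
    then have "lookup (z * t) x = 3 * (- lookup w x)"
      by (simp add: lookup_triple)
    then show ?thesis by (rule dvdI)
  qed
  obtain c \<xi>' where \<xi>: "\<xi> = Poly_Mapping.single 0 c * T\<^sub>G + triple \<xi>'"
    using constant_mod_3[OF dv[OF e(1)] dv[OF e(2)]] by blast
  define cT where "cT = Poly_Mapping.single 0 c * T\<^sub>G"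
  have a: "cT * t\<^sub>1 = 0" "cT * t\<^sub>2 = 0" "cT * T\<^sub>3 = triple cT" "cT * T\<^sub>4 = triple cT"
    unfolding cT_def T\<^sub>3_eq T\<^sub>4_eq mult.assoc T\<^sub>G_t T\<^sub>G_norm_elem by (simp_all add: triple_def algebra_simps)
  have tm: "triple u * v = triple (u * v)" for u v :: zg
    by (simp add: triple_def algebra_simps)
  have \<xi>2: "\<xi> = cT + triple \<xi>'" using \<xi> by (simp add: cT_def)
  have ta: "triple (u + v) = triple u + triple v" for u v :: zg
    by (simp add: triple_def algebra_simps)
  have tn: "triple (- u) = - triple u" for u :: zg
    by (simp add: triple_def algebra_simps)
  have x: "\<xi> * t\<^sub>1 = triple (\<xi>' * t\<^sub>1)" "\<xi> * t\<^sub>2 = triple (\<xi>' * t\<^sub>2)"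
    by (simp_all add: \<xi>2 distrib_right a tm)
  have m1: "m1 = - \<xi>' * t\<^sub>1"
    by (rule triple_zg_inj) (simp add: e(1) x tn)
  have m2: "m2 = - \<xi>' * t\<^sub>2"
    by (rule triple_zg_inj) (simp add: e(2) x tn)
  define y' where "y' = m3 - \<xi>' * T\<^sub>3 - cT"
  have y3: "y = triple y'"
    using e(3) unfolding y'_def \<xi>2 distrib_right a tm by (simp add: triple_def algebra_simps)
  have m3: "m3 = \<xi>' * T\<^sub>3 + (cT + y')" by (simp add: y'_def)
  have m4: "m4 = \<xi>' * T\<^sub>4 + (cT + y')"
    by (rule triple_zg_inj) (simp add: e(4) \<xi>2 distrib_right a tm ta y3 add.assoc)
  have "lookup y' x = lookup y' 0" for x
    using y[rule_format, of x] unfolding y3 by (simp add: lookup_triple)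
  moreover have "lookup cT x = lookup cT 0" for x
    by (simp add: cT_def lookup_single_times lookup_T\<^sub>G)
  ultimately have "(\<xi>', cT + y') \<in> M\<^sub>2"
    unfolding M\<^sub>2_iff lookup_add by metis
  moreover have "m = d\<^sub>2 (\<xi>', cT + y')"
    unfolding m by (simp add: m1 m2 m3 m4)
  ultimately show ?thesis unfolding D_def by blast
qed

lemma image_constant_eq: "m \<in> S \<Longrightarrow> (\<And>x. x \<in> S \<Longrightarrow> f x = c) \<Longrightarrow> f ` S = {c}"
  by force

text \<open>
  The class in \<open>M\<^sub>4\<close> of an element of \<open>M\<^sub>3\<close>.
\<close>

definition proj :: "zg4 \<Rightarrow> zg4 set" where "proj m = r_coset M\<^sub>3 D m"

lemma mem_proj: "x \<in> proj m \<longleftrightarrow> x - m \<in> D"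
proof -
  have "x \<in> proj m \<longleftrightarrow> (\<exists>h\<in>D. x = h + m)"
    by (auto simp: proj_def r_coset_def)
  also have "\<dots> \<longleftrightarrow> x - m \<in> D"
    by (metis add_diff_cancel_right' diff_add_cancel)
  finally show ?thesis .
qed

lemma proj_eq_iff: "proj x = proj y \<longleftrightarrow> x - y \<in> D"
proof
  assume "proj x = proj y"
  then have "x \<in> proj y" using mem_proj[of x x] D_0 by simp
  then show "x - y \<in> D" by (simp add: mem_proj)
next
  assume xy: "x - y \<in> D"
  have "z - x \<in> D \<longleftrightarrow> z - y \<in> D" for z
    using D_add[OF _ xy, of "z - x"] D_add[OF _ D_minus[OF xy], of "z - y"] by auto
  then show "proj x = proj y"
    using mem_proj by blast
qed

lemma M\<^sub>4_eq: "M\<^sub>4 = M\<^sub>3 Mod D"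
  by (simp add: M\<^sub>4_def D_def)

lemma comm_group_M\<^sub>4: "comm_group M\<^sub>4"
  unfolding M\<^sub>4_eq by (rule comm_group.abelian_FactGroup[OF comm_group_M\<^sub>3 subgroup_D])

lemma carrier_M\<^sub>4: "carrier M\<^sub>4 = proj ` carrier M\<^sub>3"
  unfolding M\<^sub>4_eq FactGroup_def RCOSETS_def proj_def by auto

lemma proj_add: "x \<in> carrier M\<^sub>3 \<Longrightarrow> y \<in> carrier M\<^sub>3 \<Longrightarrow> proj (x + y) = proj x \<otimes>\<^bsub>M\<^sub>4\<^esub> proj y"
proof -
  assume "x \<in> carrier M\<^sub>3" "y \<in> carrier M\<^sub>3"
  moreover have "D \<lhd> M\<^sub>3"
    using comm_group.normal_iff_subgroup[OF comm_group_M\<^sub>3] subgroup_D by blast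
  ultimately show ?thesis
    using normal.rcos_sum[of D M\<^sub>3 x y] by (simp add: M\<^sub>4_eq FactGroup_def proj_def)
qed

lemma proj_pow3: "x \<in> carrier M\<^sub>3 \<Longrightarrow> proj x [^]\<^bsub>M\<^sub>4\<^esub> (3::nat) = proj (triple x)"
proof -
  interpret comm_group M\<^sub>4 by (rule comm_group_M\<^sub>4)
  assume x: "x \<in> carrier M\<^sub>3"
  then have "proj x \<in> carrier M\<^sub>4" by (simp add: carrier_M\<^sub>4)
  then have "proj x [^]\<^bsub>M\<^sub>4\<^esub> (3::nat) = proj x \<otimes>\<^bsub>M\<^sub>4\<^esub> proj x \<otimes>\<^bsub>M\<^sub>4\<^esub> proj x"
    by (simp add: numeral_3_eq_3)
  then show ?thesis
    using x by (simp add: triple_def proj_add M\<^sub>3_add)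
qed

lemma triple_M\<^sub>3: "x \<in> carrier M\<^sub>3 \<Longrightarrow> triple x \<in> carrier M\<^sub>3"
  by (simp add: triple_def M\<^sub>3_add)

lemma pow1: "comm_group M \<Longrightarrow> x \<in> carrier M \<Longrightarrow> x [^]\<^bsub>M\<^esub> Suc 0 = x"
proof -
  assume "comm_group M" "x \<in> carrier M"
  interpret comm_group M by fact
  show ?thesis using \<open>x \<in> carrier M\<close> by simp
qed

lemma pow9: "comm_group M \<Longrightarrow> x \<in> carrier M \<Longrightarrow> x [^]\<^bsub>M\<^esub> (9::nat) = (x [^]\<^bsub>M\<^esub> (3::nat)) [^]\<^bsub>M\<^esub> (3::nat)"
  by (simp add: monoid.nat_pow_pow comm_group.axioms comm_monoid.axioms)

lemma proj_pow9: "x \<in> carrier M\<^sub>3 \<Longrightarrow> proj x [^]\<^bsub>M\<^sub>4\<^esub> (9::nat) = proj (triple (triple x))"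
  by (simp add: pow9[OF comm_group_M\<^sub>4] carrier_M\<^sub>4 proj_pow3 triple_M\<^sub>3)

lemma M\<^sub>3_pow3: "x \<in> carrier M\<^sub>3 \<Longrightarrow> x [^]\<^bsub>M\<^sub>3\<^esub> (3::nat) = triple x"
  by (simp add: numeral_3_eq_3 triple_def nat_pow_def)

lemma quotient_map_of_proj:
  assumes "\<And>x. x \<in> D \<Longrightarrow> f x \<in> D" "\<And>x y. f (x + y) = f x + f y"
  shows "quotient_map_of M\<^sub>3 D f (proj m) = proj (f m)"
proof -
  have "proj (f x) = proj (f m)" if "x \<in> proj m" for x
  proof -
    have "f x = f (x - m) + f m" using assms(2)[of "x - m" m] by simp
    then have "f x - f m = f (x - m)" by simp
    then show ?thesis
      using assms(1)[of "x - m"] that by (simp add: proj_eq_iff mem_proj)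
  qed
  moreover have "m \<in> proj m" by (simp add: mem_proj D_0)
  ultimately have "(\<lambda>x. proj (f x)) ` proj m = {proj (f m)}" by (intro image_constant_eq)
  then show ?thesis by (simp add: quotient_map_of_def proj_def)
qed

lemma h\<^sub>3_proj: "h\<^sub>3 (proj m) = h3lift m"
proof -
  have "h3lift x = h3lift m" if "x \<in> proj m" for x
    using h3lift_add[of "x - m" m] h3lift_D[of "x - m"] that by (simp add: mem_proj)
  moreover have "m \<in> proj m" by (simp add: mem_proj D_0)
  ultimately have "h3lift ` proj m = {h3lift m}" by (intro image_constant_eq)
  then show ?thesis unfolding h\<^sub>3_def by (simp add: h3lift_def[abs_def])
qed

section \<open>The action through two independent characters\<close>

lemma single_power: "Poly_Mapping.single (a, b) (1::int) ^ k = Poly_Mapping.single (of_nat k * a, of_nat k * b) 1"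
  for a b :: 3
proof (induction k)
  case 0
  show ?case by (simp flip: zero_prod_def)
next
  case (Suc k)
  then show ?case by (simp add: mult_single algebra_simps)
qed

lemma of_int_mod3: "(of_int (x mod 3) :: 3) = of_int x"
proof -
  have "(of_int x :: 3) = of_int (3 * (x div 3) + x mod 3)" by simp
  also have "\<dots> = of_int (x mod 3)" unfolding of_int_add of_int_mult by (simp add: three_eq_0)
  finally show ?thesis ..
qed

locale two_characters =
  fixes G :: "'a monoid" and T :: "'a topology" and chi1 chi2 :: "'a \<Rightarrow> int"
  assumes voev: "voevodsky_group G T"
    and chi1: "character3 G T chi1" and chi2: "character3 G T chi2"
    and indep: "independent_characters3 G chi1 chi2"
begin

sublocale cochain_setting G T
  using voev by unfold_locales (simp add: voevodsky_group_def pro_p_group_def profinite_group_def)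

text \<open>
  The two characters as a homomorphism to the group \<open>3 \<times> 3\<close>, and the action on the group ring.
\<close>

definition \<theta> :: "'a \<Rightarrow> 3 \<times> 3" where "\<theta> \<gamma> = (of_int (chi1 \<gamma>), of_int (chi2 \<gamma>))"

definition zg_act :: "'a \<Rightarrow> zg \<Rightarrow> zg" where
  "zg_act \<gamma> y = \<tau>\<^sub>1 ^ nat (chi1 \<gamma>) * \<tau>\<^sub>2 ^ nat (chi2 \<gamma>) * y"

lemma chi_range: "\<gamma> \<in> carrier G \<Longrightarrow> 0 \<le> chi1 \<gamma> \<and> chi1 \<gamma> < 3 \<and> 0 \<le> chi2 \<gamma> \<and> chi2 \<gamma> < 3"
  using chi1 chi2 by (auto simp: character3_def hom_def Pi_iff carrier_integer_mod_group)

lemma chi_mult: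
  "\<gamma> \<in> carrier G \<Longrightarrow> \<gamma>' \<in> carrier G \<Longrightarrow> chi1 (\<gamma> \<otimes>\<^bsub>G\<^esub> \<gamma>') = (chi1 \<gamma> + chi1 \<gamma>') mod 3"
  "\<gamma> \<in> carrier G \<Longrightarrow> \<gamma>' \<in> carrier G \<Longrightarrow> chi2 (\<gamma> \<otimes>\<^bsub>G\<^esub> \<gamma>') = (chi2 \<gamma> + chi2 \<gamma>') mod 3"
  using chi1 chi2 by (auto simp: character3_def hom_def)

lemma zg_act_single: "\<gamma> \<in> carrier G \<Longrightarrow> zg_act \<gamma> y = Poly_Mapping.single (\<theta> \<gamma>) 1 * y"
  using chi_range[of \<gamma>]
  by (simp add: zg_act_def \<tau>\<^sub>1_def \<tau>\<^sub>2_def single_power mult_single \<theta>_def)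

lemma \<theta>_mult: "\<gamma> \<in> carrier G \<Longrightarrow> \<gamma>' \<in> carrier G \<Longrightarrow> \<theta> (\<gamma> \<otimes>\<^bsub>G\<^esub> \<gamma>') = \<theta> \<gamma> + \<theta> \<gamma>'"
  by (simp add: \<theta>_def chi_mult of_int_mod3)

lemma loc_const_chi: "loc_const T chi1" "loc_const T chi2"
  using chi1 chi2 by (auto simp: character3_def continuous_map_discrete_iff)

lemma loc_const_\<theta>: "loc_const T \<theta>"
  unfolding \<theta>_def[abs_def] using loc_const_map2[OF loc_const_chi, of "\<lambda>a b. (of_int a, of_int b)"] .

lemma \<theta>_pow: "\<gamma> \<in> carrier G \<Longrightarrow> \<theta> (\<gamma> [^]\<^bsub>G\<^esub> (k::nat)) = (of_nat k * fst (\<theta> \<gamma>), of_nat k * snd (\<theta> \<gamma>))"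
proof (induction k)
  case 0
  have "\<theta> \<one>\<^bsub>G\<^esub> = 0" using \<theta>_mult[of "\<one>\<^bsub>G\<^esub>" "\<one>\<^bsub>G\<^esub>"] by simp
  then show ?case by (simp add: zero_prod_def)
next
  case (Suc k)
  then show ?case by (simp add: \<theta>_mult prod_eq_iff algebra_simps)
qed

lemma of_int_3_eq_0_iff: "(of_int x :: 3) = 0 \<longleftrightarrow> x mod 3 = 0"
proof -
  have "x mod 3 = 0 \<or> x mod 3 = 1 \<or> x mod 3 = 2" by presburger
  then show ?thesis
    unfolding of_int_mod3[of x, symmetric] by auto
qed

text \<open>
  By independence the determinant of the characters at some two elements \<open>\<gamma>\<close> and \<open>\<delta>\<close> does not vanish
  modulo 3; products of powers of \<open>\<gamma>\<close> and \<open>\<delta>\<close> then reach every point, by Cramer's rule.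
\<close>

lemma range_\<theta>: "\<theta> ` carrier G = UNIV"
proof -
  have "\<exists>\<gamma>\<in>carrier G. \<exists>\<delta>\<in>carrier G. (chi1 \<gamma> * chi2 \<delta> - chi2 \<gamma> * chi1 \<delta>) mod 3 \<noteq> 0"
  proof (rule ccontr)
    assume "\<not> ?thesis"
    then have c: "(chi1 \<gamma> * chi2 \<delta> - chi2 \<gamma> * chi1 \<delta>) mod 3 = 0" if "\<gamma> \<in> carrier G" "\<delta> \<in> carrier G" for \<gamma> \<delta>
      using that by blast
    have i: "a = 0 \<and> b = 0" if "0 \<le> a" "a < 3" "0 \<le> b" "b < 3"
      "\<And>\<delta>. \<delta> \<in> carrier G \<Longrightarrow> (a * chi1 \<delta> + b * chi2 \<delta>) mod 3 = 0" for a b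
    proof -
      have "a \<in> carrier (Zmod 3)" "b \<in> carrier (Zmod 3)"
        using that(1-4) by (simp_all add: carrier_integer_mod_group)
      then show ?thesis
        using indep that(5) unfolding independent_characters3_def by blast
    qed
    have "chi1 \<gamma> = 0" if \<gamma>: "\<gamma> \<in> carrier G" for \<gamma>
    proof -
      have "((- chi2 \<gamma>) mod 3 * chi1 \<delta> + chi1 \<gamma> * chi2 \<delta>) mod 3 = 0" if "\<delta> \<in> carrier G" for \<delta>
      proof -
        have "((- chi2 \<gamma>) mod 3 * chi1 \<delta> + chi1 \<gamma> * chi2 \<delta>) mod 3
            = ((- chi2 \<gamma>) * chi1 \<delta> + chi1 \<gamma> * chi2 \<delta>) mod 3"
          by (metis mod_add_left_eq mod_mult_left_eq)
        then show ?thesis using c[OF \<gamma> that] by (simp add: algebra_simps)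
      qed
      then show ?thesis
        using i[of "(- chi2 \<gamma>) mod 3" "chi1 \<gamma>"] chi_range[OF \<gamma>] by simp
    qed
    then show False using i[of 1 0] by simp
  qed
  then obtain \<gamma> \<delta> where \<gamma>: "\<gamma> \<in> carrier G" and \<delta>: "\<delta> \<in> carrier G"
    and d0: "(chi1 \<gamma> * chi2 \<delta> - chi2 \<gamma> * chi1 \<delta>) mod 3 \<noteq> 0" by blast
  define p1 p2 q1 q2 where "p1 = fst (\<theta> \<gamma>)" "p2 = snd (\<theta> \<gamma>)" "q1 = fst (\<theta> \<delta>)" "q2 = snd (\<theta> \<delta>)"
  define d where "d = p1 * q2 - p2 * q1"
  have "d = of_int (chi1 \<gamma> * chi2 \<delta> - chi2 \<gamma> * chi1 \<delta>)"
    by (simp add: d_def p1_p2_q1_q2_def \<theta>_def)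
  then have "d \<noteq> 0" using d0 of_int_3_eq_0_iff by metis
  then have dd: "d * d = 1" using exhaust3[of d] by auto
  have ex: "\<exists>k::nat. of_nat k = z" for z :: 3
    using exhaust3[of z] by (metis of_nat_0 of_nat_1 of_nat_numeral)
  have "(x, y) \<in> \<theta> ` carrier G" for x y
  proof -
    obtain m n :: nat where mn: "of_nat m = d * (x * q2 - y * q1)" "of_nat n = d * (y * p1 - x * p2)"
      using ex by metis
    have "\<theta> (\<gamma> [^]\<^bsub>G\<^esub> m \<otimes>\<^bsub>G\<^esub> \<delta> [^]\<^bsub>G\<^esub> n) = (of_nat m * p1 + of_nat n * q1, of_nat m * p2 + of_nat n * q2)"
      using \<gamma> \<delta> by (simp add: \<theta>_mult \<theta>_pow p1_p2_q1_q2_def)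
    also have "of_nat m * p1 + of_nat n * q1 = d * d * x"
      unfolding mn by (simp add: d_def algebra_simps)
    also have "of_nat m * p2 + of_nat n * q2 = d * d * y"
      unfolding mn by (simp add: d_def algebra_simps)
    finally have "\<theta> (\<gamma> [^]\<^bsub>G\<^esub> m \<otimes>\<^bsub>G\<^esub> \<delta> [^]\<^bsub>G\<^esub> n) = (x, y)" by (simp add: dd)
    moreover have "\<gamma> [^]\<^bsub>G\<^esub> m \<otimes>\<^bsub>G\<^esub> \<delta> [^]\<^bsub>G\<^esub> n \<in> carrier G" using \<gamma> \<delta> by simp
    ultimately show ?thesis by (metis image_eqI)
  qed
  then show ?thesis by auto
qed

lemma bockstein_vanishes_quotient:
  assumes fq: "finite_quotient G T \<theta>'"
  shows "bockstein_vanishes G T (finite_quotient.perm \<theta>') UNIV n"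
proof -
  interpret F: finite_quotient G T \<theta>' by (rule fq)
  have "subgroup F.ker G" "closedin T F.ker" using F.subgroup_ker F.closedin_ker .
  then have "cohomology_map F.GK F.TK (Zmod 3) trivial_act (\<lambda>x. x mod 3) n
          ` carrier (cohomology F.GK F.TK (Zmod 9) trivial_act n)
        = carrier (cohomology F.GK F.TK (Zmod 3) trivial_act n)"
    using voev unfolding voevodsky_group_def F.GK_def F.TK_def by blast
  then show ?thesis
    by (intro F.bockstein_vanishes_perm F.K.bockstein_vanishes_trivial)
qed

lemma zg_cochain_module: "cochain_module G T zg_act"
proof
  fix \<gamma> \<gamma>' and v w :: zg
  show "zg_act \<gamma> (v + w) = zg_act \<gamma> v + zg_act \<gamma> w"
    by (simp add: zg_act_def distrib_left)
  show "zg_act (\<gamma> \<otimes>\<^bsub>G\<^esub> \<gamma>') v = zg_act \<gamma> (zg_act \<gamma>' v)" if "\<gamma> \<in> carrier G" "\<gamma>' \<in> carrier G"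
    using that by (simp add: zg_act_single \<theta>_mult mult_single flip: mult.assoc)
  show "loc_const T (\<lambda>\<gamma>. zg_act \<gamma> v)"
    unfolding zg_act_def
    using loc_const_map2[OF loc_const_chi, of "\<lambda>a b. \<tau>\<^sub>1 ^ nat a * \<tau>\<^sub>2 ^ nat b * v"] .
qed

lemma bockstein_vanishes_zg: "bockstein_vanishes G T zg_act UNIV n"
proof -
  interpret F: finite_quotient G T \<theta>
    by unfold_locales (use \<theta>_mult loc_const_\<theta> range_\<theta> in auto)
  show ?thesis
  proof (rule bockstein_vanishes_iso[OF _ zg_cochain_module, of F.perm Abs_poly_mapping _ lookup])
    show "cochain_module G T F.perm" by unfold_locales
    show "Abs_poly_mapping (x + y) = Abs_poly_mapping x + Abs_poly_mapping y" for x y :: "3 \<times> 3 \<Rightarrow> int"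
      by (rule poly_mapping_eqI) (simp add: lookup_add)
    show "Abs_poly_mapping (F.perm \<gamma> x) = zg_act \<gamma> (Abs_poly_mapping x)" if "\<gamma> \<in> carrier G" for \<gamma> x
      by (rule poly_mapping_eqI) (simp add: zg_act_single[OF that] lookup_single_times F.perm_def)
    show "bockstein_vanishes G T F.perm UNIV n"
      by (rule bockstein_vanishes_quotient) unfold_locales
  qed simp_all
qed

text \<open>
  The ideal of elements constant on the cosets of the line of slope \<open>e\<close> is the permutation module of
  the quotient by this line, which is identified with the type \<open>3\<close> by \<open>(a, b) \<mapsto> b - e * a\<close>.
\<close>

lemma bockstein_vanishes_line: "bockstein_vanishes G T zg_act (line_invariant e) n"
proof -
  define \<theta>' where "\<theta>' \<gamma> = snd (\<theta> \<gamma>) - e * fst (\<theta> \<gamma>)" for \<gamma>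
  interpret F: finite_quotient G T \<theta>'
  proof
    show "\<theta>' (g \<otimes>\<^bsub>G\<^esub> h) = \<theta>' g + \<theta>' h" if "g \<in> carrier G" "h \<in> carrier G" for g h
      using that by (simp add: \<theta>'_def \<theta>_mult algebra_simps)
    show "loc_const T \<theta>'"
      unfolding \<theta>'_def[abs_def] using loc_const_map[OF loc_const_\<theta>, of "\<lambda>t. snd t - e * fst t"] .
    show "\<theta>' ` carrier G = UNIV"
    proof (intro equalityI subsetI UNIV_I)
      fix t :: 3
      obtain \<gamma> where "\<gamma> \<in> carrier G" "\<theta> \<gamma> = (0, t)" using range_\<theta> by (metis UNIV_I imageE)
      then show "t \<in> \<theta>' ` carrier G" by (intro image_eqI[of _ _ \<gamma>]) (simp_all add: \<theta>'_def)
    qed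
  qed
  define \<Phi> :: "(3 \<Rightarrow> int) \<Rightarrow> zg" where "\<Phi> v = Abs_poly_mapping (\<lambda>x. v (snd x - e * fst x))" for v
  have \<Phi>: "lookup (\<Phi> v) x = v (snd x - e * fst x)" for v x
    by (simp add: \<Phi>_def)
  show ?thesis
  proof (rule bockstein_vanishes_iso[OF _ zg_cochain_module, of F.perm \<Phi> _ "\<lambda>y t. lookup y (0, t)"])
    show "cochain_module G T F.perm" by unfold_locales
    show "\<Phi> (x + y) = \<Phi> x + \<Phi> y" for x y
      by (rule poly_mapping_eqI) (simp add: lookup_add \<Phi>)
    show "\<Phi> (F.perm \<gamma> x) = zg_act \<gamma> (\<Phi> x)" if "\<gamma> \<in> carrier G" for \<gamma> x
    proof (rule poly_mapping_eqI)
      fix k :: "3 \<times> 3"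
      have "snd k - e * fst k - \<theta>' \<gamma> = snd (k - \<theta> \<gamma>) - e * fst (k - \<theta> \<gamma>)"
        by (simp add: \<theta>'_def algebra_simps)
      then show "lookup (\<Phi> (F.perm \<gamma> x)) k = lookup (zg_act \<gamma> (\<Phi> x)) k"
        unfolding zg_act_single[OF that] lookup_single_times F.perm_def \<Phi> by (simp only: mult_1)
    qed
    show "bockstein_vanishes G T F.perm UNIV n"
      by (rule bockstein_vanishes_quotient) unfold_locales
    show "\<Phi> v \<in> line_invariant e" for v
      by (simp add: line_invariant_def \<Phi>)
    show "(\<lambda>t. lookup (\<Phi> v) (0, t)) = v" for v
      by (simp add: \<Phi>)
    show "\<Phi> (\<lambda>t. lookup y (0, t)) = y" if "y \<in> line_invariant e" for y
    proof (rule poly_mapping_eqI)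
      fix x :: "3 \<times> 3"
      show "lookup (\<Phi> (\<lambda>t. lookup y (0, t))) x = lookup y x"
        using that unfolding \<Phi> line_invariant_def by (cases x) simp
    qed
  qed
qed

abbreviation act :: "'a \<Rightarrow> zg4 \<Rightarrow> zg4" where "act \<equiv> act_M\<^sub>3 chi1 chi2"

lemma cochain_module_prod:
  assumes "cochain_module G T a" "cochain_module G T b"
  shows "cochain_module G T (\<lambda>\<gamma> (x, y). (a \<gamma> x, b \<gamma> y))"
proof -
  interpret a: cochain_module G T a by fact
  interpret b: cochain_module G T b by fact
  show ?thesis
  proof
    fix \<gamma> \<gamma>' v w
    show "(case v + w of (x, y) \<Rightarrow> (a \<gamma> x, b \<gamma> y)) = (case v of (x, y) \<Rightarrow> (a \<gamma> x, b \<gamma> y)) + (case w of (x, y) \<Rightarrow> (a \<gamma> x, b \<gamma> y))"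
      if "\<gamma> \<in> carrier G"
      using that by (cases v; cases w) (simp add: a.act_add b.act_add)
    show "(case v of (x, y) \<Rightarrow> (a (\<gamma> \<otimes>\<^bsub>G\<^esub> \<gamma>') x, b (\<gamma> \<otimes>\<^bsub>G\<^esub> \<gamma>') y))
      = (case (case v of (x, y) \<Rightarrow> (a \<gamma>' x, b \<gamma>' y)) of (x, y) \<Rightarrow> (a \<gamma> x, b \<gamma> y))"
      if "\<gamma> \<in> carrier G" "\<gamma>' \<in> carrier G"
      using that by (cases v) (simp add: a.act_mult b.act_mult)
    show "loc_const T (\<lambda>\<gamma>. case v of (x, y) \<Rightarrow> (a \<gamma> x, b \<gamma> y))"
      using loc_const_map2[OF a.act_loc_const b.act_loc_const, of Pair] by (cases v) simp
  qed
qed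

lemma act_prod: "act = (\<lambda>\<gamma> (x1, y). (zg_act \<gamma> x1, case y of (x2, z) \<Rightarrow> (zg_act \<gamma> x2, case z of (x3, x4) \<Rightarrow> (zg_act \<gamma> x3, zg_act \<gamma> x4))))"
  by (auto simp: act_M\<^sub>3_def zg_act_def fun_eq_iff)

lemma cochain_module_act: "cochain_module G T act"
  unfolding act_prod by (intro cochain_module_prod zg_cochain_module)

lemma bockstein_vanishes_M\<^sub>3: "bockstein_vanishes G T act (carrier M\<^sub>3) n"
  unfolding act_prod carrier_M\<^sub>3
  by (intro bockstein_vanishes_prod cochain_module_prod zg_cochain_module bockstein_vanishes_zg bockstein_vanishes_line)

sublocale M: cochain_module G T act
  by (rule cochain_module_act)

lemma act_M\<^sub>3_closed: "x \<in> carrier M\<^sub>3 \<Longrightarrow> act \<gamma> x \<in> carrier M\<^sub>3"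
  by (simp add: act_M\<^sub>3_def M\<^sub>3_smult)

lemma act_D: "x \<in> D \<Longrightarrow> act \<gamma> x \<in> D"
  by (simp add: act_M\<^sub>3_def D_smult)

lemma act_plus: "act \<gamma> (x + y) = act \<gamma> x + act \<gamma> y"
  by (simp add: act_M\<^sub>3_def smult4_add)

abbreviation act4 :: "'a \<Rightarrow> zg4 set \<Rightarrow> zg4 set" where "act4 \<equiv> act_M\<^sub>4 chi1 chi2"

lemma act4_proj: "act4 \<gamma> (proj m) = proj (act \<gamma> m)"
  unfolding act_M\<^sub>4_def D_def[symmetric] by (rule quotient_map_of_proj[OF act_D act_plus])

lemma presentation_M\<^sub>3:
  assumes k: "k > 1"
  shows "presentation G T act (tensor_product M\<^sub>3 (Zmod k)) (tensor_act M\<^sub>3 (Zmod k) act) (carrier M\<^sub>3) (tensor1 M\<^sub>3 k)"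
proof -
  interpret t: tensor_with_Zmod M\<^sub>3 k
    using comm_group_M\<^sub>3 k by (simp add: tensor_with_Zmod_def tensor_with_Zmod_axioms_def)
  show ?thesis
  proof (intro presentation.intro cochain_module_act presentation_axioms.intro)
    show "comm_group (tensor_product M\<^sub>3 (Zmod k))" by (rule t.comm_group_tensor)
    show "tensor1 M\<^sub>3 k ` carrier M\<^sub>3 = carrier (tensor_product M\<^sub>3 (Zmod k))" by (rule t.tensor1_image)
    show "tensor1 M\<^sub>3 k (x + y) = tensor1 M\<^sub>3 k x \<otimes>\<^bsub>tensor_product M\<^sub>3 (Zmod k)\<^esub> tensor1 M\<^sub>3 k y"
      if "x \<in> carrier M\<^sub>3" "y \<in> carrier M\<^sub>3" for x y
      using t.tensor1_add[OF that] by simp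
    fix \<gamma> x assume \<gamma>: "\<gamma> \<in> carrier G" and x: "x \<in> carrier M\<^sub>3"
    have "act \<gamma> \<in> hom M\<^sub>3 M\<^sub>3"
      by (rule homI) (simp_all add: act_M\<^sub>3_closed act_plus)
    moreover have "(\<lambda>x. x) \<in> hom (Zmod k) (Zmod k)" by (rule homI) simp_all
    ultimately have "tensor_map M\<^sub>3 (Zmod k) (act \<gamma>) (\<lambda>x. x) (tensor1 M\<^sub>3 k x) = tensor1 M\<^sub>3 k (act \<gamma> x [^]\<^bsub>M\<^sub>3\<^esub> nat 1)"
      using tensor_map_tensor1[OF comm_group_M\<^sub>3 comm_group_M\<^sub>3 k k] x by blast
    then show "tensor_map M\<^sub>3 (Zmod k) (act \<gamma>) (\<lambda>x. x) (tensor1 M\<^sub>3 k x) = tensor1 M\<^sub>3 k (act \<gamma> x)"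
      by (simp add: pow1 comm_group_M\<^sub>3 comm_group_M\<^sub>4 act_M\<^sub>3_closed[OF x])
  qed (simp_all add: M\<^sub>3_0 M\<^sub>3_add M\<^sub>3_minus act_M\<^sub>3_closed)
qed

text \<open>
  The map \<open>m \<mapsto> [m] \<otimes> 1\<close> from \<open>M\<^sub>3\<close> onto \<open>M\<^sub>4 \<otimes> \<int>/k\<close>.
\<close>

abbreviation tensor_proj :: "nat \<Rightarrow> zg4 \<Rightarrow> (zg4 set \<times> int \<Rightarrow>\<^sub>0 int) set" where
  "tensor_proj k m \<equiv> tensor1 M\<^sub>4 k (proj m)"

lemma presentation_M\<^sub>4:
  assumes k: "k > 1"
  shows "presentation G T act (tensor_product M\<^sub>4 (Zmod k)) (tensor_act M\<^sub>4 (Zmod k) act4) (carrier M\<^sub>3) (tensor_proj k)"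
proof -
  interpret t: tensor_with_Zmod M\<^sub>4 k
    using comm_group_M\<^sub>4 k by (simp add: tensor_with_Zmod_def tensor_with_Zmod_axioms_def)
  have pc: "proj x \<in> carrier M\<^sub>4" if "x \<in> carrier M\<^sub>3" for x
    using that by (simp add: carrier_M\<^sub>4)
  show ?thesis
  proof (intro presentation.intro cochain_module_act presentation_axioms.intro)
    show "comm_group (tensor_product M\<^sub>4 (Zmod k))" by (rule t.comm_group_tensor)
    show "tensor_proj k ` carrier M\<^sub>3 = carrier (tensor_product M\<^sub>4 (Zmod k))"
      unfolding t.tensor1_image[symmetric] carrier_M\<^sub>4 image_image ..
    show "tensor_proj k (x + y) = tensor_proj k x \<otimes>\<^bsub>tensor_product M\<^sub>4 (Zmod k)\<^esub> tensor_proj k y"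
      if "x \<in> carrier M\<^sub>3" "y \<in> carrier M\<^sub>3" for x y
      using t.tensor1_add[OF pc[OF that(1)] pc[OF that(2)]] that by (simp add: proj_add)
    fix \<gamma> x assume \<gamma>: "\<gamma> \<in> carrier G" and x: "x \<in> carrier M\<^sub>3"
    have "act4 \<gamma> \<in> hom M\<^sub>4 M\<^sub>4"
    proof (rule homI)
      fix a b assume "a \<in> carrier M\<^sub>4" "b \<in> carrier M\<^sub>4"
      then obtain a' b' where ab: "a' \<in> carrier M\<^sub>3" "b' \<in> carrier M\<^sub>3" "a = proj a'" "b = proj b'"
        unfolding carrier_M\<^sub>4 by blast
      have "act4 \<gamma> (proj a' \<otimes>\<^bsub>M\<^sub>4\<^esub> proj b') = proj (act \<gamma> (a' + b'))"
        using ab by (simp add: act4_proj flip: proj_add)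
      then show "act4 \<gamma> (a \<otimes>\<^bsub>M\<^sub>4\<^esub> b) = act4 \<gamma> a \<otimes>\<^bsub>M\<^sub>4\<^esub> act4 \<gamma> b"
        using ab by (simp add: act4_proj act_plus act_M\<^sub>3_closed proj_add)
    qed (auto simp: carrier_M\<^sub>4 act4_proj act_M\<^sub>3_closed)
    moreover have "(\<lambda>x. x) \<in> hom (Zmod k) (Zmod k)" by (rule homI) simp_all
    ultimately have "tensor_map M\<^sub>4 (Zmod k) (act4 \<gamma>) (\<lambda>x. x) (tensor_proj k x) = tensor1 M\<^sub>4 k (act4 \<gamma> (proj x) [^]\<^bsub>M\<^sub>4\<^esub> nat 1)"
      using tensor_map_tensor1[OF comm_group_M\<^sub>4 comm_group_M\<^sub>4 k k] pc[OF x] by blast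
    then show "tensor_map M\<^sub>4 (Zmod k) (act4 \<gamma>) (\<lambda>x. x) (tensor_proj k x) = tensor_proj k (act \<gamma> x)"
      by (simp add: pow1 comm_group_M\<^sub>3 comm_group_M\<^sub>4 act4_proj pc act_M\<^sub>3_closed[OF x])
  qed (simp_all add: M\<^sub>3_0 M\<^sub>3_add M\<^sub>3_minus act_M\<^sub>3_closed)
qed

lemma tensor_proj_3_eq_one_iff:
  assumes "x \<in> carrier M\<^sub>3"
  shows "tensor_proj 3 x = \<one>\<^bsub>tensor_product M\<^sub>4 (Zmod 3)\<^esub> \<longleftrightarrow> (\<exists>s\<in>carrier M\<^sub>3. x - triple s \<in> D)"
proof -
  interpret t: tensor_with_Zmod M\<^sub>4 3
    using comm_group_M\<^sub>4 by (simp add: tensor_with_Zmod_def tensor_with_Zmod_axioms_def)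
  have "proj x \<in> carrier M\<^sub>4" using assms by (simp add: carrier_M\<^sub>4)
  then have "tensor_proj 3 x = \<one>\<^bsub>tensor_product M\<^sub>4 (Zmod 3)\<^esub> \<longleftrightarrow> (\<exists>s\<in>carrier M\<^sub>3. proj x = proj s [^]\<^bsub>M\<^sub>4\<^esub> (3::nat))"
    by (simp add: t.tensor1_eq_one_iff carrier_M\<^sub>4)
  then show ?thesis by (simp add: proj_pow3 proj_eq_iff)
qed

lemma tensor_proj_9_eq_one_iff:
  assumes "x \<in> carrier M\<^sub>3"
  shows "tensor_proj 9 x = \<one>\<^bsub>tensor_product M\<^sub>4 (Zmod 9)\<^esub> \<longleftrightarrow> (\<exists>s\<in>carrier M\<^sub>3. x - triple (triple s) \<in> D)"
proof -
  interpret t: tensor_with_Zmod M\<^sub>4 9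
    using comm_group_M\<^sub>4 by (simp add: tensor_with_Zmod_def tensor_with_Zmod_axioms_def)
  have "proj x \<in> carrier M\<^sub>4" using assms by (simp add: carrier_M\<^sub>4)
  then have "tensor_proj 9 x = \<one>\<^bsub>tensor_product M\<^sub>4 (Zmod 9)\<^esub> \<longleftrightarrow> (\<exists>s\<in>carrier M\<^sub>3. proj x = proj s [^]\<^bsub>M\<^sub>4\<^esub> (9::nat))"
    by (simp add: t.tensor1_eq_one_iff carrier_M\<^sub>4)
  then show ?thesis by (simp add: proj_pow9 proj_eq_iff)
qed

text \<open>
  The prefix \<open>A3\<close> refers to \<open>M\<^sub>3 \<otimes> \<int>/3\<close>, and \<open>B3\<close> and \<open>B9\<close> to \<open>M\<^sub>4 \<otimes> \<int>/3\<close> and \<open>M\<^sub>4 \<otimes> \<int>/9\<close>. All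
  three are presented by \<open>M\<^sub>3\<close>.
\<close>

sublocale A3: presentation G T act "tensor_product M\<^sub>3 (Zmod 3)" "tensor_act M\<^sub>3 (Zmod 3) act" "carrier M\<^sub>3" "tensor1 M\<^sub>3 3"
  by (rule presentation_M\<^sub>3) simp

sublocale B3: presentation G T act "tensor_product M\<^sub>4 (Zmod 3)" "tensor_act M\<^sub>4 (Zmod 3) act4" "carrier M\<^sub>3" "tensor_proj 3"
  by (rule presentation_M\<^sub>4) simp

sublocale B9: presentation G T act "tensor_product M\<^sub>4 (Zmod 9)" "tensor_act M\<^sub>4 (Zmod 9) act4" "carrier M\<^sub>3" "tensor_proj 9"
  by (rule presentation_M\<^sub>4) simp

lemma N_A3: "x \<in> A3.N \<longleftrightarrow> x \<in> triple ` carrier M\<^sub>3"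
proof -
  interpret t: tensor_with_Zmod M\<^sub>3 3
    using comm_group_M\<^sub>3 by (simp add: tensor_with_Zmod_def tensor_with_Zmod_axioms_def)
  show ?thesis
    unfolding A3.N_def using t.tensor1_eq_one_iff[of x] M\<^sub>3_pow3 triple_M\<^sub>3 by auto
qed

lemma N_B3: "x \<in> B3.N \<longleftrightarrow> x \<in> carrier M\<^sub>3 \<and> (\<exists>s\<in>carrier M\<^sub>3. x - triple s \<in> D)"
  unfolding B3.N_def mem_Collect_eq using tensor_proj_3_eq_one_iff[of x] by blast

lemma N_B9: "x \<in> B9.N \<longleftrightarrow> x \<in> carrier M\<^sub>3 \<and> (\<exists>s\<in>carrier M\<^sub>3. x - triple (triple s) \<in> D)"
  unfolding B9.N_def mem_Collect_eq using tensor_proj_9_eq_one_iff[of x] by blast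

lemma inclusion_tensor_proj:
  assumes x: "x \<in> carrier M\<^sub>3"
  shows "tensor_map M\<^sub>4 (Zmod 9) (\<lambda>m. m) (\<lambda>k. 3 * k) (tensor_proj 3 x) = tensor_proj 9 (triple x)"
proof -
  have "(\<lambda>k. 3 * k) \<in> hom (Zmod 3) (Zmod 9)"
    by (rule homI) (auto simp: carrier_integer_mod_group mult_mod_right)
  moreover have "(\<lambda>m. m) \<in> hom M\<^sub>4 M\<^sub>4" by (rule homI) simp_all
  moreover have "proj x \<in> carrier M\<^sub>4" using x by (simp add: carrier_M\<^sub>4)
  ultimately show ?thesis
    using tensor_map_tensor1[OF comm_group_M\<^sub>4 comm_group_M\<^sub>4, of 3 9 "\<lambda>m. m" "\<lambda>k. 3 * k" "proj x"] x
    by (simp add: proj_pow3)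
qed

lemma reduction_tensor_proj:
  assumes x: "x \<in> carrier M\<^sub>3"
  shows "tensor_map M\<^sub>4 (Zmod 3) (\<lambda>m. m) (\<lambda>k. k mod 3) (tensor_proj 9 x) = tensor_proj 3 x"
proof -
  interpret M4: comm_group M\<^sub>4 by (rule comm_group_M\<^sub>4)
    have "(\<lambda>k. k mod 3) \<in> hom (Zmod 9) (Zmod 3)"
    by (rule homI) (auto simp: carrier_integer_mod_group mod_mod_cancel mod_simps)
  moreover have "(\<lambda>m. m) \<in> hom M\<^sub>4 M\<^sub>4" by (rule homI) simp_all
  moreover have "proj x \<in> carrier M\<^sub>4" using x by (simp add: carrier_M\<^sub>4)
  ultimately show ?thesis
    using tensor_map_tensor1[OF comm_group_M\<^sub>4 comm_group_M\<^sub>4, of 9 3 "\<lambda>m. m" "\<lambda>k. k mod 3" "proj x"] x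
    by (simp add: pow1 comm_group_M\<^sub>3 comm_group_M\<^sub>4)
qed

sublocale h: presentation_map G T act "tensor_product M\<^sub>4 (Zmod 3)" "tensor_act M\<^sub>4 (Zmod 3) act4" "carrier M\<^sub>3" "tensor_proj 3"
   act "tensor_product M\<^sub>3 (Zmod 3)" "tensor_act M\<^sub>3 (Zmod 3) act" "carrier M\<^sub>3" "tensor1 M\<^sub>3 3"
   "tensor_map M\<^sub>3 (Zmod 3) h\<^sub>3 (\<lambda>k. k)" h3lift
proof
  show "h3lift x \<in> carrier M\<^sub>3" if "x \<in> carrier M\<^sub>3" for x using h3lift_M\<^sub>3[OF that] .
  show "h3lift (x + y) = h3lift x + h3lift y" for x y by (rule h3lift_add)
  show "h3lift (act \<gamma> x) = act \<gamma> (h3lift x)" for \<gamma> x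
    by (simp add: act_M\<^sub>3_def h3lift_smult)
  fix x assume x: "x \<in> carrier M\<^sub>3"
    have "h\<^sub>3 \<in> hom M\<^sub>4 M\<^sub>3"
  proof (rule homI)
    fix a b assume "a \<in> carrier M\<^sub>4" "b \<in> carrier M\<^sub>4"
    then obtain a' b' where ab: "a' \<in> carrier M\<^sub>3" "b' \<in> carrier M\<^sub>3" "a = proj a'" "b = proj b'"
      unfolding carrier_M\<^sub>4 by blast
    have "h\<^sub>3 (proj a' \<otimes>\<^bsub>M\<^sub>4\<^esub> proj b') = h3lift (a' + b')"
      using ab by (simp add: h\<^sub>3_proj flip: proj_add)
    then show "h\<^sub>3 (a \<otimes>\<^bsub>M\<^sub>4\<^esub> b) = h\<^sub>3 a \<otimes>\<^bsub>M\<^sub>3\<^esub> h\<^sub>3 b"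
      using ab by (simp add: h\<^sub>3_proj h3lift_add)
  qed (auto simp: carrier_M\<^sub>4 h\<^sub>3_proj h3lift_M\<^sub>3)
  moreover have "(\<lambda>k. k) \<in> hom (Zmod 3) (Zmod 3)" by (rule homI) simp_all
  moreover have "proj x \<in> carrier M\<^sub>4" using x by (simp add: carrier_M\<^sub>4)
  ultimately show "tensor_map M\<^sub>3 (Zmod 3) h\<^sub>3 (\<lambda>k. k) (tensor_proj 3 x) = tensor1 M\<^sub>3 3 (h3lift x)"
    using tensor_map_tensor1[OF comm_group_M\<^sub>4 comm_group_M\<^sub>3, of 3 3 h\<^sub>3 "\<lambda>k. k" "proj x"] h3lift_M\<^sub>3[OF x]
    by (simp add: h\<^sub>3_proj pow1 comm_group_M\<^sub>3 comm_group_M\<^sub>4)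
qed

end

section \<open>The Bockstein map of $\mathcal{M}_4$\<close>

lemma triple_add: "triple (x + y) = triple x + triple y" and triple_diff: "triple (x - y) = triple x - triple y"
  by (simp_all add: triple_def algebra_simps)

lemma triple_zg4_inj: "triple x = triple y \<Longrightarrow> x = (y::zg4)"
  by (cases x; cases y) (auto simp: triple_def intro: triple_zg_inj[unfolded triple_def])

context two_characters
begin

lemma codiff_triple: "g \<in> tuples G (Suc n) \<Longrightarrow> codiff G act n (\<lambda>g. triple (f g)) g = triple (codiff G act n f g)"
  by (simp only: triple_def M.codiff_add)

lemma codiff_D: "g \<in> tuples G (Suc n) \<Longrightarrow> (\<And>g. g \<in> tuples G n \<Longrightarrow> f g \<in> D) \<Longrightarrow> codiff G act n f g \<in> D"
  by (rule M.codiff_closed) (auto intro: D_0 D_add D_minus act_D)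

text \<open>
  A chosen element \<open>s\<close> of \<open>M\<^sub>3\<close> with \<open>x = 3 s\<close> in \<open>M\<^sub>4\<close>. As a fixed function of \<open>x\<close> it maps locally
  constant cochains to locally constant cochains.
\<close>

definition third :: "zg4 \<Rightarrow> zg4" where
  "third x = (SOME s. s \<in> carrier M\<^sub>3 \<and> x - triple s \<in> D)"

lemma third: "x \<in> B3.N \<Longrightarrow> third x \<in> carrier M\<^sub>3 \<and> x - triple (third x) \<in> D"
  unfolding third_def N_B3 by (rule someI_ex) blast

text \<open>
  The Bockstein image is the value of \<^const>\<open>the_elem\<close> on the set of classes of all cochains obtained
  by lifting. The cochain \<open>B\<close> shows that this set is not empty (\<open>ex\<close>); that all its members agree
  (\<open>uniq\<close>) uses that \<open>M\<^sub>4\<close> has no 3-torsion.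
\<close>

lemma bockstein_coh_class:
  assumes F: "F \<in> B3.lifts m" and FN: "\<forall>g\<in>tuples G (Suc m). codiff G act m F g \<in> B3.N"
    and B: "B = (\<lambda>g. third (codiff G act m F g))"
  shows "bockstein G T M\<^sub>4 act4 m (B3.coh_class m F) = B3.coh_class (Suc m) B"
proof -
  let ?b3 = "tensor_product M\<^sub>4 (Zmod 3)" and ?b9 = "tensor_product M\<^sub>4 (Zmod 9)"
  let ?act3 = "tensor_act M\<^sub>4 (Zmod 3) act4" and ?act9 = "tensor_act M\<^sub>4 (Zmod 9) act4"
  let ?inc = "tensor_map M\<^sub>4 (Zmod 9) (\<lambda>m. m) (\<lambda>k. 3 * k)"
  let ?red = "tensor_map M\<^sub>4 (Zmod 3) (\<lambda>m. m) (\<lambda>k. k mod 3)"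
  have FS: "F g \<in> carrier M\<^sub>3" if "g \<in> tuples G m" for g
    using F that by (auto simp: B3.lifts_def)
  have BD: "B g \<in> carrier M\<^sub>3 \<and> codiff G act m F g - triple (B g) \<in> D" if "g \<in> tuples G (Suc m)" for g
    unfolding B using third FN that by blast
  have BS: "B g \<in> carrier M\<^sub>3" if "g \<in> tuples G (Suc m)" for g
    using BD[OF that] by blast
  have dFS: "codiff G act m F g \<in> carrier M\<^sub>3" if "g \<in> tuples G (Suc m)" for g
    using B3.codiff_in_S[OF that FS] .
  have Blat: "B \<in> B3.lifts (Suc m)"
  proof -
    have "loc_const (power_topology T (Suc m)) (codiff G act m F)"
      using F by (intro M.loc_const_codiff) (simp add: B3.lifts_def)
    then have "loc_const (power_topology T (Suc m)) B"
      unfolding B by (rule loc_const_map)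
    then show ?thesis using BS by (simp add: B3.lifts_def)
  qed
  have dB: "codiff G act (Suc m) B g \<in> B3.N" if g: "g \<in> tuples G (Suc (Suc m))" for g
  proof -
    have "codiff G act (Suc m) (\<lambda>g. codiff G act m F g - triple (B g)) g \<in> D"
      using g by (rule codiff_D) (use BD in blast)
    then have "- triple (codiff G act (Suc m) B g) \<in> D"
      by (simp only: M.codiff_diff[OF g] M.codiff_codiff[OF g] codiff_triple[OF g] diff_0)
    then have "triple (codiff G act (Suc m) B g) \<in> D"
      using D_minus by fastforce
    then have "codiff G act (Suc m) B g \<in> D" by (rule D_torsion_free)
    then show ?thesis
      unfolding N_B3 using B3.codiff_in_S[OF g BS] M\<^sub>3_0 by (auto simp: triple_def intro!: bexI[of _ 0])
  qed
  define P where "P b e f \<longleftrightarrow> f \<in> B3.coh_class m F \<and> e \<in> cochains G T ?b9 m \<and> b \<in> cocycles G T ?b3 ?act3 (Suc m) \<and>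
       (\<forall>g\<in>tuples G m. ?red (e g) = f g) \<and> (\<forall>g\<in>tuples G (Suc m). ?inc (b g) = coboundary G ?b9 ?act9 m e g)" for b e f
  have ex: "P (B3.reduce (Suc m) B) (B9.reduce m F) (B3.reduce m F)"
    unfolding P_def
  proof (intro conjI ballI)
    show "B3.reduce m F \<in> B3.coh_class m F" by (rule B3.reduce_in_coh_class)
    show "B9.reduce m F \<in> cochains G T ?b9 m"
      using F by (intro B9.reduce_in_cochains) (simp add: B3.lifts_def B9.lifts_def)
    show "B3.reduce (Suc m) B \<in> cocycles G T ?b3 ?act3 (Suc m)"
      using B3.reduce_in_cocycles_iff[OF Blat] dB by blast
    show "?red (B9.reduce m F g) = B3.reduce m F g" if "g \<in> tuples G m" for g
      using that by (simp only: B9.reduce_def B3.reduce_def restrict_apply'[OF that] reduction_tensor_proj[OF FS])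
    fix g assume g: "g \<in> tuples G (Suc m)"
    have "?inc (B3.reduce (Suc m) B g) = tensor_proj 9 (triple (B g))"
      by (simp only: B3.reduce_def restrict_apply'[OF g] inclusion_tensor_proj[OF BS[OF g]])
    also have "\<dots> = tensor_proj 9 (codiff G act m F g)"
    proof -
      have "proj (triple (B g)) = proj (codiff G act m F g)"
        unfolding proj_eq_iff using BD[OF g] D_minus[of "codiff G act m F g - triple (B g)"] by simp
      then show ?thesis by (simp only:)
    qed
    also have "\<dots> = coboundary G ?b9 ?act9 m (B9.reduce m F) g"
      by (simp only: B9.coboundary_reduce[OF FS]) (simp only: B9.reduce_def restrict_apply'[OF g])
    finally show "?inc (B3.reduce (Suc m) B g) = coboundary G ?b9 ?act9 m (B9.reduce m F) g" .
  qed
  have uniq: "r_coset (cochain_group G T ?b3 (Suc m)) (coboundaries G T ?b3 ?act3 (Suc m)) b = B3.coh_class (Suc m) B"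
    if P: "P b e f" for b e f
  proof -
    have "b \<in> cochains G T ?b3 (Suc m)" "e \<in> cochains G T ?b9 m"
      using P by (simp_all add: P_def cocycles_def)
    then obtain B' E where B': "B' \<in> B3.lifts (Suc m)" "b = B3.reduce (Suc m) B'" and E: "E \<in> B9.lifts m" "e = B9.reduce m E"
      using B3.cochains_lift B9.cochains_lift by metis
    have B'S: "B' g \<in> carrier M\<^sub>3" if "g \<in> tuples G (Suc m)" for g
      using B'(1) that by (auto simp: B3.lifts_def)
    have ES: "E g \<in> carrier M\<^sub>3" if "g \<in> tuples G m" for g
      using E(1) that by (auto simp: B9.lifts_def)
    \<comment> \<open>The reduction of \<open>E\<close> is \<open>f\<close>, which is cohomologous to that of \<open>F\<close>.\<close>
    have "B3.null m (\<lambda>g. E g - F g)"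
    proof (rule B3.coh_class_memD[OF FS ES])
      have "f \<in> extensional (tuples G m)"
        using P unfolding P_def B3.coh_class_def B3.reduce_def by auto
      moreover have "f g = B3.reduce m E g" if g: "g \<in> tuples G m" for g
      proof -
        have "f g = ?red (e g)" using P g unfolding P_def by simp
        also have "\<dots> = B3.reduce m E g"
          by (simp only: E(2) B9.reduce_def B3.reduce_def restrict_apply'[OF g] reduction_tensor_proj[OF ES[OF g]])
        finally show ?thesis .
      qed
      ultimately have "f = B3.reduce m E"
        by (intro extensionalityI[of f "tuples G m"]) (simp_all add: B3.reduce_def)
      then show "B3.reduce m E \<in> B3.coh_class m F" using P by (simp add: P_def)
    qed
    then obtain Y where Y: "Y \<in> B3.lifts m" "\<And>g. g \<in> tuples G m \<Longrightarrow> E g - F g - Y g \<in> B3.N"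
      and dY: "\<And>g. g \<in> tuples G (Suc m) \<Longrightarrow> codiff G act m Y g = 0"
    proof (cases m)
      case 0
      assume "B3.null m (\<lambda>g. E g - F g)"
      then have "E g - F g - 0 \<in> B3.N" if "g \<in> tuples G m" for g
        using that 0 by (simp add: B3.null_def del: lessThan_0)
      then show ?thesis
        by (rule that[OF B3.lifts_0 _ B3.codiff_zero])
    next
      case (Suc l)
      assume "B3.null m (\<lambda>g. E g - F g)"
      then obtain K where K: "K \<in> B3.lifts l" "\<And>g. g \<in> tuples G m \<Longrightarrow> E g - F g - codiff G act l K g \<in> B3.N"
        unfolding B3.null_def Suc by auto
      show ?thesis
        by (rule that[of "codiff G act l K"]) (use K B3.codiff_lifts[OF K(1)] M.codiff_codiff Suc in auto)
    qed
    define Z where "Z g = third (E g - F g - Y g)" for g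
    have ZD: "Z g \<in> carrier M\<^sub>3 \<and> E g - F g - Y g - triple (Z g) \<in> D" if "g \<in> tuples G m" for g
      unfolding Z_def using third Y(2)[OF that] by blast
    have Zlat: "Z \<in> B3.lifts m"
    proof -
      have "loc_const (power_topology T m) (\<lambda>g. E g - F g - Y g)"
        using loc_const_map2[OF loc_const_map2[of _ E F "(-)"], of _ Y "(-)"] E(1) F Y(1) by (simp add: B3.lifts_def B9.lifts_def)
      then have "loc_const (power_topology T m) Z"
        unfolding Z_def[abs_def] by (rule loc_const_map)
      then show ?thesis using ZD by (simp add: B3.lifts_def)
    qed
    have "B' g - B g - codiff G act m Z g \<in> B3.N" if g: "g \<in> tuples G (Suc m)" for g
    proof -
      have "codiff G act m (\<lambda>g. E g - F g - Y g - triple (Z g)) g \<in> D"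
        using g by (rule codiff_D) (use ZD in blast)
      then have 1: "codiff G act m E g - codiff G act m F g - triple (codiff G act m Z g) \<in> D"
        by (simp only: M.codiff_diff[OF g] codiff_triple[OF g] dY[OF g] diff_0_right)
      have dES: "codiff G act m E g \<in> carrier M\<^sub>3"
        using g ES by (rule B9.codiff_in_S)
      have "tensor_proj 9 (triple (B' g)) = ?inc (b g)"
        by (simp only: B'(2) B3.reduce_def restrict_apply'[OF g] inclusion_tensor_proj[OF B'S[OF g]])
      also have "\<dots> = coboundary G ?b9 ?act9 m e g"
        using P g unfolding P_def by simp
      also have "\<dots> = tensor_proj 9 (codiff G act m E g)"
        by (simp only: E(2) B9.coboundary_reduce[OF ES]) (simp only: B9.reduce_def restrict_apply'[OF g])
      finally have "triple (B' g) - codiff G act m E g \<in> B9.N"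
        by (rule iffD1[OF B9.j_eq_iff[OF triple_M\<^sub>3[OF B'S[OF g]] dES]])
      then obtain s where s: "s \<in> carrier M\<^sub>3" "triple (B' g) - codiff G act m E g - triple (triple s) \<in> D"
        unfolding N_B9 by blast
      \<comment> \<open>The three brackets are \<open>\<iota> b = \<delta> e\<close>, the coboundary of the choice of \<open>Z\<close>, and the choice of \<open>B\<close>.\<close>
      have "triple (B' g - B g - codiff G act m Z g - triple s)
         = (triple (B' g) - codiff G act m E g - triple (triple s))
         + (codiff G act m E g - codiff G act m F g - triple (codiff G act m Z g))
         + (codiff G act m F g - triple (B g))"
        by (simp add: triple_diff)
      also have "\<dots> \<in> D"
        using D_add[OF D_add[OF s(2) 1]] BD[OF g] by blast
      finally have "B' g - B g - codiff G act m Z g - triple s \<in> D" by (rule D_torsion_free)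
      moreover have "B' g - B g - codiff G act m Z g \<in> carrier M\<^sub>3"
        using B'S[OF g] BS[OF g] B3.codiff_lifts[OF Zlat] g by (intro B3.S_diff) (auto simp: B3.lifts_def)
      ultimately show ?thesis
        unfolding N_B3 using s(1) by blast
    qed
    then have "B3.null (Suc m) (\<lambda>g. B' g - B g)"
      unfolding B3.null_def using Zlat by auto
    then show ?thesis
      using B'S BS by (simp add: B'(2) B3.coset_eq B3.coh_class_eq_iff)
  qed
  have "{r_coset (cochain_group G T ?b3 (Suc m)) (coboundaries G T ?b3 ?act3 (Suc m)) b | b e f. P b e f}
      = {B3.coh_class (Suc m) B}"
    using ex uniq by blast
  then show ?thesis
    unfolding bockstein_def connecting_map_def P_def by simp
qed

theorem h\<^sub>3_bockstein_eq_one: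
  assumes c: "c \<in> carrier (cohomology G T (tensor_product M\<^sub>4 (Zmod 3)) (tensor_act M\<^sub>4 (Zmod 3) act4) m)"
  shows "h\<^sub>3_cohomology G T chi1 chi2 (Suc m) (bockstein G T M\<^sub>4 act4 m c)
    = \<one>\<^bsub>cohomology G T (tensor_product M\<^sub>3 (Zmod 3)) (tensor_act M\<^sub>3 (Zmod 3) act) (Suc m)\<^esub>"
proof -
  obtain F where F: "F \<in> B3.lifts m" "\<forall>g\<in>tuples G (Suc m). codiff G act m F g \<in> B3.N" "c = B3.coh_class m F"
    using c unfolding B3.carrier_cohomology by blast
  define B where "B = (\<lambda>g. third (codiff G act m F g))"
  have FS: "F g \<in> carrier M\<^sub>3" if "g \<in> tuples G m" for g
    using F that by (auto simp: B3.lifts_def)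
  have BD: "B g \<in> carrier M\<^sub>3 \<and> codiff G act m F g - triple (B g) \<in> D" if "g \<in> tuples G (Suc m)" for g
    unfolding B_def using third F(2) that by blast
  have du: "codiff G act m (\<lambda>g. h3lift (F g)) g = triple (h3lift (B g))" if g: "g \<in> tuples G (Suc m)" for g
  proof -
    have "h3lift (codiff G act m F g) = h3lift (codiff G act m F g - triple (B g)) + h3lift (triple (B g))"
      by (simp flip: h3lift_add)
    then show ?thesis
      using h.\<psi>_diff_comm[OF g FS] h3lift_D BD[OF g] by (simp add: triple_def h3lift_add)
  qed
  have u: "loc_const (power_topology T m) (\<lambda>g. h3lift (F g))"
    using loc_const_map[of _ F h3lift] F(1) by (simp add: B3.lifts_def)
  have u': "codiff G act m (\<lambda>g. h3lift (F g)) g \<in> triple ` carrier M\<^sub>3" if g: "g \<in> tuples G (Suc m)" for g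
    unfolding du[OF g] using BD[OF g] h3lift_M\<^sub>3 by blast
  have "\<exists>z. loc_const (power_topology T m) z \<and> (\<forall>g\<in>tuples G m. z g \<in> carrier M\<^sub>3) \<and>
      (\<forall>g\<in>tuples G (Suc m). codiff G act m (\<lambda>g. h3lift (F g)) g + triple (codiff G act m z g)
        \<in> triple ` triple ` carrier M\<^sub>3)"
    by (rule bockstein_vanishes_M\<^sub>3[unfolded bockstein_vanishes_def, rule_format])
      (intro conjI ballI u u' h3lift_M\<^sub>3 FS)
  then obtain z where z0: "loc_const (power_topology T m) z \<and> (\<forall>g\<in>tuples G m. z g \<in> carrier M\<^sub>3) \<and>
      (\<forall>g\<in>tuples G (Suc m). codiff G act m (\<lambda>g. h3lift (F g)) g + triple (codiff G act m z g)
        \<in> triple ` triple ` carrier M\<^sub>3)"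
    by (rule exE)
  note z = conjunct1[OF z0] conjunct1[OF conjunct2[OF z0], THEN bspec] conjunct2[OF conjunct2[OF z0], THEN bspec]
  have "A3.null (Suc m) (\<lambda>g. h3lift (B g))"
  proof -
    have "h3lift (B g) - codiff G act m (\<lambda>g. - z g) g \<in> A3.N" if g: "g \<in> tuples G (Suc m)" for g
    proof -
      obtain t where t: "triple (h3lift (B g)) + triple (codiff G act m z g) = triple t" "t \<in> triple ` carrier M\<^sub>3"
        using z(3)[OF g] unfolding du[OF g] by (rule imageE)
      have "triple (h3lift (B g) + codiff G act m z g) = triple t"
        unfolding triple_add by (rule t(1))
      then have "h3lift (B g) + codiff G act m z g = t"
        by (rule triple_zg4_inj)
      then show ?thesis
        using t(2) unfolding N_A3 M.codiff_minus[OF g] by simp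
    qed
    moreover have "(\<lambda>g. - z g) \<in> A3.lifts m"
      using z(1,2) by (intro A3.lifts_minus) (simp add: A3.lifts_def)
    ultimately show ?thesis
      unfolding A3.null_def by auto
  qed
  then have "\<one>\<^bsub>cohomology G T (tensor_product M\<^sub>3 (Zmod 3)) (tensor_act M\<^sub>3 (Zmod 3) act) (Suc m)\<^esub>
      = A3.coh_class (Suc m) (\<lambda>g. h3lift (B g))"
    by (rule A3.one_cohomology)
  moreover have "h\<^sub>3_cohomology G T chi1 chi2 (Suc m) (B3.coh_class (Suc m) B) = A3.coh_class (Suc m) (\<lambda>g. h3lift (B g))"
    unfolding h\<^sub>3_cohomology_def by (rule h.cohomology_map_coh_class) (use BD in blast)
  ultimately show ?thesis
    unfolding F(3) bockstein_coh_class[OF F(1,2) B_def] by simp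
qed

end

theorem theorem4p6:
  fixes G :: "'a monoid" and T :: "'a topology" and chi1 chi2 :: "'a \<Rightarrow> int" and n :: nat
  assumes "voevodsky_group G T"
    and "character3 G T chi1" and "character3 G T chi2"
    and "independent_characters3 G chi1 chi2"
    and "n \<ge> 1"
    and "c \<in> carrier (cohomology G T (tensor_product M\<^sub>4 (Zmod 3))
                 (tensor_act M\<^sub>4 (Zmod 3) (act_M\<^sub>4 chi1 chi2)) (n - 1))"
  shows "h\<^sub>3_cohomology G T chi1 chi2 n (bockstein G T M\<^sub>4 (act_M\<^sub>4 chi1 chi2) (n - 1) c)
    = \<one>\<^bsub>cohomology G T (tensor_product M\<^sub>3 (Zmod 3))
         (tensor_act M\<^sub>3 (Zmod 3) (act_M\<^sub>3 chi1 chi2)) n\<^esub>"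
proof -
  interpret two_characters G T chi1 chi2
    by unfold_locales (rule assms)+
  have "n = Suc (n - 1)" using assms(5) by simp
  with h\<^sub>3_bockstein_eq_one[OF assms(6)] show ?thesis by metis
qed

end
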